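(* Let $(B_t)$ be a one-dimensional $G^*$-Brownian motion, $(\langle B\rangle_t)$ its quadratic variation, and $\overline\sigma^2=\mathbb{E}^*[\langle B\rangle_1]$, $\underline\sigma^2=\mathbb{E}_*[\langle B\rangle_1]$. Then: (i) $(\langle B\rangle_t)$ is a continuous, increasing process with finite variation and with independent and stationary increments under $\mathbb{E}^*$. (ii) For all $s,t\ge0$ and all continuous $\varphi:\mathbb{R}\to\mathbb{R}$, $$\mathbb{E}^*[\varphi(\langle B\rangle_{t+s}-\langle B\rangle_s)|\mathcal{F}_s]=\sup_{\underline\sigma^2\le\alpha^2\le\overline\sigma^2}\varphi(\alpha^2t),\qquad \mathbb{E}_*[\varphi(\langle B\rangle_{t+s}-\langle B\rangle_s)|\mathcal{F}_s]=\inf_{\underline\sigma^2\le\alpha^2\le\overline\sigma^2}\varphi(\alpha^2t).$$ (iii) For all $0\le t\le T<\infty$, $\underline\sigma^2(T-t)\le\langle B\rangle_T-\langle B\rangle_t\le\overline\sigma^2(T-t)$ q.s. Therefore, for $(\eta_s)$ such that $\int_0^t|\eta_s|^2ds<\infty$ q.s., $$\underline\sigma^2\int_0^t|\eta_s|^2ds\le\int_0^t|\eta_s|^2d\langle B\rangle_s\le\overline\sigma^2\int_0^t|\eta_s|^2ds\quad\text{q.s.}$$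
   Context: $C_{l.Lip}(\mathbb{R}^m)$ is the set of $\varphi:\mathbb{R}^m\to\mathbb{R}$ with $|\varphi(x)-\varphi(y)|\le C(1+|x|^k+|y|^k)|x-y|$ for some $C>0,k\in\mathbb{N}$. $\Omega$ is the space of real-valued continuous paths with $\omega_0=0$, $B_t(\omega)=\omega_t$, $\Omega_t=\{\omega_{\cdot\wedge t}\}$, $\mathcal{F}_t=\mathcal{B}(\Omega_t)$. With $G^*(a)=\frac12\sup_{\underline\sigma\le\sigma\le\overline\sigma}\sigma^2a$, the sublinear $G$-expectation $\mathbb{E}^*$ (Peng) satisfies $\mathbb{E}^*[\varphi(x+B_t)]=u(t,x)$, $u$ the viscosity solution of $\partial_tu-G^*(\partial^2_{xx}u)=0$, $u(0,\cdot)=\varphi\in C_{l.Lip}$; increments of $B$ are stationary and independent of the past, with $\mathbb{E}^*[\varphi(B_{t_1},\dots,B_{t_m}-B_{t_{m-1}})|\mathcal{F}_{t_j}]=\psi(B_{t_1},\dots,B_{t_j}-B_{t_{j-1}})$, $\psi(x_1,\dots,x_j)=\mathbb{E}^*[\varphi(x_1,\dots,x_j,B_{t_{j+1}}-B_{t_j},\dots)]$. ($Y$ is independent of $X$ if $\mathbb{E}^*[\varphi(X,Y)]=\mathbb{E}^*[\mathbb{E}^*[\varphi(x,Y)]_{x=X}]$ for all $\varphi\in C_{l.Lip}$.) These extend continuously to $L_G^1(\Omega)$, the completion of cylinder functionals under $\mathbb{E}^*[|\cdot|]$. Under $\mathbb{E}^*$, $B$ is a $G^*$-Brownian motion. $\mathbb{E}_*[\cdot]=-\mathbb{E}^*[-\cdot]$,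 $\mathbb{E}_*[\cdot|\mathcal{F}_t]=-\mathbb{E}^*[-\cdot|\mathcal{F}_t]$. There is a family $\mathcal{P}$ of probability measures on $(\Omega,\mathcal{B}(\Omega))$ with $\mathbb{E}^*=\sup_{P\in\mathcal{P}}E_P$; q.s. means outside a set $A$ with $\sup_{P\in\mathcal{P}}P(A)=0$. $\langle B\rangle_t$ is the $L_G^2$-limit of $\sum_i(B_{t_{i+1}}-B_{t_i})^2$ over partitions of $[0,t]$ with mesh tending to $0$. *)

theory Defs
  imports "HOL-Probability.Probability"
begin

section \<open>Path space\<close>

text \<open>
  The space \<open>\<Omega>\<close> of continuous real paths on \<open>[0,\<infinity>)\<close> that start at 0. Paths are stored as functions
  on all of \<open>real\<close>; the value 0 at negative times only serves to make the representation unique.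
\<close>

typedef path = "{w :: real \<Rightarrow> real. continuous_on {0..} w \<and> w 0 = 0 \<and> (\<forall>t<0. w t = 0)}"
  morphisms path_at Abs_path
  by (rule exI[of _ "\<lambda>_. 0"]) simp

definition coord :: "real \<Rightarrow> path \<Rightarrow> real" where
  "coord t \<omega> = path_at \<omega> t"

text \<open>
  \<open>\<Omega>\<close> carries the topology of locally uniform convergence; \<open>\<B>(\<Omega>)\<close> is then the library's
  \<open>borel :: path measure\<close>.
\<close>

instantiation path :: topological_space
begin

definition open_path :: "path set \<Rightarrow> bool" where
  "open_path U \<longleftrightarrow>
     (\<forall>\<omega>\<in>U. \<exists>T\<ge>0. \<exists>e>0. \<forall>\<omega>'. (\<forall>t\<in>{0..T}. \<bar>coord t \<omega>' - coord t \<omega>\<bar> < e) \<longrightarrow> \<omega>' \<in> U)"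

instance
proof
  show "open (UNIV :: path set)"
    unfolding open_path_def by (auto intro!: exI[of _ 0] exI[of _ 1])
next
  fix S T :: "path set"
  assume S: "open S" and T: "open T"
  show "open (S \<inter> T)"
    unfolding open_path_def
  proof
    fix \<omega> assume w: "\<omega> \<in> S \<inter> T"
    from w S obtain T1 e1 where 1: "T1 \<ge> 0" "e1 > 0"
      "\<And>\<omega>'. (\<forall>t\<in>{0..T1}. \<bar>coord t \<omega>' - coord t \<omega>\<bar> < e1) \<Longrightarrow> \<omega>' \<in> S"
      unfolding open_path_def by blast
    from w T obtain T2 e2 where 2: "T2 \<ge> 0" "e2 > 0"
      "\<And>\<omega>'. (\<forall>t\<in>{0..T2}. \<bar>coord t \<omega>' - coord t \<omega>\<bar> < e2) \<Longrightarrow> \<omega>' \<in> T"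
      unfolding open_path_def by blast
    show "\<exists>T'\<ge>0. \<exists>e>0. \<forall>\<omega>'. (\<forall>t\<in>{0..T'}. \<bar>coord t \<omega>' - coord t \<omega>\<bar> < e) \<longrightarrow> \<omega>' \<in> S \<inter> T"
    proof (rule exI[of _ "max T1 T2"], rule conjI)
      show "max T1 T2 \<ge> 0" using 1(1) by simp
      show "\<exists>e>0. \<forall>\<omega>'. (\<forall>t\<in>{0..max T1 T2}. \<bar>coord t \<omega>' - coord t \<omega>\<bar> < e) \<longrightarrow> \<omega>' \<in> S \<inter> T"
        using 1(2) 2(2) by (intro exI[of _ "min e1 e2"]) (auto intro!: 1(3) 2(3))
    qed
  qed
next
  fix K :: "path set set"
  assume K: "\<forall>S\<in>K. open S"
  show "open (\<Union>K)"
    unfolding open_path_def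
  proof
    fix \<omega> assume "\<omega> \<in> \<Union>K"
    then obtain S where S: "S \<in> K" "\<omega> \<in> S" by blast
    with K obtain T e where "T \<ge> 0" "e > 0"
      "\<And>\<omega>'. (\<forall>t\<in>{0..T}. \<bar>coord t \<omega>' - coord t \<omega>\<bar> < e) \<Longrightarrow> \<omega>' \<in> S"
      unfolding open_path_def by blast
    with S show "\<exists>T\<ge>0. \<exists>e>0. \<forall>\<omega>'. (\<forall>t\<in>{0..T}. \<bar>coord t \<omega>' - coord t \<omega>\<bar> < e) \<longrightarrow> \<omega>' \<in> \<Union>K"
      by blast
  qed
qed

end


section \<open>Test functions and cylinder functionals\<close>

text \<open>
  \<open>C\<^sub>l\<^sub>.\<^sub>L\<^sub>i\<^sub>p(\<real>\<^sup>m)\<close>. Since \<open>m\<close> varies, vectors in \<open>\<real>\<^sup>m\<close> are lists of length \<open>m\<close>; values of \<open>\<phi>\<close> on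
  lists of other lengths are irrelevant.
\<close>

definition vnorm :: "real list \<Rightarrow> real" where
  "vnorm x = L2_set (\<lambda>i. x ! i) {..<length x}"

definition vdiff :: "real list \<Rightarrow> real list \<Rightarrow> real list" where
  "vdiff x y = map2 (-) x y"

definition C_lLip :: "nat \<Rightarrow> (real list \<Rightarrow> real) set" where
  "C_lLip m = {\<phi>. \<exists>C>0. \<exists>k::nat. \<forall>x y. length x = m \<longrightarrow> length y = m \<longrightarrow>
     \<bar>\<phi> x - \<phi> y\<bar> \<le> C * (1 + vnorm x ^ k + vnorm y ^ k) * vnorm (vdiff x y)}"

text \<open>
  \<open>increments r [t\<^sub>1,\<dots>,t\<^sub>m]\<close> is the vector \<open>(B\<^sub>t\<^sub>1 - B\<^sub>r, B\<^sub>t\<^sub>2 - B\<^sub>t\<^sub>1, \<dots>)\<close>. For \<open>r = 0\<close> the first entry is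
  \<open>B\<^sub>t\<^sub>1\<close>, because paths start at 0.
\<close>

primrec increments :: "real \<Rightarrow> real list \<Rightarrow> path \<Rightarrow> real list" where
  "increments r [] \<omega> = []"
| "increments r (t # ts) \<omega> = (coord t \<omega> - coord r \<omega>) # increments t ts \<omega>"

definition times :: "real list \<Rightarrow> bool" where
  "times ts \<longleftrightarrow> sorted ts \<and> (\<forall>t\<in>set ts. 0 \<le> t)"

definition cylinder :: "(path \<Rightarrow> real) \<Rightarrow> bool" where
  "cylinder X \<longleftrightarrow> (\<exists>ts \<phi>. times ts \<and> \<phi> \<in> C_lLip (length ts) \<and> X = (\<lambda>\<omega>. \<phi> (increments 0 ts \<omega>)))"


section \<open>Sublinear expectation represented by a family of measures\<close>

definition upper_exp :: "path measure set \<Rightarrow> (path \<Rightarrow> real) \<Rightarrow> real" where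
  "upper_exp \<P> X = (SUP P\<in>\<P>. \<integral>\<omega>. X \<omega> \<partial>P)"

definition lower_exp :: "path measure set \<Rightarrow> (path \<Rightarrow> real) \<Rightarrow> real" where
  "lower_exp \<P> X = - upper_exp \<P> (\<lambda>\<omega>. - X \<omega>)"

text \<open>
  \<open>\<E>\<^sup>*[|X|\<^sup>p]\<close> with values in \<open>[0,\<infinity>]\<close>, so that non-integrable \<open>X\<close> are not assigned a spurious value.
\<close>

definition upper_moment :: "path measure set \<Rightarrow> nat \<Rightarrow> (path \<Rightarrow> real) \<Rightarrow> ennreal" where
  "upper_moment \<P> p X = (SUP P\<in>\<P>. \<integral>\<^sup>+\<omega>. ennreal (\<bar>X \<omega>\<bar> ^ p) \<partial>P)"

definition quasi_surely :: "path measure set \<Rightarrow> (path \<Rightarrow> bool) \<Rightarrow> bool" where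
  "quasi_surely \<P> R \<longleftrightarrow>
     (\<exists>A\<in>sets borel. (SUP P\<in>\<P>. emeasure P A) = 0 \<and> (\<forall>\<omega>. \<omega> \<notin> A \<longrightarrow> R \<omega>))"

text \<open>
  The completion of the cylinder functionals under \<open>\<E>\<^sup>*[|\<cdot>|\<^sup>p]\<^sup>1\<^sup>/\<^sup>p\<close>, realised by Borel functions: the
  quotient of the Borel functions with finite \<open>p\<close>-th upper moment by quasi-sure equality is complete,
  so the completion is the closure in it.
\<close>

definition L_G :: "path measure set \<Rightarrow> nat \<Rightarrow> (path \<Rightarrow> real) set" where
  "L_G \<P> p = {X \<in> borel_measurable borel.
     \<exists>X'. (\<forall>n::nat. cylinder (X' n)) \<and> (\<lambda>n. upper_moment \<P> p (\<lambda>\<omega>. X' n \<omega> - X \<omega>)) \<longlonglongrightarrow> 0}"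


section \<open>Stationary and independent increments\<close>

definition independent_of ::
  "path measure set \<Rightarrow> nat \<Rightarrow> (path \<Rightarrow> real list) \<Rightarrow> nat \<Rightarrow> (path \<Rightarrow> real list) \<Rightarrow> bool" where
  "independent_of \<P> n Y m X \<longleftrightarrow> (\<forall>\<phi>\<in>C_lLip (m + n).
     upper_exp \<P> (\<lambda>\<omega>. \<phi> (X \<omega> @ Y \<omega>)) =
     upper_exp \<P> (\<lambda>\<omega>. upper_exp \<P> (\<lambda>\<omega>'. \<phi> (X \<omega> @ Y \<omega>'))))"

definition identically_distributed ::
  "path measure set \<Rightarrow> nat \<Rightarrow> (path \<Rightarrow> real list) \<Rightarrow> (path \<Rightarrow> real list) \<Rightarrow> bool" where
  "identically_distributed \<P> n X Y \<longleftrightarrow>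
     (\<forall>\<phi>\<in>C_lLip n. upper_exp \<P> (\<lambda>\<omega>. \<phi> (X \<omega>)) = upper_exp \<P> (\<lambda>\<omega>. \<phi> (Y \<omega>)))"

definition stationary_increments :: "path measure set \<Rightarrow> (real \<Rightarrow> path \<Rightarrow> real) \<Rightarrow> bool" where
  "stationary_increments \<P> X \<longleftrightarrow> (\<forall>s\<ge>0. \<forall>t\<ge>0.
     identically_distributed \<P> 1 (\<lambda>\<omega>. [X (s + t) \<omega> - X s \<omega>]) (\<lambda>\<omega>. [X t \<omega> - X 0 \<omega>]))"

definition independent_increments :: "path measure set \<Rightarrow> (real \<Rightarrow> path \<Rightarrow> real) \<Rightarrow> bool" where
  "independent_increments \<P> X \<longleftrightarrow> (\<forall>s\<ge>0. \<forall>t\<ge>0. \<forall>ts. times ts \<and> (\<forall>r\<in>set ts. r \<le> s) \<longrightarrow>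
     independent_of \<P> 1 (\<lambda>\<omega>. [X (s + t) \<omega> - X s \<omega>]) (length ts) (\<lambda>\<omega>. map (\<lambda>r. X r \<omega>) ts))"


section \<open>The \<open>G\<close>-heat equation and \<open>G\<close>-Brownian motion\<close>

definition G_fun :: "real \<Rightarrow> real \<Rightarrow> real \<Rightarrow> real" where
  "G_fun \<sigma>l \<sigma>u a = (1/2) * (SUP \<sigma>\<in>{\<sigma>l..\<sigma>u}. \<sigma>\<^sup>2 * a)"

text \<open>\<open>f\<close> is of class \<open>C\<^sup>1\<^sup>,\<^sup>2\<close> on \<open>(0,\<infinity>) \<times> \<real>\<close> with \<open>\<partial>\<^sub>tf = ft\<close>, \<open>\<partial>\<^sub>xf = fx\<close>, \<open>\<partial>\<^sup>2\<^sub>x\<^sub>xf = fxx\<close>.\<close>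

definition C12 ::
  "(real \<Rightarrow> real \<Rightarrow> real) \<Rightarrow> (real \<Rightarrow> real \<Rightarrow> real) \<Rightarrow> (real \<Rightarrow> real \<Rightarrow> real) \<Rightarrow> (real \<Rightarrow> real \<Rightarrow> real) \<Rightarrow> bool"
where
  "C12 f ft fx fxx \<longleftrightarrow>
     (\<forall>t>0. \<forall>x. ((\<lambda>s. f s x) has_real_derivative ft t x) (at t) \<and>
               (f t has_real_derivative fx t x) (at x) \<and>
               (fx t has_real_derivative fxx t x) (at x)) \<and>
     (\<forall>g\<in>{f, ft, fx, fxx}. continuous_on ({0<..} \<times> UNIV) (\<lambda>(t, x). g t x))"

definition local_max_at :: "(real \<Rightarrow> real \<Rightarrow> real) \<Rightarrow> real \<Rightarrow> real \<Rightarrow> bool" where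
  "local_max_at h t x \<longleftrightarrow> (\<forall>\<^sub>F (s, y) in nhds (t, x). h s y \<le> h t x)"

definition viscosity_subsolution :: "(real \<Rightarrow> real) \<Rightarrow> (real \<Rightarrow> real \<Rightarrow> real) \<Rightarrow> bool" where
  "viscosity_subsolution G u \<longleftrightarrow>
     (\<forall>f ft fx fxx. C12 f ft fx fxx \<longrightarrow>
       (\<forall>t>0. \<forall>x. local_max_at (\<lambda>s y. u s y - f s y) t x \<longrightarrow> ft t x - G (fxx t x) \<le> 0))"

definition viscosity_supersolution :: "(real \<Rightarrow> real) \<Rightarrow> (real \<Rightarrow> real \<Rightarrow> real) \<Rightarrow> bool" where
  "viscosity_supersolution G u \<longleftrightarrow>
     (\<forall>f ft fx fxx. C12 f ft fx fxx \<longrightarrow>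
       (\<forall>t>0. \<forall>x. local_max_at (\<lambda>s y. f s y - u s y) t x \<longrightarrow> ft t x - G (fxx t x) \<ge> 0))"

definition viscosity_solution ::
  "(real \<Rightarrow> real) \<Rightarrow> (real \<Rightarrow> real) \<Rightarrow> (real \<Rightarrow> real \<Rightarrow> real) \<Rightarrow> bool" where
  "viscosity_solution G \<phi> u \<longleftrightarrow>
     continuous_on ({0..} \<times> UNIV) (\<lambda>(t, x). u t x) \<and> (\<forall>x. u 0 x = \<phi> x) \<and>
     viscosity_subsolution G u \<and> viscosity_supersolution G u"

text \<open>
  The standing setting: \<open>\<P>\<close> is a family of probability measures on \<open>(\<Omega>, \<B>(\<Omega>))\<close> whose upper expectation
  is the \<open>G\<close>-expectation on cylinder functionals.
\<close>

definition G_Brownian_motion :: "real \<Rightarrow> real \<Rightarrow> path measure set \<Rightarrow> bool" where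
  "G_Brownian_motion \<sigma>l \<sigma>u \<P> \<longleftrightarrow>
     0 \<le> \<sigma>l \<and> \<sigma>l \<le> \<sigma>u \<and>
     \<P> \<noteq> {} \<and> (\<forall>P\<in>\<P>. prob_space P \<and> sets P = sets borel) \<and>
     (\<forall>X. cylinder X \<longrightarrow> upper_moment \<P> 1 X < \<infinity>) \<and>
     (\<forall>\<phi>\<in>C_lLip 1. viscosity_solution (G_fun \<sigma>l \<sigma>u) (\<lambda>x. \<phi> [x])
        (\<lambda>t x. upper_exp \<P> (\<lambda>\<omega>. \<phi> [x + coord t \<omega>]))) \<and>
     stationary_increments \<P> coord \<and> independent_increments \<P> coord"


section \<open>Conditional expectation\<close>

text \<open>
  On cylinder functionals: \<open>us\<close> are the times \<open>t\<^sub>1 \<le> \<dots> \<le> t\<^sub>j = s\<close>, \<open>vs\<close> the later ones.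
\<close>

definition cylinder_cond_exp ::
  "path measure set \<Rightarrow> real \<Rightarrow> (path \<Rightarrow> real) \<Rightarrow> (path \<Rightarrow> real) \<Rightarrow> bool" where
  "cylinder_cond_exp \<P> s X Y \<longleftrightarrow> (\<exists>us vs \<phi>.
     times (us @ vs) \<and> us \<noteq> [] \<and> last us = s \<and> \<phi> \<in> C_lLip (length (us @ vs)) \<and>
     X = (\<lambda>\<omega>. \<phi> (increments 0 (us @ vs) \<omega>)) \<and>
     Y = (\<lambda>\<omega>. upper_exp \<P> (\<lambda>\<omega>'. \<phi> (increments 0 us \<omega> @ increments s vs \<omega>'))))"

text \<open>
  \<open>Y\<close> is a version of \<open>\<E>\<^sup>*[X | \<F>\<^sub>s]\<close> for \<open>X \<in> L\<^sub>G\<^sup>1\<close>: the graph of the continuous extension is the closure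
  of the graph of the conditional expectation on cylinder functionals. As the latter is a contraction,
  \<open>Y\<close> is determined up to quasi-sure equality.
\<close>

definition is_cond_exp ::
  "path measure set \<Rightarrow> real \<Rightarrow> (path \<Rightarrow> real) \<Rightarrow> (path \<Rightarrow> real) \<Rightarrow> bool" where
  "is_cond_exp \<P> s X Y \<longleftrightarrow> X \<in> L_G \<P> 1 \<and> Y \<in> L_G \<P> 1 \<and>
     (\<exists>X' Y'. (\<forall>n::nat. cylinder_cond_exp \<P> s (X' n) (Y' n)) \<and>
        (\<lambda>n. upper_moment \<P> 1 (\<lambda>\<omega>. X' n \<omega> - X \<omega>)) \<longlonglongrightarrow> 0 \<and>
        (\<lambda>n. upper_moment \<P> 1 (\<lambda>\<omega>. Y' n \<omega> - Y \<omega>)) \<longlonglongrightarrow> 0)"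

definition is_lower_cond_exp ::
  "path measure set \<Rightarrow> real \<Rightarrow> (path \<Rightarrow> real) \<Rightarrow> (path \<Rightarrow> real) \<Rightarrow> bool" where
  "is_lower_cond_exp \<P> s X Y \<longleftrightarrow> is_cond_exp \<P> s (\<lambda>\<omega>. - X \<omega>) (\<lambda>\<omega>. - Y \<omega>)"


section \<open>Quadratic variation\<close>

definition partition_of :: "real \<Rightarrow> real list \<Rightarrow> bool" where
  "partition_of t ts \<longleftrightarrow> ts \<noteq> [] \<and> sorted ts \<and> hd ts = 0 \<and> last ts = t"

definition mesh_le :: "real list \<Rightarrow> real \<Rightarrow> bool" where
  "mesh_le ts d \<longleftrightarrow> (\<forall>i. Suc i < length ts \<longrightarrow> ts ! Suc i - ts ! i \<le> d)"

definition sum_squares :: "real list \<Rightarrow> path \<Rightarrow> real" where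
  "sum_squares ts \<omega> = (\<Sum>i<length ts - 1. (coord (ts ! Suc i) \<omega> - coord (ts ! i) \<omega>)\<^sup>2)"

text \<open>
  The defining limit fixes each \<open>Q t\<close> only up to quasi-sure equality, hence this says that \<open>Q\<close> is some
  version of \<open>\<langle>B\<rangle>\<close>; path properties are a matter of choosing a good version.
\<close>

definition is_quadratic_variation :: "path measure set \<Rightarrow> (real \<Rightarrow> path \<Rightarrow> real) \<Rightarrow> bool" where
  "is_quadratic_variation \<P> Q \<longleftrightarrow> (\<forall>t\<ge>0. Q t \<in> L_G \<P> 2 \<and>
     (\<forall>e>0. \<exists>d>0. \<forall>ts. partition_of t ts \<and> mesh_le ts d \<longrightarrow>
        upper_moment \<P> 2 (\<lambda>\<omega>. sum_squares ts \<omega> - Q t \<omega>) < e))"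

definition finite_variation :: "(real \<Rightarrow> real) \<Rightarrow> bool" where
  "finite_variation f \<longleftrightarrow> (\<forall>T\<ge>0. \<exists>V. \<forall>ts. partition_of T ts \<longrightarrow>
     (\<Sum>i<length ts - 1. \<bar>f (ts ! Suc i) - f (ts ! i)\<bar>) \<le> V)"

definition continuous_increasing :: "path measure set \<Rightarrow> (real \<Rightarrow> path \<Rightarrow> real) \<Rightarrow> bool" where
  "continuous_increasing \<P> A \<longleftrightarrow>
     quasi_surely \<P> (\<lambda>\<omega>. continuous_on {0..} (\<lambda>t. A t \<omega>) \<and> mono_on {0..} (\<lambda>t. A t \<omega>))"

text \<open>
  The pathwise Lebesgue--Stieltjes measure \<open>dA\<^sub>s(\<omega>)\<close> on \<open>[0,\<infinity>)\<close> of a process with continuous increasing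
  paths; freezing the integrator on negative times gives them measure 0.
\<close>

definition stieltjes :: "(real \<Rightarrow> path \<Rightarrow> real) \<Rightarrow> path \<Rightarrow> real measure" where
  "stieltjes A \<omega> = interval_measure (\<lambda>r. A (max 0 r) \<omega>)"

end

theory Submission
  imports Defs
begin

text \<open>
  The bounds in (iii) come first. For \<open>\<E>[B\<^sub>t\<^sup>2]\<close> and \<open>\<E>[-B\<^sub>t\<^sup>2]\<close> additivity in \<open>t\<close> makes
  \<open>u(t,x) = \<plusminus>x\<^sup>2 + ct\<close>, which is its own test function in the viscosity inequalities, so that \<open>c\<close> is read
  off the equation. Hence \<open>\<Sum> (\<Delta>B)\<^sup>2 - \<sigma>u\<^sup>2 t\<close> has nonpositive conditional drift, and the second moment of its
  positive part is at most the sum of the squared increments of this process; under each measure that sum tends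
  to 0 because paths are continuous and \<open>\<Sum> (\<Delta>B)\<^sup>2\<close> converges in \<open>L\<^sup>2\<close>. The lower bound is symmetric.

  Since \<open>\<langle>B\<rangle>\<close> is thereby bounded, test functions of polynomial growth can be replaced by Lipschitz ones, and
  independence of increments passes to the limit from sums of squares. The upper half of (ii) is then pathwise.
  For the lower half, cutting \<open>[s, s + t]\<close> into \<open>n\<close> pieces costs only \<open>O(n (t/n)\<^sup>2)\<close> in
  \<open>\<E>[-(\<langle>B\<rangle>\<^sub>s\<^sub>+\<^sub>t - \<langle>B\<rangle>\<^sub>s - ct)\<^sup>2]\<close>, which therefore vanishes for each admissible speed \<open>c\<close>.
\<close>

section \<open>Polynomially Lipschitz test functions\<close>

text \<open>The solution is explicit for linear and quadratic \<open>\<phi>\<close>, but the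
  equation gives no direct hold on fourth moments. The fourth powers in the second moments of the
  compensated sums are therefore controlled under one measure at a time: by uniform continuity of
  the paths along an almost surely convergent subsequence, and by the square of the sum of squares
  as a majorant that converges in mean. The subsequence depends on the measure, which is harmless
  for an almost sure statement. Where \<open>upper_exp\<close> itself has to converge, uniformity
  over \<open>\<P>\<close> is indispensable; it is taken from the definition of \<open>Q\<close>.
  Positive parts are forced by sublinearity: a factor of upper conditional mean zero makes a cross
  term vanish only if the other factor is nonnegative, so the plain second moment need not be small
  and each bound needs its own run, with \<open>k = 1\<close> and \<open>k = -1\<close>. An
  arbitrary \<open>Q\<close> is fixed at each time only up to a polar set, so its paths may be
  irregular; a good version is rebuilt from rational times.\<close>

definition l1 :: "real list \<Rightarrow> real" where
  "l1 x = (\<Sum>a\<leftarrow>x. \<bar>a\<bar>)"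

lemma l1_simps [simp]: "l1 [] = 0" "l1 (a # x) = \<bar>a\<bar> + l1 x" "l1 (x @ y) = l1 x + l1 y"
  by (simp_all add: l1_def)

lemma l1_nonneg [simp]: "0 \<le> l1 x"
  by (induction x) auto

lemma l1_eq_sum: "l1 x = (\<Sum>i<length x. \<bar>x ! i\<bar>)"
  by (simp add: l1_def sum_list_sum_nth atLeast0LessThan)

lemma nth_le_l1: "i < length x \<Longrightarrow> \<bar>x ! i\<bar> \<le> l1 x"
  unfolding l1_eq_sum by (rule member_le_sum) auto

lemma vnorm_nonneg [simp]: "0 \<le> vnorm x"
  by (simp add: vnorm_def)

lemma vnorm_le_l1: "vnorm x \<le> l1 x"
  unfolding vnorm_def l1_eq_sum by (rule L2_set_le_sum_abs)

text \<open>Together with \<open>vnorm_le_l1\<close> this lets the recursive, append-additive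
  \<open>l1\<close> stand in for the Euclidean norm; the dimension factor is absorbed by the
  constants in \<open>C_lLip\<close>.\<close>

lemma l1_le_vnorm: "l1 x \<le> real (length x) * vnorm x"
proof -
  have "\<bar>x ! i\<bar> \<le> vnorm x" if "i < length x" for i
  proof -
    have "\<bar>x ! i\<bar> \<le> L2_set (\<lambda>i. \<bar>x ! i\<bar>) {..<length x}"
      by (rule member_le_L2_set) (use that in auto)
    then show ?thesis by (simp add: vnorm_def L2_set_def)
  qed
  then have "(\<Sum>i<length x. \<bar>x ! i\<bar>) \<le> (\<Sum>i<length x. vnorm x)"
    by (intro sum_mono) auto
  then show ?thesis by (simp add: l1_eq_sum)
qed

lemma vdiff_simps [simp]: "vdiff [] [] = []" "vdiff (a # x) (b # y) = (a - b) # vdiff x y"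
  by (simp_all add: vdiff_def)

lemma length_vdiff [simp]: "length x = length y \<Longrightarrow> length (vdiff x y) = length y"
  by (simp add: vdiff_def)

lemma nth_vdiff: "i < length x \<Longrightarrow> length x = length y \<Longrightarrow> vdiff x y ! i = x ! i - y ! i"
  by (simp add: vdiff_def)

lemma vdiff_append: "length x = length y \<Longrightarrow> vdiff (x @ a) (y @ b) = vdiff x y @ vdiff a b"
  by (simp add: vdiff_def)

lemma l1_le_vdiff: "length x = length y \<Longrightarrow> l1 x \<le> l1 (vdiff x y) + l1 y"
  by (induction x y rule: list_induct2) auto

text \<open>A single base that is at least 1: bounds with different exponents become comparable by
  raising the exponent, so the constants of sums, products and compositions can simply be added or
  multiplied.\<close>

definition weight :: "real list \<Rightarrow> real list \<Rightarrow> real" where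
  "weight x y = 1 + l1 x + l1 y"

lemma weight_ge_1 [simp]: "1 \<le> weight x y"
  by (simp add: weight_def)

lemma weight_nonneg [simp]: "0 \<le> weight x y" "0 < weight x y"
  using weight_ge_1[of x y] by linarith+

lemma power_weight_mono: "j \<le> k \<Longrightarrow> weight x y ^ j \<le> weight x y ^ k"
  by (rule power_increasing) auto

lemma C_lLipI:
  assumes "\<And>x y. length x = m \<Longrightarrow> length y = m \<Longrightarrow> \<bar>\<phi> x - \<phi> y\<bar> \<le> C * weight x y ^ k * l1 (vdiff x y)"
  shows "\<phi> \<in> C_lLip m"
proof -
  \<comment> \<open>\<open>\<bar>C\<bar> + 1\<close> is positive whatever the sign of
    \<open>C\<close>; \<open>3 * (m + 1)\<close> compares \<open>weight x y\<close> with the largest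
    of 1 and the two norms; the last factor passes from \<open>l1\<close> to \<open>vnorm\<close>.
    Taking \<open>m + 1\<close> for \<open>m\<close> keeps \<open>K\<close> positive in dimension
    0.\<close>
  define K where "K = (\<bar>C\<bar> + 1) * (3 * (real m + 1)) ^ k * (real m + 1)"
  have "\<bar>\<phi> x - \<phi> y\<bar> \<le> K * (1 + vnorm x ^ k + vnorm y ^ k) * vnorm (vdiff x y)"
    if l: "length x = m" "length y = m" for x y
  proof -
    define a where "a = max 1 (max (vnorm x) (vnorm y))"
    have a: "1 \<le> a" "vnorm x \<le> a" "vnorm y \<le> a" by (auto simp: a_def)
    have m0: "0 \<le> real m" by simp
    have "l1 x \<le> real m * a" "l1 y \<le> real m * a"
      using l1_le_vnorm[of x] l1_le_vnorm[of y] l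
        mult_left_mono[OF a(2) m0] mult_left_mono[OF a(3) m0] by auto
    moreover have "0 \<le> real m * a" using a(1) by simp
    moreover have "3 * (real m + 1) * a = 3 * (real m * a) + 3 * a" by (simp add: algebra_simps)
    ultimately have "weight x y \<le> 3 * (real m + 1) * a"
      using a(1) unfolding weight_def by linarith
    then have "weight x y ^ k \<le> (3 * (real m + 1)) ^ k * a ^ k"
      using power_mono[of "weight x y" "3 * (real m + 1) * a" k] by (simp only: power_mult_distrib) simp
    moreover have "a ^ k \<le> 1 + vnorm x ^ k + vnorm y ^ k"
      by (auto simp: a_def max_def)
    moreover have "0 \<le> (3 * (real m + 1)) ^ k" by simp
    ultimately have w: "weight x y ^ k \<le> (3 * (real m + 1)) ^ k * (1 + vnorm x ^ k + vnorm y ^ k)"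
      using mult_left_mono order_trans by blast
    have d: "l1 (vdiff x y) \<le> (real m + 1) * vnorm (vdiff x y)"
      using l1_le_vnorm[of "vdiff x y"] l by (simp add: algebra_simps add_increasing)
    have "\<bar>\<phi> x - \<phi> y\<bar> \<le> C * weight x y ^ k * l1 (vdiff x y)"
      using assms l by blast
    also have "\<dots> \<le> (\<bar>C\<bar> + 1) * weight x y ^ k * l1 (vdiff x y)"
      by (intro mult_right_mono) auto
    also have "\<dots> \<le> (\<bar>C\<bar> + 1) * ((3 * (real m + 1)) ^ k * (1 + vnorm x ^ k + vnorm y ^ k))
        * ((real m + 1) * vnorm (vdiff x y))"
      by (intro mult_mono w d mult_left_mono) (auto intro!: mult_nonneg_nonneg add_nonneg_nonneg)
    finally show ?thesis by (simp add: K_def mult_ac)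
  qed
  moreover have "0 < K" by (auto simp: K_def intro!: mult_pos_pos)
  ultimately show ?thesis unfolding C_lLip_def by blast
qed

lemma C_lLip_weight_bound:
  assumes "\<phi> \<in> C_lLip m"
  shows "\<exists>C k. 0 \<le> C \<and> (\<forall>x y. length x = m \<longrightarrow> length y = m \<longrightarrow>
    \<bar>\<phi> x - \<phi> y\<bar> \<le> C * weight x y ^ k * l1 (vdiff x y))"
proof -
  from assms obtain C k where C: "0 < C" "\<And>x y. length x = m \<Longrightarrow> length y = m \<Longrightarrow>
      \<bar>\<phi> x - \<phi> y\<bar> \<le> C * (1 + vnorm x ^ k + vnorm y ^ k) * vnorm (vdiff x y)"
    unfolding C_lLip_def by blast
  have "\<bar>\<phi> x - \<phi> y\<bar> \<le> (3 * C) * weight x y ^ k * l1 (vdiff x y)"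
    if "length x = m" "length y = m" for x y
  proof -
    have "vnorm x ^ k \<le> weight x y ^ k" "vnorm y ^ k \<le> weight x y ^ k" "1 \<le> weight x y ^ k"
      using vnorm_le_l1[of x] vnorm_le_l1[of y]
      by (auto intro!: power_mono one_le_power simp: weight_def add_increasing2 add_increasing)
    then have "1 + vnorm x ^ k + vnorm y ^ k \<le> 3 * weight x y ^ k" by linarith
    then have "C * (1 + vnorm x ^ k + vnorm y ^ k) * vnorm (vdiff x y)
        \<le> C * (3 * weight x y ^ k) * l1 (vdiff x y)"
      using C(1) vnorm_le_l1 by (intro mult_mono mult_left_mono) auto
    with C(2)[OF that] show ?thesis by (simp add: mult_ac)
  qed
  with C(1) show ?thesis by (intro exI[of _ "3 * C"] exI[of _ k]) auto
qed

text \<open>Compare with the zero vector: the distance contributes one more factor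
  \<open>1 + l1 x\<close>.\<close>

lemma C_lLip_growth:
  assumes "\<phi> \<in> C_lLip m"
  shows "\<exists>C k. 0 \<le> C \<and> (\<forall>x. length x = m \<longrightarrow> \<bar>\<phi> x\<bar> \<le> C * (1 + l1 x) ^ k)"
proof -
  from C_lLip_weight_bound[OF assms] obtain C k where C: "0 \<le> C" "\<And>x y. length x = m \<Longrightarrow> length y = m \<Longrightarrow>
      \<bar>\<phi> x - \<phi> y\<bar> \<le> C * weight x y ^ k * l1 (vdiff x y)" by blast
  let ?z = "replicate m (0::real)"
  have z: "l1 ?z = 0" by (induction m) auto
  have "\<bar>\<phi> x\<bar> \<le> (C + \<bar>\<phi> ?z\<bar>) * (1 + l1 x) ^ Suc k" if "length x = m" for x
  proof -
    have vz: "l1 (vdiff x ?z) = l1 x"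
      using that by (induction x arbitrary: m) auto
    have "\<bar>\<phi> x\<bar> \<le> C * (1 + l1 x) ^ k * l1 x + \<bar>\<phi> ?z\<bar>"
      using C(2)[of x ?z] that vz z by (simp add: weight_def)
    moreover have "C * (1 + l1 x) ^ k * l1 x \<le> C * (1 + l1 x) ^ k * (1 + l1 x)"
      using C(1) by (intro mult_left_mono) auto
    moreover have "\<bar>\<phi> ?z\<bar> * 1 \<le> \<bar>\<phi> ?z\<bar> * (1 + l1 x) ^ Suc k"
      by (intro mult_left_mono one_le_power) auto
    ultimately show ?thesis by (simp add: algebra_simps)
  qed
  with C(1) show ?thesis by (intro exI[of _ "C + \<bar>\<phi> ?z\<bar>"] exI[of _ "Suc k"]) auto
qed

lemma C_lLip_const [simp]: "(\<lambda>_. c) \<in> C_lLip m"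
  by (rule C_lLipI[of _ _ 0 0]) simp

lemma C_lLip_nth: "i < m \<Longrightarrow> (\<lambda>x. x ! i) \<in> C_lLip m"
proof (rule C_lLipI[of _ _ 1 0])
  fix x y :: "real list" assume "i < m" "length x = m" "length y = m"
  then show "\<bar>x ! i - y ! i\<bar> \<le> 1 * weight x y ^ 0 * l1 (vdiff x y)"
    using nth_le_l1[of i "vdiff x y"] by (simp add: nth_vdiff)
qed

lemma C_lLip_add:
  assumes "\<phi> \<in> C_lLip m" "\<psi> \<in> C_lLip m"
  shows "(\<lambda>x. \<phi> x + \<psi> x) \<in> C_lLip m"
proof -
  from C_lLip_weight_bound[OF assms(1)] obtain C k where C: "0 \<le> C" "\<And>x y. length x = m \<Longrightarrow> length y = m \<Longrightarrow>
      \<bar>\<phi> x - \<phi> y\<bar> \<le> C * weight x y ^ k * l1 (vdiff x y)" by blast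
  from C_lLip_weight_bound[OF assms(2)] obtain D j where D: "0 \<le> D" "\<And>x y. length x = m \<Longrightarrow> length y = m \<Longrightarrow>
      \<bar>\<psi> x - \<psi> y\<bar> \<le> D * weight x y ^ j * l1 (vdiff x y)" by blast
  show ?thesis
  proof (rule C_lLipI[of _ _ "C + D" "k + j"])
    fix x y :: "real list" assume l: "length x = m" "length y = m"
    have "C * weight x y ^ k * l1 (vdiff x y) \<le> C * weight x y ^ (k + j) * l1 (vdiff x y)"
      "D * weight x y ^ j * l1 (vdiff x y) \<le> D * weight x y ^ (k + j) * l1 (vdiff x y)"
      using C(1) D(1) by (auto intro!: mult_right_mono mult_left_mono power_weight_mono)
    with C(2)[OF l] D(2)[OF l]
    show "\<bar>\<phi> x + \<psi> x - (\<phi> y + \<psi> y)\<bar> \<le> (C + D) * weight x y ^ (k + j) * l1 (vdiff x y)"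
      by (simp add: algebra_simps)
  qed
qed

lemma C_lLip_mult:
  assumes "\<phi> \<in> C_lLip m" "\<psi> \<in> C_lLip m"
  shows "(\<lambda>x. \<phi> x * \<psi> x) \<in> C_lLip m"
proof -
  from C_lLip_weight_bound[OF assms(1)] obtain C k where C: "0 \<le> C" "\<And>x y. length x = m \<Longrightarrow> length y = m \<Longrightarrow>
      \<bar>\<phi> x - \<phi> y\<bar> \<le> C * weight x y ^ k * l1 (vdiff x y)" by blast
  from C_lLip_weight_bound[OF assms(2)] obtain D j where D: "0 \<le> D" "\<And>x y. length x = m \<Longrightarrow> length y = m \<Longrightarrow>
      \<bar>\<psi> x - \<psi> y\<bar> \<le> D * weight x y ^ j * l1 (vdiff x y)" by blast
  from C_lLip_growth[OF assms(1)] obtain C' k' where C': "0 \<le> C'" "\<And>x. length x = m \<Longrightarrow> \<bar>\<phi> x\<bar> \<le> C' * (1 + l1 x) ^ k'"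
    by blast
  from C_lLip_growth[OF assms(2)] obtain D' j' where D': "0 \<le> D'" "\<And>x. length x = m \<Longrightarrow> \<bar>\<psi> x\<bar> \<le> D' * (1 + l1 x) ^ j'"
    by blast
  define p where "p = k + j + k' + j'"
  show ?thesis
  proof (rule C_lLipI[of _ _ "C' * D + D' * C" p])
    fix x y :: "real list" assume l: "length x = m" "length y = m"
    let ?w = "weight x y" and ?d = "l1 (vdiff x y)"
    have w: "(1 + l1 x) ^ k' \<le> ?w ^ k'" "(1 + l1 y) ^ j' \<le> ?w ^ j'"
      by (auto intro!: power_mono simp: weight_def)
    then have g: "\<bar>\<phi> x\<bar> \<le> C' * ?w ^ k'" "\<bar>\<psi> y\<bar> \<le> D' * ?w ^ j'"
      using order_trans[OF C'(2)[OF l(1)] mult_left_mono[OF w(1) C'(1)]]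
        order_trans[OF D'(2)[OF l(2)] mult_left_mono[OF w(2) D'(1)]] by auto
    have "\<bar>\<phi> x * \<psi> x - \<phi> y * \<psi> y\<bar> = \<bar>\<phi> x * (\<psi> x - \<psi> y) + \<psi> y * (\<phi> x - \<phi> y)\<bar>"
      by (simp add: algebra_simps)
    also have "\<dots> \<le> \<bar>\<phi> x\<bar> * \<bar>\<psi> x - \<psi> y\<bar> + \<bar>\<psi> y\<bar> * \<bar>\<phi> x - \<phi> y\<bar>"
      by (metis abs_mult abs_triangle_ineq)
    also have "\<dots> \<le> (C' * ?w ^ k') * (D * ?w ^ j * ?d) + (D' * ?w ^ j') * (C * ?w ^ k * ?d)"
      using g C(2)[OF l] D(2)[OF l] C'(1) D'(1) by (intro add_mono mult_mono) auto
    also have "\<dots> = (C' * D) * ?w ^ (k' + j) * ?d + (D' * C) * ?w ^ (j' + k) * ?d"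
      by (simp add: power_add mult_ac)
    also have "\<dots> \<le> (C' * D) * ?w ^ p * ?d + (D' * C) * ?w ^ p * ?d"
      using C(1) D(1) C'(1) D'(1)
      by (intro add_mono mult_right_mono mult_left_mono power_weight_mono) (auto simp: p_def)
    finally show "\<bar>\<phi> x * \<psi> x - \<phi> y * \<psi> y\<bar> \<le> (C' * D + D' * C) * ?w ^ p * ?d"
      by (simp add: algebra_simps)
  qed
qed

lemma C_lLip_lipschitz:
  assumes "\<phi> \<in> C_lLip m" "L-lipschitz_on UNIV h"
  shows "(\<lambda>x. h (\<phi> x)) \<in> C_lLip m"
proof -
  from C_lLip_weight_bound[OF assms(1)] obtain C k where C: "0 \<le> C" "\<And>x y. length x = m \<Longrightarrow> length y = m \<Longrightarrow>
      \<bar>\<phi> x - \<phi> y\<bar> \<le> C * weight x y ^ k * l1 (vdiff x y)" by blast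
  have "0 \<le> L" and L: "\<bar>h a - h b\<bar> \<le> L * \<bar>a - b\<bar>" for a b :: real
    using assms(2) by (auto simp: lipschitz_on_def dist_real_def)
  show ?thesis
  proof (rule C_lLipI[of _ _ "L * C" k])
    fix x y :: "real list" assume l: "length x = m" "length y = m"
    from mult_left_mono[OF C(2)[OF l] \<open>0 \<le> L\<close>] L[of "\<phi> x" "\<phi> y"]
    show "\<bar>h (\<phi> x) - h (\<phi> y)\<bar> \<le> L * C * weight x y ^ k * l1 (vdiff x y)"
      by (simp add: mult_ac)
  qed
qed

lemma C_lLip_diff: "\<phi> \<in> C_lLip m \<Longrightarrow> \<psi> \<in> C_lLip m \<Longrightarrow> (\<lambda>x. \<phi> x - \<psi> x) \<in> C_lLip m"
  using C_lLip_add[of \<phi> m "\<lambda>x. - 1 * \<psi> x"] C_lLip_mult[OF C_lLip_const, of \<psi> m "-1"] by simp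

lemma C_lLip_uminus: "\<phi> \<in> C_lLip m \<Longrightarrow> (\<lambda>x. - \<phi> x) \<in> C_lLip m"
  using C_lLip_diff[OF C_lLip_const, of \<phi> m 0] by simp

lemma square_C_lLip: "\<phi> \<in> C_lLip m \<Longrightarrow> (\<lambda>x. (\<phi> x)\<^sup>2) \<in> C_lLip m"
  unfolding power2_eq_square by (rule C_lLip_mult)

lemma C_lLip_sum:
  assumes "finite I" "\<And>i. i \<in> I \<Longrightarrow> \<phi> i \<in> C_lLip m"
  shows "(\<lambda>x. \<Sum>i\<in>I. \<phi> i x) \<in> C_lLip m"
  using assms by (induction I rule: finite_induct) (auto intro: C_lLip_add)

lemma C_lLip_vector:
  assumes "\<And>g. g \<in> set gs \<Longrightarrow> g \<in> C_lLip m"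
  shows "\<exists>C k. 0 \<le> C \<and> (\<forall>x y. length x = m \<longrightarrow> length y = m \<longrightarrow>
      l1 (vdiff (map (\<lambda>g. g x) gs) (map (\<lambda>g. g y) gs)) \<le> C * weight x y ^ k * l1 (vdiff x y))"
  using assms
proof (induction gs)
  case Nil
  show ?case by (intro exI[of _ 0]) auto
next
  case (Cons g gs)
  have g: "g \<in> C_lLip m" and "\<And>h. h \<in> set gs \<Longrightarrow> h \<in> C_lLip m" using Cons.prems by auto
  from Cons.IH[OF this(2)] obtain C k where C: "0 \<le> C" "\<And>x y. length x = m \<Longrightarrow> length y = m \<Longrightarrow>
      l1 (vdiff (map (\<lambda>g. g x) gs) (map (\<lambda>g. g y) gs)) \<le> C * weight x y ^ k * l1 (vdiff x y)"
    by blast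
  obtain D j where D: "0 \<le> D" "\<And>x y. length x = m \<Longrightarrow> length y = m \<Longrightarrow>
      \<bar>g x - g y\<bar> \<le> D * weight x y ^ j * l1 (vdiff x y)"
    using C_lLip_weight_bound[OF g] by blast
  show ?case
  proof (rule exI[of _ "C + D"], rule exI[of _ "k + j"], intro conjI allI impI)
    fix x y :: "real list" assume l: "length x = m" "length y = m"
    have "C * weight x y ^ k * l1 (vdiff x y) \<le> C * weight x y ^ (k + j) * l1 (vdiff x y)"
      "D * weight x y ^ j * l1 (vdiff x y) \<le> D * weight x y ^ (k + j) * l1 (vdiff x y)"
      using C(1) D(1) by (auto intro!: mult_right_mono mult_left_mono power_weight_mono)
    with C(2)[OF l] D(2)[OF l]
    show "l1 (vdiff (map (\<lambda>g. g x) (g # gs)) (map (\<lambda>g. g y) (g # gs)))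
        \<le> (C + D) * weight x y ^ (k + j) * l1 (vdiff x y)"
      by (simp add: algebra_simps)
  qed (use C D in auto)
qed

lemma C_lLip_vector_growth:
  assumes "\<And>g. g \<in> set gs \<Longrightarrow> g \<in> C_lLip m"
  shows "\<exists>C k. 0 \<le> C \<and> (\<forall>x. length x = m \<longrightarrow> l1 (map (\<lambda>g. g x) gs) \<le> C * (1 + l1 x) ^ k)"
  using assms
proof (induction gs)
  case Nil
  show ?case by (intro exI[of _ 0]) auto
next
  case (Cons g gs)
  have g: "g \<in> C_lLip m" and "\<And>h. h \<in> set gs \<Longrightarrow> h \<in> C_lLip m" using Cons.prems by auto
  from Cons.IH[OF this(2)] obtain C k where C: "0 \<le> C" "\<And>x. length x = m \<Longrightarrow> l1 (map (\<lambda>g. g x) gs) \<le> C * (1 + l1 x) ^ k"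
    by blast
  obtain D j where D: "0 \<le> D" "\<And>x. length x = m \<Longrightarrow> \<bar>g x\<bar> \<le> D * (1 + l1 x) ^ j"
    using C_lLip_growth[OF g] by blast
  show ?case
  proof (rule exI[of _ "C + D"], rule exI[of _ "k + j"], intro conjI allI impI)
    fix x :: "real list" assume l: "length x = m"
    have "C * (1 + l1 x) ^ k \<le> C * (1 + l1 x) ^ (k + j)" "D * (1 + l1 x) ^ j \<le> D * (1 + l1 x) ^ (k + j)"
      using C(1) D(1) by (auto intro!: mult_left_mono power_increasing)
    with C(2)[OF l] D(2)[OF l]
    show "l1 (map (\<lambda>g. g x) (g # gs)) \<le> (C + D) * (1 + l1 x) ^ (k + j)"
      by (simp add: algebra_simps)
  qed (use C D in auto)
qed

text \<open>Every change of coordinates below is an instance with a suitable list \<open>gs\<close>: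
  selecting entries, forming partial sums, merging two entries into \<open>z + y\<^sup>2\<close>.
  The exponent of \<open>\<phi>\<close> multiplies that of the growth of \<open>gs\<close>.\<close>

lemma C_lLip_comp:
  assumes gs: "\<And>g. g \<in> set gs \<Longrightarrow> g \<in> C_lLip m" and "\<phi> \<in> C_lLip (length gs)"
  shows "(\<lambda>x. \<phi> (map (\<lambda>g. g x) gs)) \<in> C_lLip m"
proof -
  let ?G = "\<lambda>x. map (\<lambda>g. g x) gs"
  from C_lLip_weight_bound[OF assms(2)] obtain C k where C: "0 \<le> C" "\<And>x y. length x = length gs \<Longrightarrow> length y = length gs \<Longrightarrow>
      \<bar>\<phi> x - \<phi> y\<bar> \<le> C * weight x y ^ k * l1 (vdiff x y)" by blast
  obtain D j where D: "0 \<le> D" "\<And>x y. length x = m \<Longrightarrow> length y = m \<Longrightarrow>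
      l1 (vdiff (?G x) (?G y)) \<le> D * weight x y ^ j * l1 (vdiff x y)" using C_lLip_vector[OF gs] by blast
  obtain E i where E: "0 \<le> E" "\<And>x. length x = m \<Longrightarrow> l1 (?G x) \<le> E * (1 + l1 x) ^ i"
    using C_lLip_vector_growth[OF gs] by blast
  show ?thesis
  proof (rule C_lLipI[of _ _ "C * (1 + 2 * E) ^ k * D" "i * k + j"])
    fix x y :: "real list" assume l: "length x = m" "length y = m"
    let ?w = "weight x y" and ?d = "l1 (vdiff x y)"
    have w: "(1 + l1 x) ^ i \<le> ?w ^ i" "(1 + l1 y) ^ i \<le> ?w ^ i"
      by (auto intro!: power_mono simp: weight_def)
    then have "l1 (?G x) \<le> E * ?w ^ i" "l1 (?G y) \<le> E * ?w ^ i"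
      using order_trans[OF E(2)[OF l(1)] mult_left_mono[OF w(1) E(1)]]
        order_trans[OF E(2)[OF l(2)] mult_left_mono[OF w(2) E(1)]] by auto
    moreover have "1 \<le> ?w ^ i" by (rule one_le_power) simp
    moreover have "(1 + 2 * E) * ?w ^ i = ?w ^ i + 2 * (E * ?w ^ i)" by (simp add: algebra_simps)
    ultimately have "weight (?G x) (?G y) \<le> (1 + 2 * E) * ?w ^ i"
      unfolding weight_def[of "?G x"] by linarith
    then have w': "weight (?G x) (?G y) ^ k \<le> (1 + 2 * E) ^ k * ?w ^ (i * k)"
      using power_mono[of "weight (?G x) (?G y)" "(1 + 2 * E) * ?w ^ i" k]
      by (simp add: power_mult_distrib power_mult)
    have "\<bar>\<phi> (?G x) - \<phi> (?G y)\<bar> \<le> C * weight (?G x) (?G y) ^ k * l1 (vdiff (?G x) (?G y))"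
      by (rule C(2)) auto
    also have "\<dots> \<le> C * ((1 + 2 * E) ^ k * ?w ^ (i * k)) * (D * ?w ^ j * ?d)"
      using C(1) D(1) E(1) by (intro mult_mono mult_left_mono w' D(2) l) auto
    finally show "\<bar>\<phi> (?G x) - \<phi> (?G y)\<bar> \<le> C * (1 + 2 * E) ^ k * D * ?w ^ (i * k + j) * ?d"
      by (simp add: power_add mult_ac)
  qed
qed

lemma l1_vdiff_map_le:
  assumes "\<And>f. f \<in> set fs \<Longrightarrow> \<bar>g f - h f\<bar> \<le> e"
  shows "l1 (vdiff (map g fs) (map h fs)) \<le> real (length fs) * e"
  using assms by (induction fs) (auto simp: algebra_simps intro: add_mono)

text \<open>A test function lives on lists, so measurability is obtained by discretisation: rounding
  every entry down to the grid of width \<open>1 / Suc n\<close> leaves countably many lists, on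
  which any function is measurable, and the local Lipschitz bound gives pointwise
  convergence.\<close>

lemma C_lLip_measurable:
  assumes phi: "\<phi> \<in> C_lLip (length fs)" and fs: "\<And>f. f \<in> set fs \<Longrightarrow> f \<in> borel_measurable M"
  shows "(\<lambda>\<omega>. \<phi> (map (\<lambda>f. f \<omega>) fs)) \<in> borel_measurable M"
proof -
  define r where "r n \<omega> = map (\<lambda>f. \<lfloor>real (Suc n) * f \<omega>\<rfloor>) fs" for n \<omega>
  define q where "q n l = map (\<lambda>z::int. real_of_int z / real (Suc n)) l" for n l
  have r: "r n \<in> measurable M (count_space UNIV)" for n
  proof -
    have "{\<omega> \<in> space M. map (\<lambda>f. \<lfloor>real (Suc n) * f \<omega>\<rfloor>) fs = l} \<in> sets M" for l :: "int list"
      using fs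
    proof (induction fs arbitrary: l)
      case Nil
      then show ?case by (cases l) auto
    next
      case (Cons f fs)
      show ?case
      proof (cases l)
        case (Cons z l')
        have f: "f \<in> borel_measurable M" using Cons.prems by simp
        have "{\<omega> \<in> space M. \<lfloor>real (Suc n) * f \<omega>\<rfloor> = z} \<in> sets M" using f by measurable
        moreover have "{\<omega> \<in> space M. map (\<lambda>f. \<lfloor>real (Suc n) * f \<omega>\<rfloor>) fs = l'} \<in> sets M"
          using Cons.IH Cons.prems(1) by simp
        ultimately have "{\<omega> \<in> space M. \<lfloor>real (Suc n) * f \<omega>\<rfloor> = z}
            \<inter> {\<omega> \<in> space M. map (\<lambda>f. \<lfloor>real (Suc n) * f \<omega>\<rfloor>) fs = l'} \<in> sets M" by (rule sets.Int)
        also have "{\<omega> \<in> space M. \<lfloor>real (Suc n) * f \<omega>\<rfloor> = z}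
            \<inter> {\<omega> \<in> space M. map (\<lambda>f. \<lfloor>real (Suc n) * f \<omega>\<rfloor>) fs = l'}
            = {\<omega> \<in> space M. map (\<lambda>f. \<lfloor>real (Suc n) * f \<omega>\<rfloor>) (f # fs) = l}"
          unfolding Cons by auto
        finally show ?thesis .
      qed simp
    qed
    then show ?thesis
      by (auto simp: measurable_count_space_eq2_countable r_def vimage_def Int_def conj_commute)
  qed
  have 1: "(\<lambda>\<omega>. \<phi> (q n (r n \<omega>))) \<in> borel_measurable M" for n
    by (rule measurable_compose[OF r]) simp
  have 2: "(\<lambda>n. \<phi> (q n (r n \<omega>))) \<longlonglongrightarrow> \<phi> (map (\<lambda>f. f \<omega>) fs)" for \<omega>
  proof -
    let ?x = "map (\<lambda>f. f \<omega>) fs"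
    have d: "l1 (vdiff (q n (r n \<omega>)) ?x) \<le> real (length fs) * (1 / real (Suc n))" for n
    proof -
      have "\<bar>real_of_int \<lfloor>real (Suc n) * f \<omega>\<rfloor> / real (Suc n) - f \<omega>\<bar> \<le> 1 / real (Suc n)" for f
      proof -
        have "\<bar>real_of_int \<lfloor>real (Suc n) * f \<omega>\<rfloor> - real (Suc n) * f \<omega>\<bar> \<le> 1" by linarith
        then have "\<bar>real_of_int \<lfloor>real (Suc n) * f \<omega>\<rfloor> - real (Suc n) * f \<omega>\<bar> / real (Suc n) \<le> 1 / real (Suc n)"
          by (intro divide_right_mono) auto
        also have "\<bar>real_of_int \<lfloor>real (Suc n) * f \<omega>\<rfloor> - real (Suc n) * f \<omega>\<bar> / real (Suc n)
            = \<bar>(real_of_int \<lfloor>real (Suc n) * f \<omega>\<rfloor> - real (Suc n) * f \<omega>) / real (Suc n)\<bar>"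
          by simp
        also have "(real_of_int \<lfloor>real (Suc n) * f \<omega>\<rfloor> - real (Suc n) * f \<omega>) / real (Suc n)
            = real_of_int \<lfloor>real (Suc n) * f \<omega>\<rfloor> / real (Suc n) - f \<omega>"
          by (simp add: diff_divide_distrib del: of_nat_Suc)
        finally show ?thesis .
      qed
      then show ?thesis unfolding q_def r_def map_map comp_def
        by (intro l1_vdiff_map_le)
    qed
    have lim: "(\<lambda>n. real (length fs) * (1 / real (Suc n))) \<longlonglongrightarrow> 0"
      using tendsto_mult_right_zero[OF LIMSEQ_inverse_real_of_nat] by (simp add: inverse_eq_divide)
    have len: "length (q n (r n \<omega>)) = length fs" for n by (simp add: q_def r_def)
    have lb: "l1 (q n (r n \<omega>)) \<le> real (length fs) + l1 ?x" for n
    proof -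
      have "real (length fs) * (1 / real (Suc n)) \<le> real (length fs) * 1"
        by (intro mult_left_mono) auto
      then show ?thesis using d[of n] l1_le_vdiff[of "q n (r n \<omega>)" ?x] len by simp
    qed
    obtain C k where C: "0 \<le> C" "\<And>x y. length x = length fs \<Longrightarrow> length y = length fs \<Longrightarrow>
      \<bar>\<phi> x - \<phi> y\<bar> \<le> C * weight x y ^ k * l1 (vdiff x y)" using C_lLip_weight_bound[OF phi] by blast
    \<comment> \<open>The rounded vectors stay within \<open>length fs\<close> of \<open>?x\<close>
      in \<open>l1\<close>, so one bound on the weight serves all \<open>n\<close>.\<close>
    define K where "K = C * (1 + real (length fs) + 2 * l1 ?x) ^ k"
    have "\<bar>\<phi> (q n (r n \<omega>)) - \<phi> ?x\<bar> \<le> K * (real (length fs) * (1 / real (Suc n)))" for n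
    proof -
      have "weight (q n (r n \<omega>)) ?x ^ k \<le> (1 + real (length fs) + 2 * l1 ?x) ^ k"
        using lb[of n] by (intro power_mono) (auto simp: weight_def)
      then have "C * weight (q n (r n \<omega>)) ?x ^ k * l1 (vdiff (q n (r n \<omega>)) ?x)
          \<le> K * (real (length fs) * (1 / real (Suc n)))"
        unfolding K_def using C(1) d[of n] by (intro mult_mono mult_left_mono) auto
      then show ?thesis using C(2)[of "q n (r n \<omega>)" ?x] len by simp
    qed
    then have "\<forall>\<^sub>F n in sequentially. norm (\<phi> (q n (r n \<omega>)) - \<phi> ?x) \<le> K * (real (length fs) * (1 / real (Suc n)))"
      by (intro always_eventually allI) (simp only: real_norm_def)
    then have "(\<lambda>n. \<phi> (q n (r n \<omega>)) - \<phi> ?x) \<longlonglongrightarrow> 0"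
      by (rule Lim_null_comparison[OF _ tendsto_mult_right_zero[OF lim]])
    then show ?thesis by (simp add: LIM_zero_iff)
  qed
  show ?thesis by (rule borel_measurable_LIMSEQ_real[OF 2 1])
qed

section \<open>Functionals of the past and the sublinear expectation\<close>

lemma open_path_iff:
  "open U \<longleftrightarrow> (\<forall>\<omega>\<in>U. \<exists>T\<ge>0. \<exists>e>0. \<forall>\<omega>'.
     (\<forall>t\<in>{0..T}. \<bar>coord t \<omega>' - coord t \<omega>\<bar> < e) \<longrightarrow> \<omega>' \<in> U)" for U :: "path set"
  unfolding open_path_def ..

lemma coord_continuous_on: "continuous_on {0..} (\<lambda>t. coord t \<omega>)"
  and coord_0 [simp]: "coord 0 \<omega> = 0"
  and coord_neg: "t < 0 \<Longrightarrow> coord t \<omega> = 0"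
  using path_at[of \<omega>] by (auto simp: coord_def)

text \<open>Coordinates are continuous for locally uniform convergence; negative times, which the
  topology does not look at, give the constant 0.\<close>

lemma coord_measurable [measurable]: "coord t \<in> borel_measurable borel"
proof (cases "t < 0")
  case True
  then have "coord t = (\<lambda>_. 0)" by (auto simp: coord_neg)
  then show ?thesis by simp
next
  case False
  have "open (coord t -` U)" if U: "open U" for U :: "real set"
    unfolding open_path_iff
  proof
    fix \<omega> assume "\<omega> \<in> coord t -` U"
    then obtain e where e: "e > 0" "\<And>y. dist y (coord t \<omega>) < e \<Longrightarrow> y \<in> U"
      using U by (auto simp: open_dist)
    with False show "\<exists>T\<ge>0. \<exists>e>0. \<forall>\<omega>'. (\<forall>s\<in>{0..T}. \<bar>coord s \<omega>' - coord s \<omega>\<bar> < e) \<longrightarrow> \<omega>' \<in> coord t -` U"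
      by (intro exI[of _ t] conjI exI[of _ e]) (auto simp: dist_real_def)
  qed
  then show ?thesis by (intro borel_measurable_continuous_onI) (auto simp: continuous_on_open_vimage)
qed

text \<open>Coordinates rather than increments, because \<open>independent_increments\<close>
  conditions on the values at past times. \<open>past_comp\<close> makes the class stable under test
  functions of several of its members.\<close>

definition past :: "real \<Rightarrow> (path \<Rightarrow> real) \<Rightarrow> bool" where
  "past s X \<longleftrightarrow> (\<exists>us g. times us \<and> (\<forall>r\<in>set us. r \<le> s) \<and> g \<in> C_lLip (length us) \<and>
     X = (\<lambda>\<omega>. g (map (\<lambda>r. coord r \<omega>) us)))"

lemma past_refine:
  assumes "set us \<subseteq> set us'" "g \<in> C_lLip (length us)"
  obtains g' where "g' \<in> C_lLip (length us')"
    "\<And>\<omega>. g (map (\<lambda>r. coord r \<omega>) us) = g' (map (\<lambda>r. coord r \<omega>) us')"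
proof -
  define ix where "ix r = (SOME i. i < length us' \<and> us' ! i = r)" for r
  have ix: "ix r < length us' \<and> us' ! ix r = r" if "r \<in> set us" for r
  proof -
    have "\<exists>i. i < length us' \<and> us' ! i = r" using that assms(1) by (metis in_set_conv_nth subsetD)
    then show ?thesis unfolding ix_def by (rule someI_ex)
  qed
  define hs where "hs = map (\<lambda>r (x :: real list). x ! ix r) us"
  show thesis
  proof (rule that[of "\<lambda>x. g (map (\<lambda>h. h x) hs)"])
    show "(\<lambda>x. g (map (\<lambda>h. h x) hs)) \<in> C_lLip (length us')"
      using assms(2) ix by (intro C_lLip_comp) (auto simp: hs_def intro: C_lLip_nth)
    show "g (map (\<lambda>r. coord r \<omega>) us) = g (map (\<lambda>h. h (map (\<lambda>r. coord r \<omega>) us')) hs)" for \<omega>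
      using ix by (auto simp: hs_def comp_def intro!: arg_cong[of _ _ g])
  qed
qed

text \<open>Several functionals of the past become functions of one common vector of coordinates;
  independence, which speaks of one vector, then applies to them jointly.\<close>

lemma past_list:
  assumes "\<And>X. X \<in> set Xs \<Longrightarrow> past s X"
  shows "\<exists>us gs. times us \<and> (\<forall>r\<in>set us. r \<le> s) \<and> length gs = length Xs \<and>
    (\<forall>g\<in>set gs. g \<in> C_lLip (length us)) \<and>
    (\<forall>\<omega>. map (\<lambda>X. X \<omega>) Xs = map (\<lambda>g. g (map (\<lambda>r. coord r \<omega>) us)) gs)"
  using assms
proof (induction Xs)
  case Nil
  show ?case by (intro exI[of _ "[]"]) (auto simp: times_def)
next
  case (Cons X Xs)
  then obtain us gs where us: "times us" "\<forall>r\<in>set us. r \<le> s" "length gs = length Xs"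
    "\<forall>g\<in>set gs. g \<in> C_lLip (length us)"
    "\<And>\<omega>. map (\<lambda>X. X \<omega>) Xs = map (\<lambda>g. g (map (\<lambda>r. coord r \<omega>) us)) gs"
    by auto
  from Cons.prems have "past s X" by simp
  then obtain vs g where vs: "times vs" "\<forall>r\<in>set vs. r \<le> s" "g \<in> C_lLip (length vs)"
    "X = (\<lambda>\<omega>. g (map (\<lambda>r. coord r \<omega>) vs))"
    unfolding past_def by blast
  \<comment> \<open>Merging by \<open>sort\<close> keeps repetitions, which \<open>times\<close>
    allows.\<close>
  define ws where "ws = sort (us @ vs)"
  have ws: "times ws" "\<forall>r\<in>set ws. r \<le> s" "set us \<subseteq> set ws" "set vs \<subseteq> set ws"
    using us vs by (auto simp: ws_def times_def)
  have ex: "\<exists>h'. h' \<in> C_lLip (length ws) \<and>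
      (\<forall>\<omega>. h (map (\<lambda>r. coord r \<omega>) us) = h' (map (\<lambda>r. coord r \<omega>) ws))"
    if "h \<in> set gs" for h
    using past_refine[OF ws(3), of h] us(4) that by metis
  define ref where "ref h = (SOME h'. h' \<in> C_lLip (length ws) \<and>
      (\<forall>\<omega>. h (map (\<lambda>r. coord r \<omega>) us) = h' (map (\<lambda>r. coord r \<omega>) ws)))" for h
  have ref: "ref h \<in> C_lLip (length ws) \<and>
      (\<forall>\<omega>. h (map (\<lambda>r. coord r \<omega>) us) = ref h (map (\<lambda>r. coord r \<omega>) ws))" if "h \<in> set gs" for h
    unfolding ref_def by (rule someI_ex[OF ex[OF that]])
  obtain g' where g': "g' \<in> C_lLip (length ws)"
    "\<And>\<omega>. g (map (\<lambda>r. coord r \<omega>) vs) = g' (map (\<lambda>r. coord r \<omega>) ws)"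
    using past_refine[OF ws(4) vs(3)] by metis
  show ?case
  proof (rule exI[of _ ws], rule exI[of _ "g' # map ref gs"], intro conjI allI)
    show "map (\<lambda>X. X \<omega>) (X # Xs) = map (\<lambda>g. g (map (\<lambda>r. coord r \<omega>) ws)) (g' # map ref gs)" for \<omega>
      using us(5)[of \<omega>] g'(2)[of \<omega>] ref by (auto simp: vs(4) comp_def)
  qed (use ws us(3) g' ref in auto)
qed

lemma past_comp:
  assumes "\<And>X. X \<in> set Xs \<Longrightarrow> past s X" "\<phi> \<in> C_lLip (length Xs)"
  shows "past s (\<lambda>\<omega>. \<phi> (map (\<lambda>X. X \<omega>) Xs))"
proof -
  from past_list[OF assms(1)] obtain us gs where us: "times us" "\<forall>r\<in>set us. r \<le> s"
    "length gs = length Xs" "\<forall>g\<in>set gs. g \<in> C_lLip (length us)"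
    "\<And>\<omega>. map (\<lambda>X. X \<omega>) Xs = map (\<lambda>g. g (map (\<lambda>r. coord r \<omega>) us)) gs"
    by blast
  have "(\<lambda>x. \<phi> (map (\<lambda>g. g x) gs)) \<in> C_lLip (length us)"
    using us assms(2) by (intro C_lLip_comp) auto
  with us show ?thesis unfolding past_def by (intro exI[of _ us] exI[of _ "\<lambda>x. \<phi> (map (\<lambda>g. g x) gs)"]) auto
qed

lemma past_coord: "0 \<le> r \<Longrightarrow> r \<le> s \<Longrightarrow> past s (coord r)"
  unfolding past_def by (intro exI[of _ "[r]"] exI[of _ "\<lambda>x. x ! 0"]) (auto simp: times_def C_lLip_nth)

lemma past_mono: "past s X \<Longrightarrow> s \<le> t \<Longrightarrow> past t X"
  unfolding past_def by force

lemma past_const [simp]: "past s (\<lambda>_. c)"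
  using past_comp[of "[]" s "\<lambda>_. c"] by simp

lemma past_add: "past s X \<Longrightarrow> past s Y \<Longrightarrow> past s (\<lambda>\<omega>. X \<omega> + Y \<omega>)"
proof -
  assume "past s X" "past s Y"
  then have "past s (\<lambda>\<omega>. (\<lambda>x. x ! 0 + x ! 1) (map (\<lambda>X. X \<omega>) [X, Y]))"
    by (intro past_comp) (auto intro!: C_lLip_add C_lLip_nth)
  then show ?thesis by simp
qed

lemma past_mult: "past s X \<Longrightarrow> past s Y \<Longrightarrow> past s (\<lambda>\<omega>. X \<omega> * Y \<omega>)"
proof -
  assume "past s X" "past s Y"
  then have "past s (\<lambda>\<omega>. (\<lambda>x. x ! 0 * x ! 1) (map (\<lambda>X. X \<omega>) [X, Y]))"
    by (intro past_comp) (auto intro!: C_lLip_mult C_lLip_nth)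
  then show ?thesis by simp
qed

lemma past_cmult: "past s X \<Longrightarrow> past s (\<lambda>\<omega>. c * X \<omega>)"
  by (intro past_mult past_const)

lemma past_uminus: "past s X \<Longrightarrow> past s (\<lambda>\<omega>. - X \<omega>)"
  using past_cmult[of s X "-1"] by simp

lemma past_diff: "past s X \<Longrightarrow> past s Y \<Longrightarrow> past s (\<lambda>\<omega>. X \<omega> - Y \<omega>)"
  using past_add[OF _ past_uminus, of s X Y] by simp

lemma past_power: "past s X \<Longrightarrow> past s (\<lambda>\<omega>. X \<omega> ^ k)"
  by (induction k) (auto intro: past_mult)

lemma past_lipschitz: "past s X \<Longrightarrow> L-lipschitz_on UNIV h \<Longrightarrow> past s (\<lambda>\<omega>. h (X \<omega>))"
proof -
  assume "past s X" "L-lipschitz_on UNIV h"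
  then have "past s (\<lambda>\<omega>. (\<lambda>x. h (x ! 0)) (map (\<lambda>X. X \<omega>) [X]))"
    by (intro past_comp C_lLip_lipschitz[of _ _ L h]) (auto intro: C_lLip_nth)
  then show ?thesis by simp
qed

lemma past_sum:
  "finite I \<Longrightarrow> (\<And>i. i \<in> I \<Longrightarrow> past s (X i)) \<Longrightarrow> past s (\<lambda>\<omega>. \<Sum>i\<in>I. X i \<omega>)"
  by (induction I rule: finite_induct) (auto intro: past_add)

lemma past_measurable: "past s X \<Longrightarrow> X \<in> borel_measurable borel"
proof -
  assume "past s X"
  then obtain us g where g: "g \<in> C_lLip (length us)" "X = (\<lambda>\<omega>. g (map (\<lambda>r. coord r \<omega>) us))"
    unfolding past_def by blast
  have "(\<lambda>\<omega>. g (map (\<lambda>f. f \<omega>) (map coord us))) \<in> borel_measurable borel"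
    using g by (intro C_lLip_measurable) auto
  then show ?thesis by (simp add: g comp_def)
qed

lemma length_increments [simp]: "length (increments r ts \<omega>) = length ts"
  by (induction ts arbitrary: r) auto

lemma sum_increments:
  "i < length ts \<Longrightarrow> (\<Sum>j\<le>i. increments r ts \<omega> ! j) = coord (ts ! i) \<omega> - coord r \<omega>"
proof (induction ts arbitrary: r i)
  case (Cons t ts)
  show ?case
  proof (cases i)
    case (Suc k)
    then show ?thesis using Cons by (subst Suc, subst sum.atMost_Suc_shift) auto
  qed simp
qed simp

lemma nth_increments:
  "i < length ts \<Longrightarrow> increments r ts \<omega> ! i = coord (ts ! i) \<omega> - coord ((r # ts) ! i) \<omega>"
proof (induction ts arbitrary: r i)
  case (Cons t ts)
  then show ?case by (cases i) auto
qed simp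

lemma past_cylinder: "past s X \<Longrightarrow> cylinder X"
proof -
  assume "past s X"
  then obtain us g where g: "times us" "g \<in> C_lLip (length us)" "X = (\<lambda>\<omega>. g (map (\<lambda>r. coord r \<omega>) us))"
    unfolding past_def by blast
  \<comment> \<open>Partial sums recover the coordinates from the increments, since paths start at
    0.\<close>
  define hs where "hs = map (\<lambda>i (x :: real list). \<Sum>j\<le>i. x ! j) [0..<length us]"
  have "(\<lambda>x. g (map (\<lambda>h. h x) hs)) \<in> C_lLip (length us)"
    using g(2) by (intro C_lLip_comp) (auto simp: hs_def intro!: C_lLip_sum C_lLip_nth)
  moreover have "map (\<lambda>h. h (increments 0 us \<omega>)) hs = map (\<lambda>r. coord r \<omega>) us" for \<omega>
    by (rule nth_equalityI) (auto simp: hs_def sum_increments)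
  ultimately show ?thesis
    unfolding cylinder_def using g by (intro exI[of _ us] exI[of _ "\<lambda>x. g (map (\<lambda>h. h x) hs)"]) auto
qed

lemma upper_exp_cong: "(\<And>\<omega>. X \<omega> = Y \<omega>) \<Longrightarrow> upper_exp \<P> X = upper_exp \<P> Y"
  by presburger

section \<open>Calculus of the upper expectation\<close>

locale gbm =
  fixes \<sigma>l \<sigma>u :: real and \<P> :: "path measure set"
  assumes GBM: "G_Brownian_motion \<sigma>l \<sigma>u \<P>"
begin

lemma sig: "0 \<le> \<sigma>l" "\<sigma>l \<le> \<sigma>u"
  and P_nonempty: "\<P> \<noteq> {}"
  and P_prob: "P \<in> \<P> \<Longrightarrow> prob_space P"
  and P_sets: "P \<in> \<P> \<Longrightarrow> sets P = sets borel"
  and stat: "stationary_increments \<P> coord" and ind: "independent_increments \<P> coord"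
  and cylinder_moment: "cylinder X \<Longrightarrow> upper_moment \<P> 1 X < \<infinity>"
  using GBM unfolding G_Brownian_motion_def by blast+

lemma sig2: "0 \<le> \<sigma>l\<^sup>2" "\<sigma>l\<^sup>2 \<le> \<sigma>u\<^sup>2"
  using sig by (auto intro: power_mono)

lemma P_measurable: "P \<in> \<P> \<Longrightarrow> measurable P M = measurable borel M"
  by (rule measurable_cong_sets[OF P_sets refl])

text \<open>The Bochner integral of a non-integrable function and the real supremum of an unbounded
  set are default values. \<open>fin\<close> is the condition under which \<open>upper_exp\<close>
  is a true supremum of true integrals; nearly every rule about \<open>E\<close> asks for
  it.\<close>

definition fin :: "(path \<Rightarrow> real) \<Rightarrow> bool" where
  "fin X \<longleftrightarrow> X \<in> borel_measurable borel \<and> upper_moment \<P> 1 X < \<infinity>"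

lemma upper_moment_ge: "P \<in> \<P> \<Longrightarrow> (\<integral>\<^sup>+\<omega>. ennreal (\<bar>X \<omega>\<bar> ^ p) \<partial>P) \<le> upper_moment \<P> p X"
  unfolding upper_moment_def by (rule SUP_upper)

lemma fin_measurable: "fin X \<Longrightarrow> X \<in> borel_measurable borel"
  by (simp add: fin_def)

lemma fin_integrable:
  assumes "fin X" "P \<in> \<P>" shows "integrable P X"
proof (rule integrableI_bounded)
  show "X \<in> borel_measurable P" using assms by (simp add: P_measurable fin_def)
  show "(\<integral>\<^sup>+\<omega>. ennreal (norm (X \<omega>)) \<partial>P) < \<infinity>"
    using upper_moment_ge[OF assms(2), of X 1] assms(1) by (auto simp: fin_def top.not_eq_extremum)
qed

lemma finI:
  assumes "X \<in> borel_measurable borel" "\<And>P. P \<in> \<P> \<Longrightarrow> integrable P X" "\<And>P. P \<in> \<P> \<Longrightarrow> (\<integral>\<omega>. \<bar>X \<omega>\<bar> \<partial>P) \<le> c"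
  shows "fin X"
proof -
  have "(\<integral>\<^sup>+\<omega>. ennreal (\<bar>X \<omega>\<bar> ^ 1) \<partial>P) \<le> ennreal c" if "P \<in> \<P>" for P
    using assms(2)[OF that] assms(3)[OF that] by (simp add: nn_integral_eq_integral ennreal_leI)
  then have "upper_moment \<P> 1 X \<le> ennreal c" unfolding upper_moment_def by (rule SUP_least)
  then show ?thesis using assms(1) by (simp add: fin_def le_less_trans[OF _ ennreal_less_top])
qed

lemma fin_bound:
  assumes "fin X" obtains c where "0 \<le> c" "\<And>P. P \<in> \<P> \<Longrightarrow> (\<integral>\<omega>. \<bar>X \<omega>\<bar> \<partial>P) \<le> c"
proof (rule that[of "enn2real (upper_moment \<P> 1 X)"])
  fix P assume P: "P \<in> \<P>"
  have "ennreal (\<integral>\<omega>. \<bar>X \<omega>\<bar> \<partial>P) \<le> upper_moment \<P> 1 X"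
    using upper_moment_ge[OF P, of X 1] fin_integrable[OF assms P] by (simp add: nn_integral_eq_integral)
  also have "\<dots> = ennreal (enn2real (upper_moment \<P> 1 X))"
    using assms by (simp add: fin_def)
  finally show "(\<integral>\<omega>. \<bar>X \<omega>\<bar> \<partial>P) \<le> enn2real (upper_moment \<P> 1 X)" by simp
qed simp

lemma fin_dominated:
  assumes "fin Y" "X \<in> borel_measurable borel" "\<And>P. P \<in> \<P> \<Longrightarrow> AE \<omega> in P. \<bar>X \<omega>\<bar> \<le> \<bar>Y \<omega>\<bar>"
  shows "fin X"
proof -
  obtain c where c: "\<And>P. P \<in> \<P> \<Longrightarrow> (\<integral>\<omega>. \<bar>Y \<omega>\<bar> \<partial>P) \<le> c" using fin_bound[OF assms(1)] by blast
  have i: "integrable P X" if "P \<in> \<P>" for P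
    using fin_integrable[OF assms(1) that] assms(3)[OF that] assms(2) that
    by (auto intro!: Bochner_Integration.integrable_bound[of P Y] simp: P_measurable)
  show ?thesis
  proof (rule finI[OF assms(2) i])
    fix P assume P: "P \<in> \<P>"
    have "(\<integral>\<omega>. \<bar>X \<omega>\<bar> \<partial>P) \<le> (\<integral>\<omega>. \<bar>Y \<omega>\<bar> \<partial>P)"
      using i[OF P] fin_integrable[OF assms(1) P] assms(3)[OF P] by (intro integral_mono_AE) auto
    with c[OF P] show "(\<integral>\<omega>. \<bar>X \<omega>\<bar> \<partial>P) \<le> c" by linarith
  qed
qed

lemma fin_add: "fin X \<Longrightarrow> fin Y \<Longrightarrow> fin (\<lambda>\<omega>. X \<omega> + Y \<omega>)"
proof -
  assume X: "fin X" and Y: "fin Y"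
  obtain c where c: "\<And>P. P \<in> \<P> \<Longrightarrow> (\<integral>\<omega>. \<bar>X \<omega>\<bar> \<partial>P) \<le> c" using fin_bound[OF X] by blast
  obtain d where d: "\<And>P. P \<in> \<P> \<Longrightarrow> (\<integral>\<omega>. \<bar>Y \<omega>\<bar> \<partial>P) \<le> d" using fin_bound[OF Y] by blast
  have [measurable]: "X \<in> borel_measurable borel" "Y \<in> borel_measurable borel"
    using X Y by (auto simp: fin_def)
  show ?thesis
  proof (rule finI)
    fix P assume P: "P \<in> \<P>"
    note [simp] = fin_integrable[OF X P] fin_integrable[OF Y P]
    show "integrable P (\<lambda>\<omega>. X \<omega> + Y \<omega>)" by simp
    have "(\<integral>\<omega>. \<bar>X \<omega> + Y \<omega>\<bar> \<partial>P) \<le> (\<integral>\<omega>. \<bar>X \<omega>\<bar> + \<bar>Y \<omega>\<bar> \<partial>P)"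
      by (intro integral_mono) auto
    also have "\<dots> = (\<integral>\<omega>. \<bar>X \<omega>\<bar> \<partial>P) + (\<integral>\<omega>. \<bar>Y \<omega>\<bar> \<partial>P)" by simp
    finally show "(\<integral>\<omega>. \<bar>X \<omega> + Y \<omega>\<bar> \<partial>P) \<le> c + d" using c[OF P] d[OF P] by linarith
  qed measurable
qed

lemma fin_const [simp]: "fin (\<lambda>_. c)"
  by (rule finI[of _ "\<bar>c\<bar>"]) (auto simp: prob_space.prob_space[OF P_prob]
    intro!: finite_measure.integrable_const prob_space.finite_measure P_prob)

lemma fin_cmult: "fin X \<Longrightarrow> fin (\<lambda>\<omega>. c * X \<omega>)"
proof -
  assume X: "fin X"
  obtain d where d: "\<And>P. P \<in> \<P> \<Longrightarrow> (\<integral>\<omega>. \<bar>X \<omega>\<bar> \<partial>P) \<le> d" using fin_bound[OF X] by blast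
  show ?thesis
    by (rule finI[of _ "\<bar>c\<bar> * d"])
      (use fin_integrable[OF X] d fin_measurable[OF X] in \<open>auto simp: abs_mult intro!: mult_left_mono\<close>)
qed

lemma fin_uminus: "fin X \<Longrightarrow> fin (\<lambda>\<omega>. - X \<omega>)"
  using fin_cmult[of X "-1"] by simp

lemma fin_diff: "fin X \<Longrightarrow> fin Y \<Longrightarrow> fin (\<lambda>\<omega>. X \<omega> - Y \<omega>)"
  using fin_add[OF _ fin_uminus, of X Y] by simp

lemma fin_past: "past s X \<Longrightarrow> fin X"
  using cylinder_moment[OF past_cylinder] past_measurable by (simp add: fin_def)

abbreviation E :: "(path \<Rightarrow> real) \<Rightarrow> real" where "E \<equiv> upper_exp \<P>"

lemma integral_le_E: "fin X \<Longrightarrow> P \<in> \<P> \<Longrightarrow> (\<integral>\<omega>. X \<omega> \<partial>P) \<le> E X"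
proof -
  assume X: "fin X" and P: "P \<in> \<P>"
  obtain c where c: "\<And>P. P \<in> \<P> \<Longrightarrow> (\<integral>\<omega>. \<bar>X \<omega>\<bar> \<partial>P) \<le> c" using fin_bound[OF X] by blast
  have "(\<integral>\<omega>. X \<omega> \<partial>P) \<le> c" if "P \<in> \<P>" for P
  proof -
    have "(\<integral>\<omega>. X \<omega> \<partial>P) \<le> (\<integral>\<omega>. \<bar>X \<omega>\<bar> \<partial>P)"
      using fin_integrable[OF X that] by (intro integral_mono) auto
    with c[OF that] show ?thesis by linarith
  qed
  then show ?thesis unfolding upper_exp_def by (intro cSUP_upper[OF P] bdd_aboveI2[of _ _ c])
qed

lemma E_le: "(\<And>P. P \<in> \<P> \<Longrightarrow> (\<integral>\<omega>. X \<omega> \<partial>P) \<le> c) \<Longrightarrow> E X \<le> c"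
  unfolding upper_exp_def by (rule cSUP_least[OF P_nonempty])

lemma E_const [simp]: "E (\<lambda>_. c) = c"
proof -
  have "(SUP P\<in>\<P>. \<integral>\<omega>. c \<partial>P) = (SUP P\<in>\<P>. c)"
    by (rule SUP_cong) (simp_all add: prob_space.prob_space[OF P_prob])
  then show ?thesis unfolding upper_exp_def using P_nonempty by simp
qed

lemma E_mono_AE:
  assumes "fin X" "fin Y" "\<And>P. P \<in> \<P> \<Longrightarrow> AE \<omega> in P. X \<omega> \<le> Y \<omega>"
  shows "E X \<le> E Y"
proof (rule E_le)
  fix P assume P: "P \<in> \<P>"
  have "(\<integral>\<omega>. X \<omega> \<partial>P) \<le> (\<integral>\<omega>. Y \<omega> \<partial>P)"
    using assms P by (intro integral_mono_AE fin_integrable)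
  with integral_le_E[OF assms(2) P] show "(\<integral>\<omega>. X \<omega> \<partial>P) \<le> E Y" by linarith
qed

lemma E_mono: "fin X \<Longrightarrow> fin Y \<Longrightarrow> (\<And>\<omega>. X \<omega> \<le> Y \<omega>) \<Longrightarrow> E X \<le> E Y"
  by (rule E_mono_AE) auto

lemma E_add_le: "fin X \<Longrightarrow> fin Y \<Longrightarrow> E (\<lambda>\<omega>. X \<omega> + Y \<omega>) \<le> E X + E Y"
  by (intro E_le) (simp add: fin_integrable integral_le_E add_mono)

lemma E_add_const: "fin X \<Longrightarrow> E (\<lambda>\<omega>. X \<omega> + c) = E X + c"
proof (rule antisym)
  assume X: "fin X"
  show "E (\<lambda>\<omega>. X \<omega> + c) \<le> E X + c" using E_add_le[OF X fin_const[of c]] by simp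
  show "E X + c \<le> E (\<lambda>\<omega>. X \<omega> + c)"
    using E_add_le[OF fin_add[OF X fin_const[of c]] fin_const[of "-c"]] by simp
qed

lemma E_const_add: "fin X \<Longrightarrow> E (\<lambda>\<omega>. c + X \<omega>) = c + E X"
  using E_add_const[of X c] by (simp add: add.commute)

lemma E_cmult: "fin X \<Longrightarrow> 0 \<le> c \<Longrightarrow> E (\<lambda>\<omega>. c * X \<omega>) = c * E X"
proof -
  assume X: "fin X" and c: "0 \<le> c"
  have le: "E (\<lambda>\<omega>. c * X \<omega>) \<le> c * E X" if "fin X" "0 \<le> c" for c X
    using that by (intro E_le) (auto intro!: mult_left_mono integral_le_E)
  show ?thesis
  proof (cases "c = 0")
    case False
    with le[OF fin_cmult[OF X, of c], of "1 / c"] c have "E X \<le> 1 / c * E (\<lambda>\<omega>. c * X \<omega>)" by simp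
    with False c have "c * E X \<le> E (\<lambda>\<omega>. c * X \<omega>)" by (simp add: field_simps)
    with le[OF X c] show ?thesis by simp
  qed simp
qed

text \<open>A supremum is 1-Lipschitz for the uniform distance, here the distance in mean uniformly
  over \<open>\<P>\<close>. Approximations are carried under \<open>E\<close> by this bound.\<close>

lemma E_diff_bound:
  assumes "fin X" "fin Y" "\<And>P. P \<in> \<P> \<Longrightarrow> (\<integral>\<omega>. \<bar>X \<omega> - Y \<omega>\<bar> \<partial>P) \<le> c"
  shows "\<bar>E X - E Y\<bar> \<le> c"
proof -
  have le: "E X \<le> E Y + c" if "fin X" "fin Y" "\<And>P. P \<in> \<P> \<Longrightarrow> (\<integral>\<omega>. \<bar>X \<omega> - Y \<omega>\<bar> \<partial>P) \<le> c" for X Y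
  proof (rule E_le)
    fix P assume P: "P \<in> \<P>"
    note [simp] = fin_integrable[OF that(1) P] fin_integrable[OF that(2) P]
    have "(\<integral>\<omega>. X \<omega> \<partial>P) \<le> (\<integral>\<omega>. Y \<omega> + \<bar>X \<omega> - Y \<omega>\<bar> \<partial>P)" by (intro integral_mono) auto
    also have "\<dots> = (\<integral>\<omega>. Y \<omega> \<partial>P) + (\<integral>\<omega>. \<bar>X \<omega> - Y \<omega>\<bar> \<partial>P)" by simp
    finally show "(\<integral>\<omega>. X \<omega> \<partial>P) \<le> E Y + c" using that(3)[OF P] integral_le_E[OF that(2) P] by linarith
  qed
  from le[OF assms] le[OF assms(2,1)] assms(3) show ?thesis by (simp add: abs_minus_commute)
qed

lemma E_cong_AE:
  assumes "fin X" "fin Y" "\<And>P. P \<in> \<P> \<Longrightarrow> AE \<omega> in P. X \<omega> = Y \<omega>"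
  shows "E X = E Y"
proof (rule antisym; rule E_mono_AE)
  fix P assume "P \<in> \<P>"
  note AE = assms(3)[OF this]
  from AE show "AE \<omega> in P. X \<omega> \<le> Y \<omega>" by eventually_elim simp
  from AE show "AE \<omega> in P. Y \<omega> \<le> X \<omega>" by eventually_elim simp
qed (use assms in auto)

text \<open>The hypothesis asks for all powers of \<open>1 + 2 * \<bar>Y\<bar>\<close> and not for
  \<open>past s Y\<close>, so that increments of the quadratic variation, which are only limits of
  functionals of the past, are covered too. The factor 2 fits \<open>weight\<close>, in which an
  appended \<open>Y\<close> occurs twice.\<close>

lemma fin_C_lLip_append:
  assumes phi: "\<phi> \<in> C_lLip (Suc n)" and Y: "Y \<in> borel_measurable borel" "\<And>k. fin (\<lambda>\<omega>. (1 + 2 * \<bar>Y \<omega>\<bar>) ^ k)"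
    and x: "length x = n"
  shows "fin (\<lambda>\<omega>. \<phi> (x @ [Y \<omega>]))"
proof -
  from C_lLip_growth[OF phi] obtain C k where C: "0 \<le> C" "\<And>x. length x = Suc n \<Longrightarrow> \<bar>\<phi> x\<bar> \<le> C * (1 + l1 x) ^ k"
    by blast
  have meas: "(\<lambda>\<omega>. \<phi> (x @ [Y \<omega>])) \<in> borel_measurable borel"
  proof -
    have "(\<lambda>\<omega>. \<phi> (map (\<lambda>f. f \<omega>) (map (\<lambda>a _. a) x @ [Y]))) \<in> borel_measurable borel"
      using phi x Y(1) by (intro C_lLip_measurable) auto
    then show ?thesis by (simp add: comp_def)
  qed
  have "\<bar>\<phi> (x @ [Y \<omega>])\<bar> \<le> (C * (1 + l1 x) ^ k) * (1 + 2 * \<bar>Y \<omega>\<bar>) ^ k" for \<omega>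
  proof -
    have "1 + l1 (x @ [Y \<omega>]) \<le> (1 + l1 x) * (1 + 2 * \<bar>Y \<omega>\<bar>)"
      by (simp add: algebra_simps)
    then have "(1 + l1 (x @ [Y \<omega>])) ^ k \<le> (1 + l1 x) ^ k * (1 + 2 * \<bar>Y \<omega>\<bar>) ^ k"
      unfolding power_mult_distrib[symmetric] by (intro power_mono) auto
    then have "C * (1 + l1 (x @ [Y \<omega>])) ^ k \<le> C * ((1 + l1 x) ^ k * (1 + 2 * \<bar>Y \<omega>\<bar>) ^ k)"
      using C(1) by (rule mult_left_mono)
    then show ?thesis using C(2)[of "x @ [Y \<omega>]"] x by (simp add: mult.assoc)
  qed
  then show ?thesis
    by (intro fin_dominated[OF fin_cmult[OF Y(2)[of k], of "C * (1 + l1 x) ^ k"] meas])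
      (use C(1) in \<open>auto simp: abs_mult\<close>)
qed

text \<open>Freezing the first entries and averaging over the last gives a test function again,
  because \<open>weight\<close> of the extended vectors is at most \<open>weight x y\<close> times a
  function of \<open>Y\<close> alone. This is what allows conditioning on one increment after
  another.\<close>

lemma C_lLip_E:
  assumes phi: "\<phi> \<in> C_lLip (Suc n)" and Y: "Y \<in> borel_measurable borel" "\<And>k. fin (\<lambda>\<omega>. (1 + 2 * \<bar>Y \<omega>\<bar>) ^ k)"
  shows "(\<lambda>x. E (\<lambda>\<omega>. \<phi> (x @ [Y \<omega>]))) \<in> C_lLip n"
proof -
  from C_lLip_weight_bound[OF phi] obtain C k where C: "0 \<le> C"
    "\<And>x y. length x = Suc n \<Longrightarrow> length y = Suc n \<Longrightarrow>
      \<bar>\<phi> x - \<phi> y\<bar> \<le> C * weight x y ^ k * l1 (vdiff x y)" by blast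
  define Z where "Z = (\<lambda>\<omega>. (1 + 2 * \<bar>Y \<omega>\<bar>) ^ k)"
  have Z: "fin Z" unfolding Z_def by (rule Y(2))
  note fin = fin_C_lLip_append[OF phi Y]
  obtain c where c: "0 \<le> c" "\<And>P. P \<in> \<P> \<Longrightarrow> (\<integral>\<omega>. \<bar>Z \<omega>\<bar> \<partial>P) \<le> c" using fin_bound[OF Z] by blast
  show ?thesis
  proof (rule C_lLipI[of _ _ "C * c" k])
    fix x y :: "real list" assume l: "length x = n" "length y = n"
    show "\<bar>E (\<lambda>\<omega>. \<phi> (x @ [Y \<omega>])) - E (\<lambda>\<omega>. \<phi> (y @ [Y \<omega>]))\<bar> \<le> C * c * weight x y ^ k * l1 (vdiff x y)"
    proof (rule E_diff_bound[OF fin[OF l(1)] fin[OF l(2)]])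
      fix P assume P: "P \<in> \<P>"
      have b: "\<bar>\<phi> (x @ [Y \<omega>]) - \<phi> (y @ [Y \<omega>])\<bar> \<le> C * weight x y ^ k * l1 (vdiff x y) * Z \<omega>" for \<omega>
      proof -
        have "weight (x @ [Y \<omega>]) (y @ [Y \<omega>]) = weight x y + 2 * \<bar>Y \<omega>\<bar>" by (simp add: weight_def)
        also have "\<dots> \<le> weight x y + weight x y * (2 * \<bar>Y \<omega>\<bar>)"
          using mult_right_mono[OF weight_ge_1[of x y], of "2 * \<bar>Y \<omega>\<bar>"] by simp
        also have "\<dots> = weight x y * (1 + 2 * \<bar>Y \<omega>\<bar>)" by (simp add: algebra_simps)
        finally have "weight (x @ [Y \<omega>]) (y @ [Y \<omega>]) ^ k \<le> weight x y ^ k * Z \<omega>"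
          unfolding Z_def by (subst power_mult_distrib[symmetric]) (auto intro: power_mono)
        then have "C * weight (x @ [Y \<omega>]) (y @ [Y \<omega>]) ^ k * l1 (vdiff x y)
            \<le> C * (weight x y ^ k * Z \<omega>) * l1 (vdiff x y)"
          using C(1) by (intro mult_right_mono mult_left_mono) auto
        moreover have "l1 (vdiff (x @ [Y \<omega>]) (y @ [Y \<omega>])) = l1 (vdiff x y)"
          using l by (simp add: vdiff_append)
        ultimately show ?thesis using C(2)[of "x @ [Y \<omega>]" "y @ [Y \<omega>]"] l by (simp add: mult_ac)
      qed
      have "(\<integral>\<omega>. \<bar>\<phi> (x @ [Y \<omega>]) - \<phi> (y @ [Y \<omega>])\<bar> \<partial>P)
          \<le> (\<integral>\<omega>. C * weight x y ^ k * l1 (vdiff x y) * Z \<omega> \<partial>P)"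
        using fin_integrable[OF fin[OF l(1)] P] fin_integrable[OF fin[OF l(2)] P] fin_integrable[OF Z P] b
        by (intro integral_mono) auto
      also have "\<dots> = C * weight x y ^ k * l1 (vdiff x y) * (\<integral>\<omega>. Z \<omega> \<partial>P)" by simp
      also have "(\<integral>\<omega>. Z \<omega> \<partial>P) = (\<integral>\<omega>. \<bar>Z \<omega>\<bar> \<partial>P)" by (simp add: Z_def)
      also have "C * weight x y ^ k * l1 (vdiff x y) * (\<integral>\<omega>. \<bar>Z \<omega>\<bar> \<partial>P) \<le> C * weight x y ^ k * l1 (vdiff x y) * c"
        using c(2)[OF P] C(1) by (intro mult_left_mono) auto
      finally show "(\<integral>\<omega>. \<bar>\<phi> (x @ [Y \<omega>]) - \<phi> (y @ [Y \<omega>])\<bar> \<partial>P) \<le> C * c * weight x y ^ k * l1 (vdiff x y)"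
        by (simp add: mult_ac)
    qed
  qed
qed

lemma fin_past_power: "past s Y \<Longrightarrow> fin (\<lambda>\<omega>. (1 + 2 * \<bar>Y \<omega>\<bar>) ^ k)"
proof -
  have abs: "1-lipschitz_on UNIV (abs :: real \<Rightarrow> real)"
    by (auto intro!: lipschitz_onI simp: dist_real_def)
  assume "past s Y"
  then show ?thesis
    by (intro fin_past[of s] past_power past_add past_cmult past_const past_lipschitz[OF _ abs])
qed

lemma C_lLip_E_past:
  "\<phi> \<in> C_lLip (Suc n) \<Longrightarrow> past s Y \<Longrightarrow> (\<lambda>x. E (\<lambda>\<omega>. \<phi> (x @ [Y \<omega>]))) \<in> C_lLip n"
  by (rule C_lLip_E) (auto intro: past_measurable fin_past_power)

lemma past_independence:
  assumes Xs: "\<And>X. X \<in> set Xs \<Longrightarrow> past s X" and st: "0 \<le> s" "s \<le> t"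
    and phi: "\<phi> \<in> C_lLip (Suc (length Xs))"
  shows "E (\<lambda>\<omega>. \<phi> (map (\<lambda>X. X \<omega>) Xs @ [coord t \<omega> - coord s \<omega>])) =
    E (\<lambda>\<omega>. E (\<lambda>\<omega>'. \<phi> (map (\<lambda>X. X \<omega>) Xs @ [coord t \<omega>' - coord s \<omega>'])))"
proof -
  from past_list[OF Xs] obtain us gs where us: "times us" "\<forall>r\<in>set us. r \<le> s"
    "length gs = length Xs" "\<forall>g\<in>set gs. g \<in> C_lLip (length us)"
    "\<And>\<omega>. map (\<lambda>X. X \<omega>) Xs = map (\<lambda>g. g (map (\<lambda>r. coord r \<omega>) us)) gs"
    by blast
  let ?m = "length us"
  \<comment> \<open>\<open>tk\<close> keeps the \<open>?m\<close> coordinates and drops the last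
    entry, the increment; \<open>\<psi>\<close> is \<open>\<phi>\<close> rewritten as a test
    function of coordinates and increment.\<close>
  define tk where "tk = map (\<lambda>i (x :: real list). x ! i) [0..<?m]"
  define \<psi> where "\<psi> = (\<lambda>x. \<phi> (map (\<lambda>g. g x) (map (\<lambda>g x. g (map (\<lambda>h. h x) tk)) gs @ [\<lambda>x. x ! ?m])))"
  have tk: "map (\<lambda>h. h (map (\<lambda>r. coord r \<omega>) us @ [y])) tk = map (\<lambda>r. coord r \<omega>) us" for \<omega> y
    by (rule nth_equalityI) (auto simp: tk_def nth_append)
  have "(\<lambda>x. g (map (\<lambda>h. h x) tk)) \<in> C_lLip (Suc ?m)" if "g \<in> set gs" for g
    using us(4) that by (intro C_lLip_comp) (auto simp: tk_def intro: C_lLip_nth)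
  then have psi: "\<psi> \<in> C_lLip (?m + 1)"
    unfolding \<psi>_def using phi us(3) by (intro C_lLip_comp) (auto intro: C_lLip_nth)
  have psi_eq: "\<psi> (map (\<lambda>r. coord r \<omega>) us @ [y]) = \<phi> (map (\<lambda>X. X \<omega>) Xs @ [y])" for \<omega> y
    by (simp add: \<psi>_def comp_def tk us(5) nth_append)
  have "independent_of \<P> 1 (\<lambda>\<omega>. [coord (s + (t - s)) \<omega> - coord s \<omega>]) ?m (\<lambda>\<omega>. map (\<lambda>r. coord r \<omega>) us)"
    using ind[unfolded independent_increments_def, rule_format, of s "t - s" us] st us(1,2) by simp
  then show ?thesis
    using psi unfolding independent_of_def by (auto simp: psi_eq)
qed

lemma stationary_E:
  assumes "0 \<le> s" "s \<le> t" "\<phi> \<in> C_lLip 1"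
  shows "E (\<lambda>\<omega>. \<phi> [coord t \<omega> - coord s \<omega>]) = E (\<lambda>\<omega>. \<phi> [coord (t - s) \<omega>])"
proof -
  have "identically_distributed \<P> 1 (\<lambda>\<omega>. [coord (s + (t - s)) \<omega> - coord s \<omega>])
      (\<lambda>\<omega>. [coord (t - s) \<omega> - coord 0 \<omega>])"
    using stat[unfolded stationary_increments_def, rule_format, of s "t - s"] assms(1,2) by simp
  then show ?thesis using assms(3) unfolding identically_distributed_def by auto
qed

end

section \<open>Moments of the increments\<close>

text \<open>Cauchy's functional equation on the half-line: additivity gives linearity on the
  multiples of each \<open>1 / Suc n\<close>, and such multiples approach \<open>t\<close>.\<close>

lemma additive_continuous_linear:
  fixes a :: "real \<Rightarrow> real"
  assumes add: "\<And>s t. 0 \<le> s \<Longrightarrow> 0 \<le> t \<Longrightarrow> a (s + t) = a s + a t"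
    and cont: "continuous_on {0..} a" and t: "0 \<le> t"
  shows "a t = a 1 * t"
proof -
  have mult: "a (real n * s) = real n * a s" if "0 \<le> s" for n s
    using that add[of 0 0] by (induction n) (auto simp: algebra_simps add)
  define q where "q n = real (nat \<lfloor>t * real (Suc n)\<rfloor>) / real (Suc n)" for n
  have aq: "a (q n) = a 1 * q n" for n
  proof -
    have "a 1 = real (Suc n) * a (1 / real (Suc n))" using mult[of "1 / real (Suc n)" "Suc n"] by simp
    moreover have "a (q n) = real (nat \<lfloor>t * real (Suc n)\<rfloor>) * a (1 / real (Suc n))"
      using mult[of "1 / real (Suc n)" "nat \<lfloor>t * real (Suc n)\<rfloor>"] by (simp add: q_def)
    ultimately show ?thesis by (simp add: q_def)
  qed
  have "norm (q n - t) \<le> inverse (real (Suc n))" for n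
  proof -
    have "real (nat \<lfloor>t * real (Suc n)\<rfloor>) = real_of_int \<lfloor>t * real (Suc n)\<rfloor>" using t by simp
    then have "\<bar>real (nat \<lfloor>t * real (Suc n)\<rfloor>) - t * real (Suc n)\<bar> \<le> 1" by linarith
    then have "\<bar>real (nat \<lfloor>t * real (Suc n)\<rfloor>) - t * real (Suc n)\<bar> / real (Suc n) \<le> 1 / real (Suc n)"
      by (intro divide_right_mono) auto
    also have "\<bar>real (nat \<lfloor>t * real (Suc n)\<rfloor>) - t * real (Suc n)\<bar> / real (Suc n) = \<bar>q n - t\<bar>"
    proof -
      have "q n - t = (real (nat \<lfloor>t * real (Suc n)\<rfloor>) - t * real (Suc n)) / real (Suc n)"
        unfolding q_def by (simp add: diff_divide_distrib del: of_nat_Suc)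
      then show ?thesis by (simp add: abs_divide del: of_nat_Suc)
    qed
    finally show ?thesis by (simp add: inverse_eq_divide)
  qed
  then have "(\<lambda>n. q n - t) \<longlonglongrightarrow> 0"
    by (intro Lim_null_comparison[OF _ LIMSEQ_inverse_real_of_nat] always_eventually allI)
  then have q: "q \<longlonglongrightarrow> t" by (simp add: LIM_zero_iff)
  have "(\<lambda>n. a (q n)) \<longlonglongrightarrow> a t"
    using t by (intro continuous_on_tendsto_compose[OF cont q]) (auto simp: q_def)
  moreover have "(\<lambda>n. a (q n)) \<longlonglongrightarrow> a 1 * t"
    unfolding aq by (intro tendsto_mult tendsto_const q)
  ultimately show ?thesis by (rule LIMSEQ_unique)
qed

text \<open>With the formula for \<open>u\<close> itself as test function the difference vanishes at
  all positive times, so every interior point is a local maximum from both sides and the two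
  viscosity inequalities become an equation.\<close>

lemma viscosity_solution_separated:
  fixes G :: "real \<Rightarrow> real"
  assumes u: "viscosity_solution G \<phi> u" and eq: "\<And>t x. 0 \<le> t \<Longrightarrow> u t x = p x + c * t"
    and p: "\<And>x. (p has_real_derivative p' x) (at x)" "\<And>x. (p' has_real_derivative p'' x) (at x)"
    and p'': "continuous_on UNIV p''"
  shows "c = G (p'' x)"
proof -
  have cp: "continuous_on UNIV p" "continuous_on UNIV p'"
    using p by (auto intro!: DERIV_continuous_on)
  have C: "C12 (\<lambda>t x. p x + c * t) (\<lambda>_ _. c) (\<lambda>_ x. p' x) (\<lambda>_ x. p'' x)"
    unfolding C12_def case_prod_beta
    by (auto intro!: derivative_eq_intros p continuous_intros continuous_on_compose2[OF cp(1)]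
        continuous_on_compose2[OF cp(2)] continuous_on_compose2[OF p''])
  \<comment> \<open>The formula for \<open>u\<close> is known at nonnegative times only, so the
    neighbourhood of \<open>(1, x)\<close> has to avoid the others.\<close>
  have ev: "\<forall>\<^sub>F z in nhds (1, x). fst z > (0::real)"
  proof -
    have "\<forall>\<^sub>F z in nhds (1, x). z \<in> {0::real<..} \<times> (UNIV :: real set)"
      by (intro eventually_nhds_in_open open_Times) auto
    then show ?thesis by eventually_elim auto
  qed
  have 1: "local_max_at (\<lambda>s y. u s y - (p y + c * s)) 1 x" "local_max_at (\<lambda>s y. (p y + c * s) - u s y) 1 x"
    unfolding local_max_at_def using ev by (auto simp: eq elim!: eventually_mono)
  have "viscosity_subsolution G u" "viscosity_supersolution G u"
    using u by (auto simp: viscosity_solution_def)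
  then have "c - G (p'' x) \<le> 0" "c - G (p'' x) \<ge> 0"
    unfolding viscosity_subsolution_def viscosity_supersolution_def
    using C 1 zero_less_one by blast+
  then show ?thesis by simp
qed

lemma G_fun_simps: "0 \<le> \<sigma>l \<Longrightarrow> \<sigma>l \<le> \<sigma>u \<Longrightarrow> G_fun \<sigma>l \<sigma>u 0 = 0"
  "0 \<le> \<sigma>l \<Longrightarrow> \<sigma>l \<le> \<sigma>u \<Longrightarrow> G_fun \<sigma>l \<sigma>u 2 = \<sigma>u\<^sup>2"
  "0 \<le> \<sigma>l \<Longrightarrow> \<sigma>l \<le> \<sigma>u \<Longrightarrow> G_fun \<sigma>l \<sigma>u (- 2) = - \<sigma>l\<^sup>2"
proof -
  assume s: "0 \<le> \<sigma>l" "\<sigma>l \<le> \<sigma>u"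
  then show "G_fun \<sigma>l \<sigma>u 0 = 0" by (simp add: G_fun_def)
  have "(SUP \<sigma>\<in>{\<sigma>l..\<sigma>u}. \<sigma>\<^sup>2 * 2) = \<sigma>u\<^sup>2 * 2"
    using s by (intro cSup_eq_maximum) (auto intro!: power_mono)
  then show "G_fun \<sigma>l \<sigma>u 2 = \<sigma>u\<^sup>2" by (simp add: G_fun_def)
  have "(SUP \<sigma>\<in>{\<sigma>l..\<sigma>u}. \<sigma>\<^sup>2 * - 2) = \<sigma>l\<^sup>2 * - 2"
    using s by (intro cSup_eq_maximum) (auto intro!: power_mono)
  then show "G_fun \<sigma>l \<sigma>u (- 2) = - \<sigma>l\<^sup>2" by (simp add: G_fun_def)
qed

text \<open>The partition points form a sequence and the number of squares is a separate argument,
  so inductions add the last increment, the one that is independent of all before.\<close>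

definition sum_sq :: "(nat \<Rightarrow> real) \<Rightarrow> nat \<Rightarrow> path \<Rightarrow> real" where
  "sum_sq v j \<omega> = (\<Sum>i<j. (coord (v (Suc i)) \<omega> - coord (v i) \<omega>)\<^sup>2)"

lemma past_increment_power:
  "0 \<le> r \<Longrightarrow> r \<le> t \<Longrightarrow> t \<le> s \<Longrightarrow> past s (\<lambda>\<omega>. (coord t \<omega> - coord r \<omega>) ^ k)"
  by (intro past_power past_diff past_coord) auto

lemma past_sum_sq:
  assumes "0 \<le> v 0" "mono v" "v j \<le> s"
  shows "past s (sum_sq v j)"
proof -
  have "0 \<le> v i \<and> v i \<le> v (Suc i) \<and> v (Suc i) \<le> s" if "i < j" for i
    using assms monoD[OF assms(2), of 0 i] monoD[OF assms(2), of i "Suc i"]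
      monoD[OF assms(2), of "Suc i" j] that by auto
  then have "past s (\<lambda>\<omega>. \<Sum>i\<in>{..<j}. (coord (v (Suc i)) \<omega> - coord (v i) \<omega>)\<^sup>2)"
    by (intro past_sum past_increment_power) auto
  then show ?thesis by (simp add: sum_sq_def[abs_def])
qed

lemma sum_sq_Suc: "sum_sq v (Suc j) \<omega> = sum_sq v j \<omega> + (coord (v (Suc j)) \<omega> - coord (v j) \<omega>)\<^sup>2"
  by (simp add: sum_sq_def)

section \<open>Upper means of linear and quadratic functionals of \<open>B\<close>\<close>

context gbm
begin

text \<open>Sublinearity gives one inequality; the other comes from adding \<open>- Y\<close> back,
  which is why both signs are assumed.\<close>

lemma E_add_null:
  assumes "fin X" "fin Y" "E Y \<le> 0" "E (\<lambda>\<omega>. - Y \<omega>) \<le> 0"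
  shows "E (\<lambda>\<omega>. X \<omega> + Y \<omega>) = E X"
proof (rule antisym)
  show "E (\<lambda>\<omega>. X \<omega> + Y \<omega>) \<le> E X" using E_add_le[OF assms(1,2)] assms(3) by simp
  show "E X \<le> E (\<lambda>\<omega>. X \<omega> + Y \<omega>)"
    using E_add_le[OF fin_add[OF assms(1,2)] fin_uminus[OF assms(2)]] assms(4) by simp
qed

lemma viscosity_E:
  "\<phi> \<in> C_lLip 1 \<Longrightarrow> viscosity_solution (G_fun \<sigma>l \<sigma>u) (\<lambda>x. \<phi> [x]) (\<lambda>t x. E (\<lambda>\<omega>. \<phi> [x + coord t \<omega>]))"
  using GBM unfolding G_Brownian_motion_def by blast

lemma continuous_E:
  assumes "\<phi> \<in> C_lLip 1" shows "continuous_on {0..} (\<lambda>t. E (\<lambda>\<omega>. \<phi> [coord t \<omega>]))"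
proof -
  have "continuous_on ({0..} \<times> UNIV) (\<lambda>z. E (\<lambda>\<omega>. \<phi> [snd z + coord (fst z) \<omega>]))"
    using viscosity_E[OF assms] by (simp add: viscosity_solution_def case_prod_beta)
  then have "continuous_on {0..} (\<lambda>t. E (\<lambda>\<omega>. \<phi> [snd (t, 0::real) + coord (fst (t, 0::real)) \<omega>]))"
    by (rule continuous_on_compose2) (auto intro!: continuous_intros)
  then show ?thesis by simp
qed

lemma fin_coord: "0 \<le> t \<Longrightarrow> fin (\<lambda>\<omega>. k * coord t \<omega>)"
  by (intro fin_past[of t] past_cmult past_coord) auto

lemma fin_coord2: "0 \<le> t \<Longrightarrow> fin (\<lambda>\<omega>. k * (coord t \<omega>)\<^sup>2)"
  by (intro fin_past[of t] past_cmult past_power past_coord) auto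

text \<open>The solution with initial value \<open>k * x\<close> has zero second derivative, so its
  speed is \<open>G_fun \<sigma>l \<sigma>u 0 = 0\<close>. Since \<open>k\<close> may have either
  sign, this says that \<open>B\<close> has no mean uncertainty.\<close>

lemma E_coord:
  assumes t: "0 \<le> t" shows "E (\<lambda>\<omega>. k * coord t \<omega>) = 0"
proof -
  define a where "a t = E (\<lambda>\<omega>. k * coord t \<omega>)" for t
  have phi: "(\<lambda>x. k * x ! 0) \<in> C_lLip 1" by (intro C_lLip_mult C_lLip_const C_lLip_nth) simp
  have add: "a (s + t) = a s + a t" if "0 \<le> s" "0 \<le> t" for s t
  proof -
    have "a (s + t) = E (\<lambda>\<omega>. (\<lambda>x. k * x ! 0 + k * x ! 1) (map (\<lambda>X. X \<omega>) [coord s] @ [coord (s + t) \<omega> - coord s \<omega>]))"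
      by (simp add: a_def algebra_simps)
    also have "\<dots> = E (\<lambda>\<omega>. E (\<lambda>\<omega>'. (\<lambda>x. k * x ! 0 + k * x ! 1) (map (\<lambda>X. X \<omega>) [coord s] @ [coord (s + t) \<omega>' - coord s \<omega>'])))"
      using that by (intro past_independence) (auto intro!: past_coord C_lLip_add C_lLip_mult C_lLip_nth)
    also have "\<dots> = E (\<lambda>\<omega>. k * coord s \<omega> + E (\<lambda>\<omega>'. k * (coord (s + t) \<omega>' - coord s \<omega>')))"
    proof -
      have f: "fin (\<lambda>\<omega>'. k * (coord (s + t) \<omega>' - coord s \<omega>'))"
        using that by (intro fin_past[of "s + t"] past_cmult past_diff past_coord) auto
      show ?thesis by (simp add: E_const_add[OF f])
    qed
    also have "E (\<lambda>\<omega>'. k * (coord (s + t) \<omega>' - coord s \<omega>')) = a t"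
      using stationary_E[OF that(1), of "s + t", OF _ phi] that by (simp add: a_def)
    also have "E (\<lambda>\<omega>. k * coord s \<omega> + a t) = a s + a t"
      using E_add_const[OF fin_coord[OF that(1)]] by (simp add: a_def)
    finally show ?thesis .
  qed
  have lin: "a t = a 1 * t" if "0 \<le> t" for t
    using add continuous_E[OF phi] that by (intro additive_continuous_linear) (auto simp: a_def[abs_def])
  have "a 1 = G_fun \<sigma>l \<sigma>u 0"
  proof (rule viscosity_solution_separated[OF viscosity_E[OF phi], where p = "\<lambda>x. k * x" and p' = "\<lambda>_. k"
      and p'' = "\<lambda>_. 0" and x = 0])
    fix t x :: real assume t: "0 \<le> t"
    have "E (\<lambda>\<omega>. k * [x + coord t \<omega>] ! 0) = E (\<lambda>\<omega>. k * x + k * coord t \<omega>)" by (simp add: algebra_simps)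
    also have "\<dots> = k * x + a 1 * t" by (subst E_const_add[OF fin_coord[OF t]]) (simp add: lin[OF t, unfolded a_def] a_def)
    finally show "E (\<lambda>\<omega>. k * [x + coord t \<omega>] ! 0) = k * x + a 1 * t" .
  qed (auto intro!: derivative_eq_intros)
  then show ?thesis using lin[OF t] sig by (simp add: G_fun_simps a_def)
qed

text \<open>\<open>2 * k\<close> is the second derivative of \<open>k * x\<^sup>2\<close>. The
  number turns out to be the upper mean of \<open>k\<close> times the quadratic variation at time 1,
  and equals the maximum of \<open>k * c\<close> over the speeds \<open>c\<close> between
  \<open>\<sigma>l\<^sup>2\<close> and \<open>\<sigma>u\<^sup>2\<close>.\<close>

definition gam :: "real \<Rightarrow> real" where "gam k = G_fun \<sigma>l \<sigma>u (2 * k)"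

lemma gam_simps [simp]: "gam 1 = \<sigma>u\<^sup>2" "gam (- 1) = - \<sigma>l\<^sup>2"
  using sig by (simp_all add: gam_def G_fun_simps)

text \<open>Expanding the square leaves the cross term \<open>2 * k * x * coord t \<omega>\<close>,
  whose upper mean is zero for both signs.\<close>

lemma E_shifted_square:
  assumes t: "0 \<le> t" shows "E (\<lambda>\<omega>. k * (x + coord t \<omega>)\<^sup>2) = k * x\<^sup>2 + E (\<lambda>\<omega>. k * (coord t \<omega>)\<^sup>2)"
proof -
  have "E (\<lambda>\<omega>. k * (x + coord t \<omega>)\<^sup>2) = E (\<lambda>\<omega>. (k * x\<^sup>2 + k * (coord t \<omega>)\<^sup>2) + (2 * k * x) * coord t \<omega>)"
    by (simp add: power2_eq_square algebra_simps)
  also have "\<dots> = E (\<lambda>\<omega>. k * x\<^sup>2 + k * (coord t \<omega>)\<^sup>2)"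
    using E_coord[OF t, of "2 * k * x"] E_coord[OF t, of "- (2 * k * x)"] t
    by (intro E_add_null fin_add fin_coord fin_coord2) auto
  finally show ?thesis by (simp add: E_const_add fin_coord2[OF t])
qed

lemma E_coord_square:
  assumes t: "0 \<le> t" shows "E (\<lambda>\<omega>. k * (coord t \<omega>)\<^sup>2) = gam k * t"
proof -
  define a where "a t = E (\<lambda>\<omega>. k * (coord t \<omega>)\<^sup>2)" for t
  have phi: "(\<lambda>x. k * (x ! 0)\<^sup>2) \<in> C_lLip 1" by (intro C_lLip_mult C_lLip_const C_lLip_nth square_C_lLip) simp
  have phi2: "(\<lambda>x. k * (y + x ! 0)\<^sup>2) \<in> C_lLip 1" for y
    by (intro C_lLip_mult C_lLip_const C_lLip_nth square_C_lLip C_lLip_add) simp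
  have add: "a (s + t) = a s + a t" if st: "0 \<le> s" "0 \<le> t" for s t
  proof -
    have "a (s + t) = E (\<lambda>\<omega>. (\<lambda>x. k * (x ! 0 + x ! 1)\<^sup>2) (map (\<lambda>X. X \<omega>) [coord s] @ [coord (s + t) \<omega> - coord s \<omega>]))"
      by (simp add: a_def)
    also have "\<dots> = E (\<lambda>\<omega>. E (\<lambda>\<omega>'. (\<lambda>x. k * (x ! 0 + x ! 1)\<^sup>2) (map (\<lambda>X. X \<omega>) [coord s] @ [coord (s + t) \<omega>' - coord s \<omega>'])))"
      using st by (intro past_independence)
        (auto intro!: past_coord C_lLip_add C_lLip_mult C_lLip_nth square_C_lLip)
    also have "\<dots> = E (\<lambda>\<omega>. k * (coord s \<omega>)\<^sup>2 + a t)"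
    proof -
      have "E (\<lambda>\<omega>'. k * (y + (coord (s + t) \<omega>' - coord s \<omega>'))\<^sup>2) = k * y\<^sup>2 + a t" for y
        using stationary_E[OF st(1), of "s + t", OF _ phi2[of y]] st E_shifted_square[OF st(2), of k y]
        by (simp add: a_def)
      then show ?thesis by simp
    qed
    also have "E (\<lambda>\<omega>. k * (coord s \<omega>)\<^sup>2 + a t) = a s + a t"
      using E_add_const[OF fin_coord2[OF st(1)]] by (simp add: a_def)
    finally show ?thesis .
  qed
  have lin: "a t = a 1 * t" if "0 \<le> t" for t
    using add continuous_E[OF phi] that by (intro additive_continuous_linear) (auto simp: a_def[abs_def])
  have "a 1 = G_fun \<sigma>l \<sigma>u (2 * k)"
  proof (rule viscosity_solution_separated[OF viscosity_E[OF phi], where p = "\<lambda>x. k * x\<^sup>2" and p' = "\<lambda>x. 2 * k * x"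
      and p'' = "\<lambda>_. 2 * k" and x = 0])
    fix t x :: real assume t: "0 \<le> t"
    show "E (\<lambda>\<omega>. k * ([x + coord t \<omega>] ! 0)\<^sup>2) = k * x\<^sup>2 + a 1 * t"
      using E_shifted_square[OF t, of k x] lin[OF t] by (simp add: a_def)
  qed (auto intro!: derivative_eq_intros)
  then show ?thesis using lin[OF t] by (simp add: gam_def a_def)
qed

lemma E_increment_square:
  assumes "0 \<le> s" "s \<le> t" shows "E (\<lambda>\<omega>. k * (coord t \<omega> - coord s \<omega>)\<^sup>2) = gam k * (t - s)"
proof -
  have phi: "(\<lambda>x. k * (x ! 0)\<^sup>2) \<in> C_lLip 1" by (intro C_lLip_mult C_lLip_const C_lLip_nth square_C_lLip) simp
  from stationary_E[OF assms phi] E_coord_square[of "t - s" k] assms show ?thesis by simp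
qed

text \<open>Peel off the last square: integrating it out turns \<open>g\<close> into a test function
  \<open>\<psi>\<close> of the shorter sum, to which the induction hypothesis applies; the same
  peeling with frozen entries restores the longer sum in the inner expectation.\<close>

lemma past_independence_sum_sq:
  assumes Xs: "\<And>X. X \<in> set Xs \<Longrightarrow> past (v 0) X" and v: "0 \<le> v 0" "mono v"
    and g: "g \<in> C_lLip (Suc (length Xs))"
  shows "E (\<lambda>\<omega>. g (map (\<lambda>X. X \<omega>) Xs @ [sum_sq v j \<omega>])) =
    E (\<lambda>\<omega>. E (\<lambda>\<omega>'. g (map (\<lambda>X. X \<omega>) Xs @ [sum_sq v j \<omega>'])))"
  using g
proof (induction j arbitrary: g)
  case 0
  show ?case by (simp add: sum_sq_def)
next
  case (Suc j)
  let ?n = "length Xs"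
  have v1: "0 \<le> v j" "v j \<le> v (Suc j)" "v 0 \<le> v j"
    using v monoD[OF v(2), of 0 j] monoD[OF v(2), of j "Suc j"] by auto
  \<comment> \<open>The two entries \<open>z\<close> and \<open>y\<close> after the first
    \<open>?n\<close> are merged into \<open>z + y\<^sup>2\<close>, the running sum plus the new
    square.\<close>
  define hs where "hs = map (\<lambda>i (x :: real list). x ! i) [0..<?n] @ [\<lambda>x. x ! ?n + (x ! Suc ?n)\<^sup>2]"
  define \<phi> where "\<phi> = (\<lambda>x. g (map (\<lambda>h. h x) hs))"
  have hs: "map (\<lambda>h. h (x @ [z] @ [y])) hs = x @ [z + y\<^sup>2]" if "length x = ?n" for x z y
    by (rule nth_equalityI) (auto simp: hs_def nth_append that less_Suc_eq)
  have phi: "\<phi> \<in> C_lLip (Suc (Suc ?n))"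
    unfolding \<phi>_def using Suc.prems
    by (intro C_lLip_comp) (auto simp: hs_def intro!: C_lLip_nth C_lLip_add square_C_lLip)
  define \<psi> where "\<psi> x = E (\<lambda>\<omega>. \<phi> (x @ [coord (v (Suc j)) \<omega> - coord (v j) \<omega>]))" for x
  have psi: "\<psi> \<in> C_lLip (Suc ?n)"
    unfolding \<psi>_def using v1 by (intro C_lLip_E_past[OF phi, of "v (Suc j)"] past_diff past_coord) auto
  \<comment> \<open>Stated for arbitrary \<open>Ys\<close>, because it is used for \<open>Xs\<close>
    itself and for the constants \<open>\<lambda>_. X \<omega>\<close>.\<close>
  have step: "E (\<lambda>\<omega>. g (map (\<lambda>X. X \<omega>) Ys @ [sum_sq v (Suc j) \<omega>])) =
      E (\<lambda>\<omega>. \<psi> (map (\<lambda>X. X \<omega>) Ys @ [sum_sq v j \<omega>]))"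
    if Ys: "\<And>X. X \<in> set Ys \<Longrightarrow> past (v 0) X" "length Ys = ?n" for Ys
  proof -
    have "E (\<lambda>\<omega>. \<phi> (map (\<lambda>X. X \<omega>) (Ys @ [sum_sq v j]) @ [coord (v (Suc j)) \<omega> - coord (v j) \<omega>])) =
      E (\<lambda>\<omega>. E (\<lambda>\<omega>'. \<phi> (map (\<lambda>X. X \<omega>) (Ys @ [sum_sq v j]) @ [coord (v (Suc j)) \<omega>' - coord (v j) \<omega>'])))"
      using Ys v v1 phi
      by (intro past_independence) (auto intro!: past_sum_sq intro: past_mono[OF Ys(1)])
    then show ?thesis
      using Ys(2) by (simp add: \<psi>_def \<phi>_def hs[simplified] sum_sq_Suc)
  qed
  have "E (\<lambda>\<omega>. g (map (\<lambda>X. X \<omega>) Xs @ [sum_sq v (Suc j) \<omega>])) = E (\<lambda>\<omega>. \<psi> (map (\<lambda>X. X \<omega>) Xs @ [sum_sq v j \<omega>]))"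
    by (rule step) (use Xs in auto)
  also have "\<dots> = E (\<lambda>\<omega>. E (\<lambda>\<omega>'. \<psi> (map (\<lambda>X. X \<omega>) Xs @ [sum_sq v j \<omega>'])))"
    by (rule Suc.IH[OF psi])
  also have "\<dots> = E (\<lambda>\<omega>. E (\<lambda>\<omega>'. g (map (\<lambda>X. X \<omega>) Xs @ [sum_sq v (Suc j) \<omega>'])))"
  proof (rule upper_exp_cong)
    fix \<omega>
    show "E (\<lambda>\<omega>'. \<psi> (map (\<lambda>X. X \<omega>) Xs @ [sum_sq v j \<omega>'])) =
        E (\<lambda>\<omega>'. g (map (\<lambda>X. X \<omega>) Xs @ [sum_sq v (Suc j) \<omega>']))"
    proof -
      have "past (v 0) X" if "X \<in> set (map (\<lambda>X _. X \<omega>) Xs)" for X using that by auto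
      note step[of "map (\<lambda>X _. X \<omega>) Xs", OF this]
      then show ?thesis by (simp add: comp_def)
    qed
  qed
  finally show ?case .
qed

text \<open>Each square has a constant conditional upper mean, so the means add up exactly and the
  value depends only on the end points.\<close>

lemma E_sum_sq:
  assumes v: "0 \<le> v 0" "mono v"
  shows "E (\<lambda>\<omega>. k * sum_sq v j \<omega>) = gam k * (v j - v 0)"
proof (induction j)
  case (Suc j)
  have v1: "0 \<le> v j" "v j \<le> v (Suc j)"
    using v monoD[OF v(2), of 0 j] monoD[OF v(2), of j "Suc j"] by auto
  let ?c = "gam k * (v (Suc j) - v j)"
  have "E (\<lambda>\<omega>. (\<lambda>x. k * x ! 0 + k * (x ! 1)\<^sup>2) (map (\<lambda>X. X \<omega>) [sum_sq v j] @ [coord (v (Suc j)) \<omega> - coord (v j) \<omega>])) =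
    E (\<lambda>\<omega>. E (\<lambda>\<omega>'. (\<lambda>x. k * x ! 0 + k * (x ! 1)\<^sup>2) (map (\<lambda>X. X \<omega>) [sum_sq v j] @ [coord (v (Suc j)) \<omega>' - coord (v j) \<omega>'])))"
    using v v1 by (intro past_independence)
      (auto intro!: past_sum_sq C_lLip_add C_lLip_mult C_lLip_nth square_C_lLip)
  moreover have "fin (\<lambda>\<omega>. k * (coord (v (Suc j)) \<omega> - coord (v j) \<omega>)\<^sup>2)"
    using v1 by (intro fin_past[of "v (Suc j)"] past_cmult past_increment_power) auto
  ultimately have "E (\<lambda>\<omega>. k * sum_sq v (Suc j) \<omega>) = E (\<lambda>\<omega>. k * sum_sq v j \<omega> + ?c)"
    by (simp add: E_const_add E_increment_square[OF v1] sum_sq_Suc algebra_simps)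
  also have "\<dots> = E (\<lambda>\<omega>. k * sum_sq v j \<omega>) + ?c"
    using v by (intro E_add_const fin_past[of "v j"] past_cmult past_sum_sq) auto
  finally show ?case using Suc by (simp add: algebra_simps)
qed (simp add: sum_sq_def)

text \<open>The compensated sums \<open>S\<^sub>j\<close> have nonpositive conditional drift, and
  \<open>(x + d)\<^sup>+\<^sup>2 \<le> x\<^sup>+\<^sup>2 + 2 x\<^sup>+ d + d\<^sup>2\<close>.\<close>

lemma sum_sq_pos_part:
  fixes k :: real
  assumes v: "0 \<le> v 0" "mono v" and P: "P \<in> \<P>"
  defines "S \<equiv> \<lambda>j \<omega>. k * sum_sq v j \<omega> - gam k * (v j - v 0)"
  shows "(\<integral>\<omega>. (max 0 (S j \<omega>))\<^sup>2 \<partial>P) \<le>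
    (\<Sum>i<j. \<integral>\<omega>. (k * (coord (v (Suc i)) \<omega> - coord (v i) \<omega>)\<^sup>2 - gam k * (v (Suc i) - v i))\<^sup>2 \<partial>P)"
proof (induction j)
  case 0
  show ?case by (simp add: S_def sum_sq_def)
next
  case (Suc j)
  have v1: "0 \<le> v j" "v j \<le> v (Suc j)"
    using v monoD[OF v(2), of 0 j] monoD[OF v(2), of j "Suc j"] by auto
  let ?h = "gam k * (v (Suc j) - v j)"
  define D where "D \<omega> = k * (coord (v (Suc j)) \<omega> - coord (v j) \<omega>)\<^sup>2 - ?h" for \<omega>
  have lip: "1-lipschitz_on UNIV (\<lambda>x::real. max 0 x)"
    by (auto intro!: lipschitz_onI simp: dist_real_def)
  have pS: "past (v j) (\<lambda>\<omega>. max 0 (S j \<omega>))"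
    unfolding S_def using v
    by (intro past_lipschitz[OF _ lip] past_diff past_cmult past_sum_sq past_const) auto
  have pD: "past (v (Suc j)) D"
    unfolding D_def using v1 by (intro past_diff past_cmult past_increment_power past_const) auto
  note pS' = past_mono[OF pS v1(2)]
  have f1: "fin (\<lambda>\<omega>. (max 0 (S j \<omega>))\<^sup>2)" by (rule fin_past[OF past_power[OF pS']])
  have f2: "fin (\<lambda>\<omega>. 2 * (max 0 (S j \<omega>) * D \<omega>))" by (rule fin_past[OF past_cmult[OF past_mult[OF pS' pD]]])
  have f3: "fin (\<lambda>\<omega>. (D \<omega>)\<^sup>2)" by (rule fin_past[OF past_power[OF pD]])
  have S: "S (Suc j) \<omega> = S j \<omega> + D \<omega>" for \<omega> by (simp add: S_def D_def sum_sq_Suc algebra_simps)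
  have "past (v (Suc j)) (S (Suc j))"
    unfolding S_def using v by (intro past_diff past_cmult past_sum_sq past_const) auto
  from fin_past[OF past_power[OF past_lipschitz[OF this lip]]]
  have f4: "fin (\<lambda>\<omega>. (max 0 (S j \<omega> + D \<omega>))\<^sup>2)" unfolding S .
  have fD: "fin D" by (rule fin_past[OF pD])
  have ED: "E D = 0"
  proof -
    have "fin (\<lambda>\<omega>. k * (coord (v (Suc j)) \<omega> - coord (v j) \<omega>)\<^sup>2)"
      using v1 by (intro fin_past[of "v (Suc j)"] past_cmult past_increment_power) auto
    from E_add_const[OF this, of "- ?h"] show ?thesis
      unfolding D_def by (simp add: E_increment_square[OF v1])
  qed
  have "E (\<lambda>\<omega>. (\<lambda>x. 2 * (x ! 0 * (k * (x ! 1)\<^sup>2 + - ?h))) (map (\<lambda>X. X \<omega>) [\<lambda>\<omega>. max 0 (S j \<omega>)] @ [coord (v (Suc j)) \<omega> - coord (v j) \<omega>])) =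
    E (\<lambda>\<omega>. E (\<lambda>\<omega>'. (\<lambda>x. 2 * (x ! 0 * (k * (x ! 1)\<^sup>2 + - ?h))) (map (\<lambda>X. X \<omega>) [\<lambda>\<omega>. max 0 (S j \<omega>)] @ [coord (v (Suc j)) \<omega>' - coord (v j) \<omega>'])))"
    using pS v1 by (intro past_independence)
      (auto intro!: C_lLip_diff C_lLip_mult C_lLip_nth square_C_lLip)
  then have "E (\<lambda>\<omega>. 2 * (max 0 (S j \<omega>) * D \<omega>)) = E (\<lambda>\<omega>. E (\<lambda>\<omega>'. (2 * max 0 (S j \<omega>)) * D \<omega>'))"
    by (simp add: D_def mult.assoc)
  also have "\<dots> = 0" by (simp add: E_cmult[OF fD] ED)
  finally have "(\<integral>\<omega>. 2 * (max 0 (S j \<omega>) * D \<omega>) \<partial>P) \<le> 0" using integral_le_E[OF f2 P] by simp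
  moreover have "(\<integral>\<omega>. (max 0 (S (Suc j) \<omega>))\<^sup>2 \<partial>P)
      \<le> (\<integral>\<omega>. (max 0 (S j \<omega>))\<^sup>2 + 2 * (max 0 (S j \<omega>) * D \<omega>) + (D \<omega>)\<^sup>2 \<partial>P)"
  proof (rule integral_mono)
    have "(max 0 (x + d))\<^sup>2 \<le> (max 0 x)\<^sup>2 + 2 * (max 0 x * d) + d\<^sup>2" for x d :: real
    proof -
      have "(max 0 x + d)\<^sup>2 = (max 0 x)\<^sup>2 + 2 * (max 0 x * d) + d\<^sup>2" by (simp add: power2_sum)
      moreover have "(max 0 (x + d))\<^sup>2 \<le> (max 0 x + d)\<^sup>2"
      proof (cases "x + d \<le> 0")
        case False
        then show ?thesis by (intro power_mono) auto
      qed simp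
      ultimately show ?thesis by simp
    qed
    then show "(max 0 (S (Suc j) \<omega>))\<^sup>2 \<le> (max 0 (S j \<omega>))\<^sup>2 + 2 * (max 0 (S j \<omega>) * D \<omega>) + (D \<omega>)\<^sup>2" for \<omega>
      by (simp add: S)
    show "integrable P (\<lambda>\<omega>. (max 0 (S (Suc j) \<omega>))\<^sup>2)" using fin_integrable[OF f4 P] by (simp add: S)
    show "integrable P (\<lambda>\<omega>. (max 0 (S j \<omega>))\<^sup>2 + 2 * (max 0 (S j \<omega>) * D \<omega>) + (D \<omega>)\<^sup>2)"
      by (intro Bochner_Integration.integrable_add fin_integrable[OF f1 P] fin_integrable[OF f2 P] fin_integrable[OF f3 P])
  qed
  moreover have "\<dots> = (\<integral>\<omega>. (max 0 (S j \<omega>))\<^sup>2 \<partial>P) + (\<integral>\<omega>. 2 * (max 0 (S j \<omega>) * D \<omega>) \<partial>P) + (\<integral>\<omega>. (D \<omega>)\<^sup>2 \<partial>P)"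
    by (simp only: Bochner_Integration.integral_add Bochner_Integration.integrable_add
        fin_integrable[OF f1 P] fin_integrable[OF f2 P] fin_integrable[OF f3 P])
  ultimately show ?case using Suc.IH by (simp add: D_def)
qed

end

section \<open>Two-sided bounds for the quadratic variation\<close>

text \<open>Not cut off at \<open>t\<close>: the points run on for indices beyond \<open>n\<close>,
  so the sequence is monotone on all of \<open>nat\<close>, as the lemmas on \<open>sum_sq\<close>
  ask.\<close>

definition unif :: "real \<Rightarrow> real \<Rightarrow> nat \<Rightarrow> nat \<Rightarrow> real" where
  "unif s t n i = s + (t - s) * (real i / real n)"

lemma unif_0 [simp]: "unif s t n 0 = s"
  and unif_n [simp]: "0 < n \<Longrightarrow> unif s t n n = t"
  and unif_step: "0 < n \<Longrightarrow> unif s t n (Suc i) - unif s t n i = (t - s) / real n"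
  by (auto simp: unif_def field_simps)

lemma mono_unif: "s \<le> t \<Longrightarrow> mono (unif s t n)"
  by (auto simp: unif_def mono_def intro!: mult_left_mono divide_right_mono)

lemma sum_squares_map: "sum_squares (map v [0..<Suc N]) = sum_sq v N"
  unfolding sum_squares_def sum_sq_def by (intro ext sum.cong) (auto simp del: upt_Suc)

lemma partition_of_map:
  assumes "mono v" "v 0 = 0" "v N = t" shows "partition_of t (map v [0..<Suc N])"
proof -
  have "sorted (map v [0..<Suc N])"
    using assms(1) by (auto simp: sorted_iff_nth_mono monoD simp del: upt_Suc)
  moreover have "hd (map v [0..<Suc N]) = 0" using assms(2) by (subst hd_map) (auto simp del: upt_Suc)
  ultimately show ?thesis using assms(3) by (simp add: partition_of_def)
qed

lemma mesh_le_map: "(\<And>i. i < N \<Longrightarrow> v (Suc i) - v i \<le> d) \<Longrightarrow> mesh_le (map v [0..<Suc N]) d"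
  unfolding mesh_le_def by (auto simp del: upt_Suc)

lemma sum_sq_append: "sum_sq v (N + m) \<omega> = sum_sq v N \<omega> + sum_sq (\<lambda>i. v (N + i)) m \<omega>"
  by (induction m) (auto simp: sum_sq_Suc sum_sq_def[of _ 0])

lemma sum_sq_cong: "(\<And>i. i \<le> N \<Longrightarrow> v i = w i) \<Longrightarrow> sum_sq v N \<omega> = sum_sq w N \<omega>"
  unfolding sum_sq_def by (intro sum.cong) auto

text \<open>\<open>Suc n\<close> pieces instead of \<open>n\<close>, so that every index gives a
  genuine partition of \<open>[s, t]\<close>.\<close>

definition Z :: "real \<Rightarrow> real \<Rightarrow> nat \<Rightarrow> path \<Rightarrow> real" where
  "Z s t n = sum_sq (unif s t (Suc n)) (Suc n)"

lemma past_Z: "0 \<le> s \<Longrightarrow> s \<le> t \<Longrightarrow> t \<le> r \<Longrightarrow> past r (Z s t n)"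
  unfolding Z_def by (rule past_sum_sq) (auto intro: mono_unif)

lemma Z_measurable: "0 \<le> s \<Longrightarrow> s \<le> t \<Longrightarrow> Z s t n \<in> borel_measurable borel"
  by (rule past_measurable[OF past_Z]) auto

text \<open>A partition of \<open>[0, t]\<close> through \<open>s\<close>: its sum of squares splits at \<open>s\<close>, which transfers the convergence
  assumed on intervals \<open>[0, t]\<close> to \<open>[s, t]\<close>.\<close>

definition joint_unif :: "real \<Rightarrow> real \<Rightarrow> nat \<Rightarrow> nat \<Rightarrow> real" where
  "joint_unif s t n i = (if i \<le> n then unif 0 s n i else unif s t n (i - n))"

lemma joint_unif_simps:
  assumes "0 < n" shows "joint_unif s t n 0 = 0" "joint_unif s t n (n + n) = t"
    "i \<le> n \<Longrightarrow> joint_unif s t n i = unif 0 s n i" "joint_unif s t n (n + i) = unif s t n i"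
  using assms by (auto simp: joint_unif_def)

lemma joint_unif_step:
  assumes "0 < n" "0 \<le> s" "s \<le> t"
  shows "joint_unif s t n (Suc i) - joint_unif s t n i \<in> {0..t / real n}"
proof (cases "i < n")
  case True
  then have "joint_unif s t n (Suc i) - joint_unif s t n i = s / real n"
    using assms by (simp add: joint_unif_def unif_step)
  then show ?thesis using assms by (auto intro!: divide_right_mono)
next
  case False
  then obtain k where k: "i = n + k" by (metis le_add_diff_inverse not_less)
  have "joint_unif s t n (n + Suc k) - joint_unif s t n (n + k) = (t - s) / real n"
    by (simp only: joint_unif_simps[OF assms(1)] unif_step[OF assms(1)])
  then show ?thesis using assms by (auto simp: k intro!: divide_right_mono)
qed

lemma sum_sq_joint_unif:
  "sum_sq (joint_unif s t (Suc n)) (Suc n + Suc n) \<omega> = Z 0 s n \<omega> + Z s t n \<omega>"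
proof -
  have "sum_sq (joint_unif s t (Suc n)) (Suc n) \<omega> = Z 0 s n \<omega>"
    unfolding Z_def by (rule sum_sq_cong) (simp add: joint_unif_simps)
  then show ?thesis
    unfolding sum_sq_append by (simp add: joint_unif_simps Z_def del: add_Suc)
qed

text \<open>The sum is at most the largest squared increment times the sum of squares: the first
  factor tends to 0 by uniform continuity on \<open>[s, t]\<close>, the second stays bounded because
  it converges along \<open>r\<close>.\<close>

lemma fourth_powers_tendsto_0:
  assumes st: "0 \<le> s" "s \<le> t" and Z: "(\<lambda>n. Z s t (r n) \<omega>) \<longlonglongrightarrow> l" and r: "strict_mono r"
  shows "(\<lambda>n. \<Sum>i<Suc (r n). (coord (unif s t (Suc (r n)) (Suc i)) \<omega> - coord (unif s t (Suc (r n)) i) \<omega>) ^ 4) \<longlonglongrightarrow> 0"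
    (is "?Y \<longlonglongrightarrow> 0")
proof -
  have Z0: "0 \<le> Z s t n \<omega>" for n unfolding Z_def sum_sq_def by (intro sum_nonneg) auto
  have "convergent (\<lambda>n. Z s t (r n) \<omega>)" using Z by (auto simp: convergent_def)
  then obtain K where K: "\<And>n. \<bar>Z s t (r n) \<omega>\<bar> \<le> K" "0 < K"
    using convergent_imp_Bseq BseqE by (metis real_norm_def)
  have uc: "uniformly_continuous_on {s..t} (\<lambda>u. coord u \<omega>)"
    using st by (intro compact_uniformly_continuous continuous_on_subset[OF coord_continuous_on]) auto
  show ?thesis
  proof (rule LIMSEQ_I)
    fix e :: real assume e: "0 < e"
    \<comment> \<open>Chosen so that \<open>\<epsilon>\<^sup>2 * K = e / 2\<close>.\<close>
    define \<epsilon> where "\<epsilon> = sqrt (e / (2 * K))"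
    have eps: "0 < \<epsilon>" "\<epsilon>\<^sup>2 * K < e" using e K(2) by (auto simp: \<epsilon>_def)
    obtain d where d: "d > 0" "\<And>x y. x \<in> {s..t} \<Longrightarrow> y \<in> {s..t} \<Longrightarrow> dist y x < d \<Longrightarrow> dist (coord y \<omega>) (coord x \<omega>) < \<epsilon>"
      using uc eps(1) unfolding uniformly_continuous_on_def by blast
    obtain N where N: "(t - s) / d < real N" using reals_Archimedean2 by blast
    show "\<exists>no. \<forall>n\<ge>no. norm (?Y n - 0) < e"
    proof (intro exI[of _ N] allI impI)
      fix n assume "N \<le> n"
      \<comment> \<open>A strictly increasing \<open>r\<close> satisfies \<open>n \<le> r n\<close>,
        hence the mesh is below \<open>d\<close>.\<close>
      then have n: "(t - s) / d < real (Suc (r n))" using N seq_suble[OF r, of n] by linarith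
      let ?u = "unif s t (Suc (r n))"
      have "(coord (?u (Suc i)) \<omega> - coord (?u i) \<omega>) ^ 4 \<le> \<epsilon>\<^sup>2 * (coord (?u (Suc i)) \<omega> - coord (?u i) \<omega>)\<^sup>2"
        if "i < Suc (r n)" for i
      proof -
        let ?x = "coord (?u (Suc i)) \<omega> - coord (?u i) \<omega>"
        have "s \<le> ?u i" "?u i \<le> ?u (Suc i)" "?u (Suc i) \<le> t"
          using that monoD[OF mono_unif[OF st(2)], of 0 i "Suc (r n)"] monoD[OF mono_unif[OF st(2)], of i "Suc i" "Suc (r n)"]
            monoD[OF mono_unif[OF st(2)], of "Suc i" "Suc (r n)" "Suc (r n)"] by auto
        moreover have "?u (Suc i) - ?u i < d"
          using n d(1) by (simp add: unif_step field_simps del: of_nat_Suc)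
        ultimately have "\<bar>?x\<bar> < \<epsilon>" using d(2)[of "?u i" "?u (Suc i)"] by (auto simp: dist_real_def)
        then have "?x\<^sup>2 \<le> \<epsilon>\<^sup>2" by (subst abs_le_square_iff[symmetric]) auto
        then have "?x\<^sup>2 * ?x\<^sup>2 \<le> \<epsilon>\<^sup>2 * ?x\<^sup>2" by (rule mult_right_mono) simp
        then show ?thesis by (simp add: power2_eq_square power4_eq_xxxx mult.assoc)
      qed
      then have "?Y n \<le> (\<Sum>i<Suc (r n). \<epsilon>\<^sup>2 * (coord (?u (Suc i)) \<omega> - coord (?u i) \<omega>)\<^sup>2)"
        by (intro sum_mono) auto
      also have "\<dots> = \<epsilon>\<^sup>2 * Z s t (r n) \<omega>" by (simp add: Z_def sum_sq_def sum_distrib_left del: sum.lessThan_Suc)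
      also have "\<dots> \<le> \<epsilon>\<^sup>2 * K" using K(1)[of n] by (intro mult_left_mono) auto
      finally have "?Y n < e" using eps(2) by linarith
      moreover have "0 \<le> ?Y n" by (intro sum_nonneg) auto
      ultimately show "norm (?Y n - 0) < e" by (simp only: real_norm_def)
    qed
  qed
qed

section \<open>Convergence of sums of squares in second moment\<close>

locale gbm_qv = gbm +
  fixes Q :: "real \<Rightarrow> path \<Rightarrow> real"
  assumes QV: "is_quadratic_variation \<P> Q"
begin

lemma Q_measurable: "0 \<le> t \<Longrightarrow> Q t \<in> borel_measurable borel"
  using QV unfolding is_quadratic_variation_def L_G_def by blast

text \<open>Translates the epsilon-delta form of \<open>is_quadratic_variation\<close>, stated for
  lists, into convergence along sequences of partitions given by functions.\<close>

lemma sum_sq_tendsto: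
  assumes t: "0 \<le> t" and v: "\<And>n. mono (v n)" "\<And>n. v n 0 = 0" "\<And>n. v n (N n) = t"
    and step: "\<And>n i. i < N n \<Longrightarrow> v n (Suc i) - v n i \<le> c / real (Suc n)"
  shows "(\<lambda>n. upper_moment \<P> 2 (\<lambda>\<omega>. sum_sq (v n) (N n) \<omega> - Q t \<omega>)) \<longlonglongrightarrow> 0"
proof (rule order_tendstoI)
  fix e :: ennreal assume "0 < e"
  then obtain d where d: "d > 0" "\<And>ts. partition_of t ts \<Longrightarrow> mesh_le ts d \<Longrightarrow>
      upper_moment \<P> 2 (\<lambda>\<omega>. sum_squares ts \<omega> - Q t \<omega>) < e"
    using QV t unfolding is_quadratic_variation_def by blast
  obtain M where M: "\<bar>c\<bar> / d < real M" using reals_Archimedean2 by blast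
  show "\<forall>\<^sub>F n in sequentially. upper_moment \<P> 2 (\<lambda>\<omega>. sum_sq (v n) (N n) \<omega> - Q t \<omega>) < e"
    unfolding eventually_sequentially
  proof (intro exI[of _ M] allI impI)
    fix n assume "M \<le> n"
    then have n: "\<bar>c\<bar> / d < real (Suc n)" using M by linarith
    have "c / real (Suc n) \<le> \<bar>c\<bar> / real (Suc n)" by (intro divide_right_mono) auto
    also have "\<dots> \<le> d" using n d(1) by (simp add: field_simps del: of_nat_Suc)
    finally have "mesh_le (map (v n) [0..<Suc (N n)]) d"
      using step by (intro mesh_le_map) (meson order_trans)
    from d(2)[OF partition_of_map[OF v] this]
    show "upper_moment \<P> 2 (\<lambda>\<omega>. sum_sq (v n) (N n) \<omega> - Q t \<omega>) < e"
      by (simp add: sum_squares_map del: upt_Suc)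
  qed
qed simp

text \<open>By \<open>(x - y)\<^sup>2 \<le> 2 * x\<^sup>2 + 2 * y\<^sup>2\<close>, read in
  \<open>ennreal\<close>; the factor 2 does no harm where moments only have to tend to 0.\<close>

lemma upper_moment_diff:
  assumes [measurable]: "X \<in> borel_measurable borel" "Y \<in> borel_measurable borel"
  shows "upper_moment \<P> 2 (\<lambda>\<omega>. X \<omega> - Y \<omega>) \<le> 2 * upper_moment \<P> 2 X + 2 * upper_moment \<P> 2 Y"
  unfolding upper_moment_def[of _ _ "\<lambda>\<omega>. X \<omega> - Y \<omega>"]
proof (rule SUP_least)
  fix P assume P: "P \<in> \<P>"
  have [measurable]: "X \<in> borel_measurable P" "Y \<in> borel_measurable P"
    using assms by (simp_all add: P_measurable[OF P])
  have "(x - y)\<^sup>2 \<le> 2 * x\<^sup>2 + 2 * y\<^sup>2" for x y :: real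
    using zero_le_power2[of "x + y"] by (simp add: power2_eq_square algebra_simps)
  then have "(\<integral>\<^sup>+\<omega>. ennreal (\<bar>X \<omega> - Y \<omega>\<bar>\<^sup>2) \<partial>P) \<le> (\<integral>\<^sup>+\<omega>. 2 * ennreal (\<bar>X \<omega>\<bar>\<^sup>2) + 2 * ennreal (\<bar>Y \<omega>\<bar>\<^sup>2) \<partial>P)"
    by (intro nn_integral_mono) (simp add: ennreal_mult'[symmetric] ennreal_plus[symmetric] ennreal_leI
        flip: ennreal_numeral del: ennreal_plus)
  also have "\<dots> = 2 * (\<integral>\<^sup>+\<omega>. ennreal (\<bar>X \<omega>\<bar>\<^sup>2) \<partial>P) + 2 * (\<integral>\<^sup>+\<omega>. ennreal (\<bar>Y \<omega>\<bar>\<^sup>2) \<partial>P)"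
    by (simp add: nn_integral_add nn_integral_cmult)
  also have "\<dots> \<le> 2 * upper_moment \<P> 2 X + 2 * upper_moment \<P> 2 Y"
    by (intro add_mono mult_left_mono upper_moment_ge P) auto
  finally show "(\<integral>\<^sup>+\<omega>. ennreal (\<bar>X \<omega> - Y \<omega>\<bar>\<^sup>2) \<partial>P) \<le> 2 * upper_moment \<P> 2 X + 2 * upper_moment \<P> 2 Y" .
qed

lemma Z_tendsto:
  assumes st: "0 \<le> s" "s \<le> t"
  shows "(\<lambda>n. upper_moment \<P> 2 (\<lambda>\<omega>. Z s t n \<omega> - (Q t \<omega> - Q s \<omega>))) \<longlonglongrightarrow> 0"
proof -
  \<comment> \<open>\<open>?A n - ?B n\<close> is the error to be estimated, because the sum over
    the joint partition contains \<open>Z 0 s n\<close>.\<close>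
  let ?A = "\<lambda>n \<omega>. sum_sq (joint_unif s t (Suc n)) (Suc n + Suc n) \<omega> - Q t \<omega>"
  let ?B = "\<lambda>n \<omega>. Z 0 s n \<omega> - Q s \<omega>"
  have A: "(\<lambda>n. upper_moment \<P> 2 (?A n)) \<longlonglongrightarrow> 0"
  proof (rule sum_sq_tendsto)
    show "mono (joint_unif s t (Suc n))" for n
      using joint_unif_step[OF _ st, of "Suc n"] by (auto simp: mono_iff_le_Suc)
    show "joint_unif s t (Suc n) (Suc i) - joint_unif s t (Suc n) i \<le> t / real (Suc n)" for n i
      using joint_unif_step[OF _ st, of "Suc n" i] by simp
  qed (use st in \<open>auto simp: joint_unif_simps simp del: add_Suc add_Suc_right\<close>)
  have B: "(\<lambda>n. upper_moment \<P> 2 (?B n)) \<longlonglongrightarrow> 0"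
    unfolding Z_def by (rule sum_sq_tendsto) (use st in \<open>auto intro: mono_unif simp: unif_step\<close>)
  have [measurable]: "Q t \<in> borel_measurable borel" "Q s \<in> borel_measurable borel"
    "\<And>n. Z 0 s n \<in> borel_measurable borel" "\<And>n. Z s t n \<in> borel_measurable borel"
    using st by (auto intro: Q_measurable Z_measurable)
  have le: "upper_moment \<P> 2 (\<lambda>\<omega>. Z s t n \<omega> - (Q t \<omega> - Q s \<omega>))
      \<le> 2 * upper_moment \<P> 2 (?A n) + 2 * upper_moment \<P> 2 (?B n)" for n
  proof -
    have "?A n \<in> borel_measurable borel" "?B n \<in> borel_measurable borel"
      unfolding sum_sq_joint_unif by measurable
    from upper_moment_diff[OF this] show ?thesis
      unfolding sum_sq_joint_unif by (simp add: algebra_simps)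
  qed
  have "(\<lambda>n. 2 * upper_moment \<P> 2 (?A n) + 2 * upper_moment \<P> 2 (?B n)) \<longlonglongrightarrow> 2 * 0 + 2 * 0"
    by (intro tendsto_add ennreal_tendsto_cmult A B) auto
  then have "(\<lambda>n. 2 * upper_moment \<P> 2 (?A n) + 2 * upper_moment \<P> 2 (?B n)) \<longlonglongrightarrow> 0" by simp
  from tendsto_sandwich[OF _ _ tendsto_const this] le show ?thesis by (simp add: always_eventually)
qed

lemma increment_L2:
  assumes st: "0 \<le> s" "s \<le> t" and P: "P \<in> \<P>"
  shows "integrable P (\<lambda>\<omega>. (Q t \<omega> - Q s \<omega>)\<^sup>2)"
    and "\<And>n. integrable P (\<lambda>\<omega>. (Z s t n \<omega> - (Q t \<omega> - Q s \<omega>))\<^sup>2)"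
    and "(\<lambda>n. \<integral>\<omega>. (Z s t n \<omega> - (Q t \<omega> - Q s \<omega>))\<^sup>2 \<partial>P) \<longlonglongrightarrow> 0"
proof -
  let ?R = "\<lambda>\<omega>. Q t \<omega> - Q s \<omega>"
  have [measurable]: "Q t \<in> borel_measurable P" "Q s \<in> borel_measurable P"
    "\<And>n. Z s t n \<in> borel_measurable P" "\<And>u. coord u \<in> borel_measurable P"
    using st by (auto simp: P_measurable[OF P] intro: Q_measurable Z_measurable)
  have lim: "(\<lambda>n. \<integral>\<^sup>+\<omega>. ennreal ((Z s t n \<omega> - ?R \<omega>)\<^sup>2) \<partial>P) \<longlonglongrightarrow> 0"
    by (rule tendsto_sandwich[OF _ _ tendsto_const Z_tendsto[OF st]])
      (use upper_moment_ge[OF P, of _ 2] in \<open>auto intro!: always_eventually\<close>)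
  then have "\<forall>\<^sub>F n in sequentially. (\<integral>\<^sup>+\<omega>. ennreal ((Z s t n \<omega> - ?R \<omega>)\<^sup>2) \<partial>P) < \<infinity>"
    by (rule order_tendstoD) simp
  \<comment> \<open>One approximation at finite distance is enough to make \<open>?R\<close> square
    integrable, because \<open>Z s t n0\<close> is.\<close>
  then obtain n0 where n0: "(\<integral>\<^sup>+\<omega>. ennreal ((Z s t n0 \<omega> - ?R \<omega>)\<^sup>2) \<partial>P) < \<infinity>"
    by (auto simp: eventually_sequentially)
  then have i0: "integrable P (\<lambda>\<omega>. (Z s t n0 \<omega> - ?R \<omega>)\<^sup>2)"
    by (intro integrableI_bounded) auto
  have iZ: "integrable P (\<lambda>\<omega>. (Z s t n \<omega>)\<^sup>2)" for n
    using st by (intro fin_integrable[OF _ P] fin_past[of t] past_power past_Z) auto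
  have sq: "a\<^sup>2 \<le> 2 * b\<^sup>2 + 2 * (b - a)\<^sup>2" "(a - b)\<^sup>2 \<le> 2 * a\<^sup>2 + 2 * b\<^sup>2" for a b :: real
    using zero_le_power2[of "2 * b - a"] zero_le_power2[of "a + b"] by (simp_all add: power2_eq_square algebra_simps)
  show R: "integrable P (\<lambda>\<omega>. (?R \<omega>)\<^sup>2)"
  proof (rule Bochner_Integration.integrable_bound)
    show "integrable P (\<lambda>\<omega>. 2 * (Z s t n0 \<omega>)\<^sup>2 + 2 * (Z s t n0 \<omega> - ?R \<omega>)\<^sup>2)" using i0 iZ by auto
    show "AE \<omega> in P. norm ((?R \<omega>)\<^sup>2) \<le> norm (2 * (Z s t n0 \<omega>)\<^sup>2 + 2 * (Z s t n0 \<omega> - ?R \<omega>)\<^sup>2)"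
      using sq(1) by auto
  qed measurable
  show iD: "integrable P (\<lambda>\<omega>. (Z s t n \<omega> - ?R \<omega>)\<^sup>2)" for n
  proof (rule Bochner_Integration.integrable_bound)
    show "integrable P (\<lambda>\<omega>. 2 * (Z s t n \<omega>)\<^sup>2 + 2 * (?R \<omega>)\<^sup>2)" using R iZ by auto
    show "AE \<omega> in P. norm ((Z s t n \<omega> - ?R \<omega>)\<^sup>2) \<le> norm (2 * (Z s t n \<omega>)\<^sup>2 + 2 * (?R \<omega>)\<^sup>2)"
      using sq(2) by auto
  qed measurable
  have "(\<integral>\<^sup>+\<omega>. ennreal ((Z s t n \<omega> - ?R \<omega>)\<^sup>2) \<partial>P) = ennreal (\<integral>\<omega>. (Z s t n \<omega> - ?R \<omega>)\<^sup>2 \<partial>P)" for n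
    by (rule nn_integral_eq_integral[OF iD]) auto
  with lim show "(\<lambda>n. \<integral>\<omega>. (Z s t n \<omega> - ?R \<omega>)\<^sup>2 \<partial>P) \<longlonglongrightarrow> 0"
    by (simp add: ennreal_tendsto_0_iff)
qed

text \<open>\<open>k = 1\<close> gives the upper bound and \<open>k = -1\<close> the lower one. The
  positive part of the limit \<open>T\<close> is compared with that of \<open>S n\<close>, whose
  second moment \<open>sum_sq_pos_part\<close> bounds through the mean of \<open>Y n\<close>, the
  sum of fourth powers, and a term of order \<open>1 / n\<close>.\<close>

lemma increment_bound_AE:
  assumes st: "0 \<le> s" "s \<le> t" and P: "P \<in> \<P>"
  shows "AE \<omega> in P. k * (Q t \<omega> - Q s \<omega>) \<le> gam k * (t - s)"
proof -
  let ?R = "\<lambda>\<omega>. Q t \<omega> - Q s \<omega>"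
  define u where "u n = unif s t (Suc n)" for n
  define Y where "Y n \<omega> = (\<Sum>i<Suc n. (coord (u n (Suc i)) \<omega> - coord (u n i) \<omega>) ^ 4)" for n \<omega>
  note L2 = increment_L2[OF st P]
  have [measurable]: "Q t \<in> borel_measurable P" "Q s \<in> borel_measurable P"
    "\<And>n. Z s t n \<in> borel_measurable P" "\<And>u. coord u \<in> borel_measurable P"
    using st by (auto simp: P_measurable[OF P] intro: Q_measurable Z_measurable)
  have [measurable]: "Y n \<in> borel_measurable P" for n unfolding Y_def by measurable
  have u: "0 \<le> u n i" "u n i \<le> u n (Suc i)" "mono (u n)" for n i
    using monoD[OF mono_unif[OF st(2), of "Suc n"], of 0 i] monoD[OF mono_unif[OF st(2), of "Suc n"], of i "Suc i"]
      mono_unif[OF st(2)] st(1) by (auto simp: u_def)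
  have i4: "integrable P (\<lambda>\<omega>. (coord (u n (Suc i)) \<omega> - coord (u n i) \<omega>) ^ 4)" for n i
    using u by (intro fin_integrable[OF _ P] fin_past[of "u n (Suc i)"] past_increment_power) auto
  then have iY: "integrable P (Y n)" for n unfolding Y_def by auto
  have Y0: "0 \<le> Y n \<omega>" for n \<omega> unfolding Y_def by (intro sum_nonneg) auto
  obtain r where r: "strict_mono r" and AE: "AE \<omega> in P. (\<lambda>n. (Z s t (r n) \<omega> - ?R \<omega>)\<^sup>2) \<longlonglongrightarrow> 0"
    using tendsto_L1_AE_subseq[of P "\<lambda>n \<omega>. (Z s t n \<omega> - ?R \<omega>)\<^sup>2"] L2 by auto
  have AE_Y: "AE \<omega> in P. (\<lambda>n. Y (r n) \<omega>) \<longlonglongrightarrow> 0"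
    using AE
  proof eventually_elim
    case (elim \<omega>)
    then have "(\<lambda>n. sqrt ((Z s t (r n) \<omega> - ?R \<omega>)\<^sup>2)) \<longlonglongrightarrow> sqrt 0" by (intro tendsto_real_sqrt)
    then have "(\<lambda>n. Z s t (r n) \<omega> - ?R \<omega>) \<longlonglongrightarrow> 0" by (simp add: tendsto_rabs_zero_iff)
    then have "(\<lambda>n. Z s t (r n) \<omega>) \<longlonglongrightarrow> ?R \<omega>" by (simp only: LIM_zero_iff)
    from fourth_powers_tendsto_0[OF st this r] show ?case by (simp add: Y_def u_def)
  qed
  \<comment> \<open>\<open>Y\<close> tends to 0 almost surely along \<open>r\<close>, but no
    integrable majorant for it is at hand; cut off at \<open>2 * (?R \<omega>)\<^sup>2\<close> it
    has one.\<close>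
  have min0: "(\<lambda>n. \<integral>\<omega>. min (Y (r n) \<omega>) (2 * (?R \<omega>)\<^sup>2) \<partial>P) \<longlonglongrightarrow> (\<integral>\<omega>. 0 \<partial>P)"
  proof (rule integral_dominated_convergence)
    show "integrable P (\<lambda>\<omega>. 2 * (?R \<omega>)\<^sup>2)" using L2(1) by simp
    show "AE \<omega> in P. (\<lambda>n. min (Y (r n) \<omega>) (2 * (?R \<omega>)\<^sup>2)) \<longlonglongrightarrow> 0"
      using AE_Y
    proof eventually_elim
      case (elim \<omega>)
      have "(\<lambda>n. min (Y (r n) \<omega>) (2 * (?R \<omega>)\<^sup>2)) \<longlonglongrightarrow> min 0 (2 * (?R \<omega>)\<^sup>2)"
        by (intro tendsto_min elim tendsto_const)
      then show ?case by simp
    qed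
    show "AE \<omega> in P. norm (min (Y (r n) \<omega>) (2 * (?R \<omega>)\<^sup>2)) \<le> 2 * (?R \<omega>)\<^sup>2" for n
      using Y0 by (auto simp: min_def)
  qed measurable
  \<comment> \<open>\<open>Y n\<close> is at most \<open>(Z s t n)\<^sup>2\<close>, hence at most
    \<open>2 * (Z s t n - ?R)\<^sup>2 + 2 * ?R\<^sup>2\<close>. What the cutoff loses is therefore
    at most the first term, which tends to 0 in mean.\<close>
  have Y_le: "Y n \<omega> \<le> 2 * (Z s t n \<omega> - ?R \<omega>)\<^sup>2 + min (Y n \<omega>) (2 * (?R \<omega>)\<^sup>2)" for n \<omega>
  proof -
    have "Y n \<omega> \<le> (Z s t n \<omega>)\<^sup>2"
    proof -
      have "(\<Sum>i\<in>I. (a i)\<^sup>2 * (a i)\<^sup>2) \<le> (\<Sum>i\<in>I. (a i)\<^sup>2) * (\<Sum>i\<in>I. (a i)\<^sup>2)" if "finite I" for I and a :: "nat \<Rightarrow> real"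
        unfolding sum_distrib_right
        by (intro sum_mono mult_left_mono member_le_sum that) auto
      from this[of "{..<Suc n}" "\<lambda>i. coord (u n (Suc i)) \<omega> - coord (u n i) \<omega>"] show ?thesis
        by (simp add: Y_def Z_def sum_sq_def u_def power2_eq_square power4_eq_xxxx mult.assoc del: sum.lessThan_Suc)
    qed
    also have "\<dots> \<le> 2 * (Z s t n \<omega> - ?R \<omega>)\<^sup>2 + 2 * (?R \<omega>)\<^sup>2"
      using zero_le_power2[of "Z s t n \<omega> - 2 * ?R \<omega>"] by (simp add: power2_eq_square algebra_simps)
    finally show ?thesis by (auto simp: min_def)
  qed
  have Ylim: "(\<lambda>n. \<integral>\<omega>. Y (r n) \<omega> \<partial>P) \<longlonglongrightarrow> 0"
  proof (rule tendsto_sandwich[OF _ _ tendsto_const])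
    show "\<forall>\<^sub>F n in sequentially. 0 \<le> (\<integral>\<omega>. Y (r n) \<omega> \<partial>P)" using Y0 by (intro always_eventually) auto
    have im: "integrable P (\<lambda>\<omega>. min (Y n \<omega>) (2 * (?R \<omega>)\<^sup>2))" for n
      using iY L2(1) by (intro integrable_min) auto
    have "(\<integral>\<omega>. Y n \<omega> \<partial>P) \<le> (\<integral>\<omega>. 2 * (Z s t n \<omega> - ?R \<omega>)\<^sup>2 + min (Y n \<omega>) (2 * (?R \<omega>)\<^sup>2) \<partial>P)" for n
      using iY L2(2) im Y_le by (intro integral_mono) auto
    also have "\<And>n. (\<integral>\<omega>. 2 * (Z s t n \<omega> - ?R \<omega>)\<^sup>2 + min (Y n \<omega>) (2 * (?R \<omega>)\<^sup>2) \<partial>P)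
        = 2 * (\<integral>\<omega>. (Z s t n \<omega> - ?R \<omega>)\<^sup>2 \<partial>P) + (\<integral>\<omega>. min (Y n \<omega>) (2 * (?R \<omega>)\<^sup>2) \<partial>P)"
      using L2(2) im by simp
    finally show "\<forall>\<^sub>F n in sequentially. (\<integral>\<omega>. Y (r n) \<omega> \<partial>P) \<le>
        2 * (\<integral>\<omega>. (Z s t (r n) \<omega> - ?R \<omega>)\<^sup>2 \<partial>P) + (\<integral>\<omega>. min (Y (r n) \<omega>) (2 * (?R \<omega>)\<^sup>2) \<partial>P)"
      by (intro always_eventually allI)
    have "(\<lambda>n. \<integral>\<omega>. (Z s t (r n) \<omega> - ?R \<omega>)\<^sup>2 \<partial>P) \<longlonglongrightarrow> 0"
      using LIMSEQ_subseq_LIMSEQ[OF L2(3) r] by (simp add: comp_def)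
    from tendsto_add[OF tendsto_mult_left[OF this, of 2] min0]
    show "(\<lambda>n. 2 * (\<integral>\<omega>. (Z s t (r n) \<omega> - ?R \<omega>)\<^sup>2 \<partial>P) + (\<integral>\<omega>. min (Y (r n) \<omega>) (2 * (?R \<omega>)\<^sup>2) \<partial>P)) \<longlonglongrightarrow> 0"
      by simp
  qed
  define T where "T \<omega> = k * ?R \<omega> - gam k * (t - s)" for \<omega>
  define S where "S n \<omega> = k * Z s t n \<omega> - gam k * (t - s)" for n \<omega>
  have [measurable]: "T \<in> borel_measurable P" "S n \<in> borel_measurable P" for n
    unfolding T_def S_def by measurable
  have lip: "1-lipschitz_on UNIV (\<lambda>x::real. max 0 x)"
    by (auto intro!: lipschitz_onI simp: dist_real_def)
  have iS: "integrable P (\<lambda>\<omega>. (max 0 (S n \<omega>))\<^sup>2)" for n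
    unfolding S_def using st
    by (intro fin_integrable[OF _ P] fin_past[of t] past_power past_lipschitz[OF _ lip] past_diff past_cmult past_Z past_const) auto
  \<comment> \<open>The positive part is 1-Lipschitz, so replacing the limit by \<open>Z\<close>
    costs a multiple of the squared error.\<close>
  have T_le: "(max 0 (T \<omega>))\<^sup>2 \<le> 2 * (max 0 (S n \<omega>))\<^sup>2 + 2 * k\<^sup>2 * (Z s t n \<omega> - ?R \<omega>)\<^sup>2" for n \<omega>
  proof -
    have "\<bar>max 0 (T \<omega>) - max 0 (S n \<omega>)\<bar> \<le> \<bar>T \<omega> - S n \<omega>\<bar>" by auto
    then have "(max 0 (T \<omega>) - max 0 (S n \<omega>))\<^sup>2 \<le> (T \<omega> - S n \<omega>)\<^sup>2" by (simp add: abs_le_square_iff)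
    moreover have "a\<^sup>2 \<le> 2 * b\<^sup>2 + 2 * (a - b)\<^sup>2" for a b :: real
      using zero_le_power2[of "2 * b - a"] by (simp add: power2_eq_square algebra_simps)
    note this[of "max 0 (T \<omega>)" "max 0 (S n \<omega>)"]
    moreover have "(T \<omega> - S n \<omega>)\<^sup>2 = k\<^sup>2 * (Z s t n \<omega> - ?R \<omega>)\<^sup>2"
      by (simp add: T_def S_def power_mult_distrib[symmetric]) (simp add: power2_eq_square algebra_simps)
    ultimately show ?thesis by linarith
  qed
  have iT: "integrable P (\<lambda>\<omega>. (max 0 (T \<omega>))\<^sup>2)"
    by (rule Bochner_Integration.integrable_bound[of P "\<lambda>\<omega>. 2 * (max 0 (S 0 \<omega>))\<^sup>2 + 2 * k\<^sup>2 * (Z s t 0 \<omega> - ?R \<omega>)\<^sup>2"])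
      (use iS L2(2) T_le[of _ 0] in auto)
  \<comment> \<open>\<open>Suc n\<close> compensators of size
    \<open>gam k * (t - s) / Suc n\<close>, squared and doubled, add up to
    \<open>c / Suc n\<close>.\<close>
  define c where "c = 2 * (gam k)\<^sup>2 * (t - s)\<^sup>2"
  have S_le: "(\<integral>\<omega>. (max 0 (S n \<omega>))\<^sup>2 \<partial>P) \<le> 2 * k\<^sup>2 * (\<integral>\<omega>. Y n \<omega> \<partial>P) + c * inverse (real (Suc n))" for n
  proof -
    have "(\<integral>\<omega>. (max 0 (S n \<omega>))\<^sup>2 \<partial>P) \<le> (\<Sum>i<Suc n. \<integral>\<omega>. (k * (coord (u n (Suc i)) \<omega> - coord (u n i) \<omega>)\<^sup>2
        - gam k * (u n (Suc i) - u n i))\<^sup>2 \<partial>P)"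
      using sum_sq_pos_part[OF _ u(3) P, of n k "Suc n"] u(1)[of n 0] by (simp add: S_def Z_def u_def)
    also have "\<dots> \<le> (\<Sum>i<Suc n. \<integral>\<omega>. 2 * k\<^sup>2 * (coord (u n (Suc i)) \<omega> - coord (u n i) \<omega>) ^ 4
        + 2 * (gam k)\<^sup>2 * ((t - s) / real (Suc n))\<^sup>2 \<partial>P)"
    proof (rule sum_mono, rule integral_mono)
      fix i
      show "integrable P (\<lambda>\<omega>. 2 * k\<^sup>2 * (coord (u n (Suc i)) \<omega> - coord (u n i) \<omega>) ^ 4
        + 2 * (gam k)\<^sup>2 * ((t - s) / real (Suc n))\<^sup>2)"
        using i4 fin_integrable[OF fin_const P] by simp
      show "integrable P (\<lambda>\<omega>. (k * (coord (u n (Suc i)) \<omega> - coord (u n i) \<omega>)\<^sup>2 - gam k * (u n (Suc i) - u n i))\<^sup>2)"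
        using u by (intro fin_integrable[OF _ P] fin_past[of "u n (Suc i)"] past_power past_diff past_cmult past_coord past_const) auto
      fix \<omega>
      have "(k * x\<^sup>2 - g * h)\<^sup>2 \<le> 2 * k\<^sup>2 * x ^ 4 + 2 * g\<^sup>2 * h\<^sup>2" for x g h :: real
        using zero_le_power2[of "k * x\<^sup>2 + g * h"] by (simp add: power2_eq_square power4_eq_xxxx algebra_simps)
      then show "(k * (coord (u n (Suc i)) \<omega> - coord (u n i) \<omega>)\<^sup>2 - gam k * (u n (Suc i) - u n i))\<^sup>2
          \<le> 2 * k\<^sup>2 * (coord (u n (Suc i)) \<omega> - coord (u n i) \<omega>) ^ 4 + 2 * (gam k)\<^sup>2 * ((t - s) / real (Suc n))\<^sup>2"
        by (simp only: u_def unif_step[OF zero_less_Suc])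
    qed
    also have "\<dots> = 2 * k\<^sup>2 * (\<integral>\<omega>. Y n \<omega> \<partial>P) + real (Suc n) * (2 * (gam k)\<^sup>2 * ((t - s) / real (Suc n))\<^sup>2)"
    proof -
      have "(\<integral>\<omega>. 2 * k\<^sup>2 * (coord (u n (Suc i)) \<omega> - coord (u n i) \<omega>) ^ 4 + 2 * (gam k)\<^sup>2 * ((t - s) / real (Suc n))\<^sup>2 \<partial>P)
        = 2 * k\<^sup>2 * (\<integral>\<omega>. (coord (u n (Suc i)) \<omega> - coord (u n i) \<omega>) ^ 4 \<partial>P) + 2 * (gam k)\<^sup>2 * ((t - s) / real (Suc n))\<^sup>2" for i
        using i4 fin_integrable[OF fin_const P] prob_space.prob_space[OF P_prob[OF P]]
        by (subst Bochner_Integration.integral_add) (auto simp del: of_nat_Suc)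
      moreover have "(\<integral>\<omega>. Y n \<omega> \<partial>P) = (\<Sum>i<Suc n. \<integral>\<omega>. (coord (u n (Suc i)) \<omega> - coord (u n i) \<omega>) ^ 4 \<partial>P)"
        unfolding Y_def using i4 by (intro Bochner_Integration.integral_sum) auto
      ultimately show ?thesis
        by (simp add: sum.distrib sum_distrib_left[symmetric] mult_ac del: sum.lessThan_Suc of_nat_Suc)
    qed
    also have "real (Suc n) * (2 * (gam k)\<^sup>2 * ((t - s) / real (Suc n))\<^sup>2) = c * inverse (real (Suc n))"
      by (simp add: c_def power2_eq_square field_simps del: of_nat_Suc)
    finally show ?thesis .
  qed
  have le: "(\<integral>\<omega>. (max 0 (T \<omega>))\<^sup>2 \<partial>P) \<le> 2 * (2 * k\<^sup>2 * (\<integral>\<omega>. Y n \<omega> \<partial>P) + c * inverse (real (Suc n)))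
      + 2 * k\<^sup>2 * (\<integral>\<omega>. (Z s t n \<omega> - ?R \<omega>)\<^sup>2 \<partial>P)" for n
  proof -
    have "(\<integral>\<omega>. (max 0 (T \<omega>))\<^sup>2 \<partial>P) \<le> (\<integral>\<omega>. 2 * (max 0 (S n \<omega>))\<^sup>2 + 2 * k\<^sup>2 * (Z s t n \<omega> - ?R \<omega>)\<^sup>2 \<partial>P)"
      using iT iS L2(2) T_le by (intro integral_mono) auto
    also have "\<dots> = 2 * (\<integral>\<omega>. (max 0 (S n \<omega>))\<^sup>2 \<partial>P) + 2 * k\<^sup>2 * (\<integral>\<omega>. (Z s t n \<omega> - ?R \<omega>)\<^sup>2 \<partial>P)"
      using iS L2(2) by simp
    also have "\<dots> \<le> 2 * (2 * k\<^sup>2 * (\<integral>\<omega>. Y n \<omega> \<partial>P) + c * inverse (real (Suc n)))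
        + 2 * k\<^sup>2 * (\<integral>\<omega>. (Z s t n \<omega> - ?R \<omega>)\<^sup>2 \<partial>P)"
      by (intro add_right_mono mult_left_mono S_le) simp
    finally show ?thesis .
  qed
  have "(\<lambda>n. 2 * (2 * k\<^sup>2 * (\<integral>\<omega>. Y (r n) \<omega> \<partial>P) + c * inverse (real (Suc (r n))))
      + 2 * k\<^sup>2 * (\<integral>\<omega>. (Z s t (r n) \<omega> - ?R \<omega>)\<^sup>2 \<partial>P)) \<longlonglongrightarrow> 2 * (2 * k\<^sup>2 * 0 + c * 0) + 2 * k\<^sup>2 * 0"
    using LIMSEQ_subseq_LIMSEQ[OF L2(3) r] LIMSEQ_subseq_LIMSEQ[OF LIMSEQ_inverse_real_of_nat r] Ylim
    by (intro tendsto_add tendsto_mult_left) (simp_all add: comp_def)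
  then have "(\<integral>\<omega>. (max 0 (T \<omega>))\<^sup>2 \<partial>P) \<le> 2 * (2 * k\<^sup>2 * 0 + c * 0) + 2 * k\<^sup>2 * 0"
    by (rule LIMSEQ_le_const) (use le in auto)
  then have "(\<integral>\<omega>. (max 0 (T \<omega>))\<^sup>2 \<partial>P) = 0" by (intro antisym) auto
  then have "AE \<omega> in P. (max 0 (T \<omega>))\<^sup>2 = 0"
    using integral_nonneg_eq_0_iff_AE[OF iT] by simp
  then show ?thesis by eventually_elim (auto simp: T_def max_def split: if_splits)
qed

lemma increment_bounds_AE:
  assumes "0 \<le> s" "s \<le> t" "P \<in> \<P>"
  shows "AE \<omega> in P. \<sigma>l\<^sup>2 * (t - s) \<le> Q t \<omega> - Q s \<omega> \<and> Q t \<omega> - Q s \<omega> \<le> \<sigma>u\<^sup>2 * (t - s)"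
  using increment_bound_AE[OF assms, of 1] increment_bound_AE[OF assms, of "-1"]
  by eventually_elim auto

end

section \<open>Independence of the increments\<close>

text \<open>The retraction of the line onto \<open>[0, K]\<close> for nonnegative \<open>K\<close>.
  With \<open>K = \<sigma>u\<^sup>2 * t\<close> it fixes almost surely each value of
  \<open>Q\<close> up to time \<open>t\<close>, so putting it in front of a test function changes
  nothing there.\<close>

definition clamp0 :: "real \<Rightarrow> real \<Rightarrow> real" where
  "clamp0 K x = max 0 (min K x)"

lemma clamp0_bounds [simp]: "0 \<le> K \<Longrightarrow> 0 \<le> clamp0 K x" "0 \<le> K \<Longrightarrow> clamp0 K x \<le> K" "0 \<le> K \<Longrightarrow> \<bar>clamp0 K x\<bar> \<le> K"
  by (auto simp: clamp0_def)

lemma clamp0_id: "0 \<le> x \<Longrightarrow> x \<le> K \<Longrightarrow> clamp0 K x = x"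
  by (simp add: clamp0_def)

lemma clamp0_measurable [measurable]: "clamp0 K \<in> borel_measurable borel"
  unfolding clamp0_def[abs_def] by measurable

lemma l1_clamp0: "0 \<le> K \<Longrightarrow> l1 (map (clamp0 K) x) \<le> real (length x) * K"
  by (induction x) (auto simp: algebra_simps intro: add_mono)

lemma l1_vdiff_clamp0:
  "length x = length y \<Longrightarrow> l1 (vdiff (map (clamp0 K) x) (map (clamp0 K) y)) \<le> l1 (vdiff x y)"
  by (induction x y rule: list_induct2) (auto simp: clamp0_def)

text \<open>On a cube the weights are bounded, so the polynomial factor becomes a constant; the
  retraction does not increase distances.\<close>

lemma C_lLip_clamp0:
  assumes phi: "\<phi> \<in> C_lLip m" and K: "0 \<le> K"
  shows "\<exists>L M. 0 \<le> L \<and> (\<forall>x y. length x = m \<longrightarrow> length y = m \<longrightarrow>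
      \<bar>\<phi> (map (clamp0 K) x) - \<phi> (map (clamp0 K) y)\<bar> \<le> L * l1 (vdiff x y)) \<and>
    (\<forall>x. length x = m \<longrightarrow> \<bar>\<phi> (map (clamp0 K) x)\<bar> \<le> M)"
proof -
  from C_lLip_weight_bound[OF phi] obtain C k where C: "0 \<le> C" "\<And>x y. length x = m \<Longrightarrow> length y = m \<Longrightarrow>
      \<bar>\<phi> x - \<phi> y\<bar> \<le> C * weight x y ^ k * l1 (vdiff x y)" by blast
  from C_lLip_growth[OF phi] obtain D j where D: "0 \<le> D" "\<And>x. length x = m \<Longrightarrow> \<bar>\<phi> x\<bar> \<le> D * (1 + l1 x) ^ j"
    by blast
  let ?c = "map (clamp0 K)"
  let ?L = "C * (1 + 2 * (real m * K)) ^ k"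
  have "\<bar>\<phi> (?c x) - \<phi> (?c y)\<bar> \<le> ?L * l1 (vdiff x y)" if "length x = m" "length y = m" for x y
  proof -
    have "weight (?c x) (?c y) \<le> 1 + 2 * (real m * K)"
      using l1_clamp0[OF K, of x] l1_clamp0[OF K, of y] that by (simp add: weight_def)
    then have "weight (?c x) (?c y) ^ k \<le> (1 + 2 * (real m * K)) ^ k" by (intro power_mono) auto
    then have "C * weight (?c x) (?c y) ^ k * l1 (vdiff (?c x) (?c y)) \<le> ?L * l1 (vdiff x y)"
      using that C(1) K by (intro mult_mono l1_vdiff_clamp0 mult_left_mono) auto
    then show ?thesis using C(2)[of "?c x" "?c y"] that by simp
  qed
  moreover have "\<bar>\<phi> (?c x)\<bar> \<le> D * (1 + real m * K) ^ j" if "length x = m" for x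
  proof -
    have "(1 + l1 (?c x)) ^ j \<le> (1 + real m * K) ^ j"
      using l1_clamp0[OF K, of x] that by (intro power_mono) auto
    with D(1) have "D * (1 + l1 (?c x)) ^ j \<le> D * (1 + real m * K) ^ j" by (intro mult_left_mono)
    then show ?thesis using D(2)[of "?c x"] that by simp
  qed
  moreover have "0 \<le> ?L" using C(1) K by simp
  ultimately show ?thesis by blast
qed

context gbm
begin

lemma fin_bounded:
  assumes "X \<in> borel_measurable borel" "\<And>P. P \<in> \<P> \<Longrightarrow> AE \<omega> in P. \<bar>X \<omega>\<bar> \<le> M"
  shows "fin X"
proof (rule fin_dominated[OF fin_const[of M] assms(1)])
  fix P assume "P \<in> \<P>"
  from assms(2)[OF this] show "AE \<omega> in P. \<bar>X \<omega>\<bar> \<le> \<bar>M\<bar>" by eventually_elim auto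
qed

lemma abs_E_le:
  assumes "fin X" "\<And>P. P \<in> \<P> \<Longrightarrow> AE \<omega> in P. \<bar>X \<omega>\<bar> \<le> M"
  shows "\<bar>E X\<bar> \<le> M"
proof -
  have "(\<integral>\<omega>. \<bar>X \<omega> - 0\<bar> \<partial>P) \<le> M" if P: "P \<in> \<P>" for P
  proof -
    have "(\<integral>\<omega>. \<bar>X \<omega> - 0\<bar> \<partial>P) \<le> (\<integral>\<omega>. M \<partial>P)"
      using fin_integrable[OF assms(1) P] fin_integrable[OF fin_const P] assms(2)[OF P]
      by (intro integral_mono_AE) auto
    then show ?thesis by (simp add: prob_space.prob_space[OF P_prob[OF P]])
  qed
  from E_diff_bound[OF assms(1) fin_const this] show ?thesis by simp
qed

text \<open>Convergence in mean is asked uniformly over \<open>\<P>\<close>, so that it survives the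
  supremum; convergence under each measure separately would not do in general.\<close>

definition L1_lim :: "(nat \<Rightarrow> path \<Rightarrow> real) \<Rightarrow> (path \<Rightarrow> real) \<Rightarrow> bool" where
  "L1_lim X Y \<longleftrightarrow> (\<forall>n. fin (X n)) \<and> fin Y \<and>
     (\<forall>e>0. \<forall>\<^sub>F n in sequentially. \<forall>P\<in>\<P>. (\<integral>\<omega>. \<bar>X n \<omega> - Y \<omega>\<bar> \<partial>P) \<le> e)"

lemma L1_limD: "L1_lim X Y \<Longrightarrow> fin (X n)" "L1_lim X Y \<Longrightarrow> fin Y"
  "L1_lim X Y \<Longrightarrow> 0 < e \<Longrightarrow> \<forall>\<^sub>F n in sequentially. \<forall>P\<in>\<P>. (\<integral>\<omega>. \<bar>X n \<omega> - Y \<omega>\<bar> \<partial>P) \<le> e"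
  by (auto simp: L1_lim_def)

lemma L1_lim_E:
  assumes "L1_lim X Y" shows "(\<lambda>n. E (X n)) \<longlonglongrightarrow> E Y"
proof (rule LIMSEQ_I)
  fix e :: real assume e: "0 < e"
  from L1_limD(3)[OF assms, of "e / 2"] e obtain N where
    N: "\<And>n P. n \<ge> N \<Longrightarrow> P \<in> \<P> \<Longrightarrow> (\<integral>\<omega>. \<bar>X n \<omega> - Y \<omega>\<bar> \<partial>P) \<le> e / 2"
    by (auto simp: eventually_sequentially)
  show "\<exists>no. \<forall>n\<ge>no. norm (E (X n) - E Y) < e"
  proof (intro exI[of _ N] allI impI)
    fix n assume "N \<le> n"
    with E_diff_bound[OF L1_limD(1,2)[OF assms], of n "e / 2"] N e show "norm (E (X n) - E Y) < e" by force
  qed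
qed

lemma L1_lim_vector:
  assumes "list_all2 L1_lim Xs Ys" "0 < e"
  shows "\<forall>\<^sub>F n in sequentially. \<forall>P\<in>\<P>.
    integrable P (\<lambda>\<omega>. l1 (vdiff (map (\<lambda>X. X n \<omega>) Xs) (map (\<lambda>Y. Y \<omega>) Ys))) \<and>
    (\<integral>\<omega>. l1 (vdiff (map (\<lambda>X. X n \<omega>) Xs) (map (\<lambda>Y. Y \<omega>) Ys)) \<partial>P) \<le> e"
  using assms
proof (induction Xs Ys arbitrary: e rule: list_all2_induct)
  case Nil
  then show ?case by simp
next
  case (Cons X Xs Y Ys)
  from Cons.prems have "0 < e / 2" by simp
  from L1_limD(3)[OF Cons.hyps(1) this] Cons.IH[OF this] show ?case
  proof eventually_elim
    case (elim n)
    show ?case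
    proof
      fix P assume P: "P \<in> \<P>"
      have "integrable P (\<lambda>\<omega>. \<bar>X n \<omega> - Y \<omega>\<bar>)"
        using fin_integrable[OF L1_limD(1)[OF Cons.hyps(1)] P] fin_integrable[OF L1_limD(2)[OF Cons.hyps(1)] P]
        by auto
      moreover from elim P have
        "integrable P (\<lambda>\<omega>. l1 (vdiff (map (\<lambda>X. X n \<omega>) Xs) (map (\<lambda>Y. Y \<omega>) Ys)))"
        "(\<integral>\<omega>. l1 (vdiff (map (\<lambda>X. X n \<omega>) Xs) (map (\<lambda>Y. Y \<omega>) Ys)) \<partial>P) \<le> e / 2"
        "(\<integral>\<omega>. \<bar>X n \<omega> - Y \<omega>\<bar> \<partial>P) \<le> e / 2" by auto
      ultimately show "integrable P (\<lambda>\<omega>. l1 (vdiff (map (\<lambda>X. X n \<omega>) (X # Xs)) (map (\<lambda>Y. Y \<omega>) (Y # Ys)))) \<and>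
        (\<integral>\<omega>. l1 (vdiff (map (\<lambda>X. X n \<omega>) (X # Xs)) (map (\<lambda>Y. Y \<omega>) (Y # Ys))) \<partial>P) \<le> e"
        by simp
    qed
  qed
qed

lemma L1_lim_cmult: "L1_lim X Y \<Longrightarrow> L1_lim (\<lambda>n \<omega>. k * X n \<omega>) (\<lambda>\<omega>. k * Y \<omega>)"
proof -
  assume L: "L1_lim X Y"
  have "\<forall>\<^sub>F n in sequentially. \<forall>P\<in>\<P>. (\<integral>\<omega>. \<bar>k * X n \<omega> - k * Y \<omega>\<bar> \<partial>P) \<le> e" if "0 < e" for e
  proof -
    have "0 < e / (\<bar>k\<bar> + 1)" using that by simp
    from L1_limD(3)[OF L this] show ?thesis
    proof eventually_elim
      case (elim n)
      show ?case
      proof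
        fix P assume "P \<in> \<P>"
        with elim have "\<bar>k\<bar> * (\<integral>\<omega>. \<bar>X n \<omega> - Y \<omega>\<bar> \<partial>P) \<le> (\<bar>k\<bar> + 1) * (e / (\<bar>k\<bar> + 1))"
          by (intro mult_mono) auto
        then show "(\<integral>\<omega>. \<bar>k * X n \<omega> - k * Y \<omega>\<bar> \<partial>P) \<le> e"
          by (simp add: abs_mult flip: right_diff_distrib)
      qed
    qed
  qed
  then show ?thesis using L1_limD(1,2)[OF L] by (auto simp: L1_lim_def intro: fin_cmult)
qed

lemma gam_eq: "gam k = (if 0 \<le> k then k * \<sigma>u\<^sup>2 else k * \<sigma>l\<^sup>2)"
proof -
  have b: "\<sigma>l\<^sup>2 \<le> x\<^sup>2" "x\<^sup>2 \<le> \<sigma>u\<^sup>2" if "x \<in> {\<sigma>l..\<sigma>u}" for x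
    using that sig by (auto intro!: power_mono)
  show ?thesis
  proof (cases "0 \<le> k")
    case True
    have "(SUP \<sigma>\<in>{\<sigma>l..\<sigma>u}. \<sigma>\<^sup>2 * (2 * k)) = \<sigma>u\<^sup>2 * (2 * k)"
    proof (rule cSup_eq_maximum)
      show "\<sigma>u\<^sup>2 * (2 * k) \<in> (\<lambda>\<sigma>. \<sigma>\<^sup>2 * (2 * k)) ` {\<sigma>l..\<sigma>u}" using sig by (intro imageI) auto
      fix y assume "y \<in> (\<lambda>\<sigma>. \<sigma>\<^sup>2 * (2 * k)) ` {\<sigma>l..\<sigma>u}"
      then obtain x where "x \<in> {\<sigma>l..\<sigma>u}" "y = x\<^sup>2 * (2 * k)" by blast
      then show "y \<le> \<sigma>u\<^sup>2 * (2 * k)" using mult_right_mono[OF b(2), of x "2 * k"] True by simp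
    qed
    then show ?thesis using True by (simp add: gam_def G_fun_def)
  next
    case False
    have "(SUP \<sigma>\<in>{\<sigma>l..\<sigma>u}. \<sigma>\<^sup>2 * (2 * k)) = \<sigma>l\<^sup>2 * (2 * k)"
    proof (rule cSup_eq_maximum)
      show "\<sigma>l\<^sup>2 * (2 * k) \<in> (\<lambda>\<sigma>. \<sigma>\<^sup>2 * (2 * k)) ` {\<sigma>l..\<sigma>u}" using sig by (intro imageI) auto
      fix y assume "y \<in> (\<lambda>\<sigma>. \<sigma>\<^sup>2 * (2 * k)) ` {\<sigma>l..\<sigma>u}"
      then obtain x where "x \<in> {\<sigma>l..\<sigma>u}" "y = x\<^sup>2 * (2 * k)" by blast
      then show "y \<le> \<sigma>l\<^sup>2 * (2 * k)" using mult_right_mono_neg[OF b(1), of x "2 * k"] False by simp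
    qed
    then show ?thesis using False by (simp add: gam_def G_fun_def)
  qed
qed

lemma gam_ge: "\<sigma>l\<^sup>2 \<le> c \<Longrightarrow> c \<le> \<sigma>u\<^sup>2 \<Longrightarrow> k * c \<le> gam k"
  by (auto simp: gam_eq intro: mult_left_mono mult_left_mono_neg)

end

section \<open>Passage from sums of squares to \<open>Q\<close>\<close>

context gbm_qv
begin

text \<open>\<open>is_quadratic_variation\<close> speaks of \<open>Q 0\<close> through partitions of
  \<open>[0, 0]\<close>; the one-point partition has an empty sum of squares.\<close>

lemma Q_0_AE: assumes P: "P \<in> \<P>" shows "AE \<omega> in P. Q 0 \<omega> = 0"
proof -
  have "(\<lambda>n. upper_moment \<P> 2 (\<lambda>\<omega>. sum_sq (\<lambda>_. 0) 0 \<omega> - Q 0 \<omega>)) \<longlonglongrightarrow> 0"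
    using sum_sq_tendsto[of 0 "\<lambda>_ _. 0" "\<lambda>_. 0" 0] by (auto simp: mono_def)
  then have "upper_moment \<P> 2 (\<lambda>\<omega>. sum_sq (\<lambda>_. 0) 0 \<omega> - Q 0 \<omega>) = 0"
    using LIMSEQ_unique tendsto_const by blast
  then have "(\<integral>\<^sup>+\<omega>. ennreal (\<bar>0 - Q 0 \<omega>\<bar>\<^sup>2) \<partial>P) = 0"
    using upper_moment_ge[OF P, of "\<lambda>\<omega>. 0 - Q 0 \<omega>" 2] by (simp add: sum_sq_def)
  moreover have "Q 0 \<in> borel_measurable P" using Q_measurable[of 0] by (simp add: P_measurable[OF P])
  ultimately have "AE \<omega> in P. ennreal (\<bar>0 - Q 0 \<omega>\<bar>\<^sup>2) = 0"
    by (subst (asm) nn_integral_0_iff_AE) auto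
  then show ?thesis by eventually_elim (simp add: ennreal_eq_0_iff)
qed

lemma Q_bounds_AE:
  assumes t: "0 \<le> t" and P: "P \<in> \<P>" shows "AE \<omega> in P. 0 \<le> Q t \<omega> \<and> Q t \<omega> \<le> \<sigma>u\<^sup>2 * t"
  using Q_0_AE[OF P] increment_bounds_AE[OF order_refl t P]
proof eventually_elim
  case (elim \<omega>)
  moreover have "0 \<le> \<sigma>l\<^sup>2 * t" using t by simp
  ultimately show ?case by simp
qed

lemma increment_nonneg_AE:
  assumes "0 \<le> s" "s \<le> t" and P: "P \<in> \<P>"
  shows "AE \<omega> in P. 0 \<le> Q t \<omega> - Q s \<omega> \<and> Q t \<omega> - Q s \<omega> \<le> \<sigma>u\<^sup>2 * (t - s)"
  using increment_bounds_AE[OF assms]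
proof eventually_elim
  case (elim \<omega>)
  moreover have "0 \<le> \<sigma>l\<^sup>2 * (t - s)" using assms by simp
  ultimately show ?case by linarith
qed

lemma increment_measurable:
  "0 \<le> s \<Longrightarrow> s \<le> t \<Longrightarrow> (\<lambda>\<omega>. Q t \<omega> - Q s \<omega>) \<in> borel_measurable borel"
  using Q_measurable[of s] Q_measurable[of t] by auto

lemma fin_increment: "0 \<le> s \<Longrightarrow> s \<le> t \<Longrightarrow> fin (\<lambda>\<omega>. Q t \<omega> - Q s \<omega>)"
proof (rule fin_bounded[of _ "\<sigma>u\<^sup>2 * (t - s)"])
  assume st: "0 \<le> s" "s \<le> t"
  then show "(\<lambda>\<omega>. Q t \<omega> - Q s \<omega>) \<in> borel_measurable borel" by (rule increment_measurable)
  fix P assume "P \<in> \<P>"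
  from increment_nonneg_AE[OF st this] show "AE \<omega> in P. \<bar>Q t \<omega> - Q s \<omega>\<bar> \<le> \<sigma>u\<^sup>2 * (t - s)"
    by eventually_elim auto
qed

lemma Z_L1_lim:
  assumes st: "0 \<le> s" "s \<le> t"
  shows "L1_lim (Z s t) (\<lambda>\<omega>. Q t \<omega> - Q s \<omega>)"
  unfolding L1_lim_def
proof (intro conjI allI impI)
  show "fin (Z s t n)" for n using st by (intro fin_past[of t] past_Z) auto
  show "fin (\<lambda>\<omega>. Q t \<omega> - Q s \<omega>)" using st by (rule fin_increment)
  fix e :: real assume e: "0 < e"
  let ?D = "\<lambda>n \<omega>. Z s t n \<omega> - (Q t \<omega> - Q s \<omega>)"
  have "\<forall>\<^sub>F n in sequentially. upper_moment \<P> 2 (?D n) < ennreal (e\<^sup>2)"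
    using e by (intro order_tendstoD(2)[OF Z_tendsto[OF st]]) auto
  then show "\<forall>\<^sub>F n in sequentially. \<forall>P\<in>\<P>. (\<integral>\<omega>. \<bar>?D n \<omega>\<bar> \<partial>P) \<le> e"
  proof eventually_elim
    case (elim n)
    show ?case
    proof
      fix P assume P: "P \<in> \<P>"
      note i2 = increment_L2(2)[OF st P, of n]
      have "(\<integral>\<^sup>+\<omega>. ennreal ((?D n \<omega>)\<^sup>2) \<partial>P) = ennreal (\<integral>\<omega>. (?D n \<omega>)\<^sup>2 \<partial>P)"
        by (rule nn_integral_eq_integral[OF i2]) auto
      with upper_moment_ge[OF P, of "?D n" 2] elim
      have "ennreal (\<integral>\<omega>. (?D n \<omega>)\<^sup>2 \<partial>P) < ennreal (e\<^sup>2)" by simp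
      then have m: "(\<integral>\<omega>. (?D n \<omega>)\<^sup>2 \<partial>P) < e\<^sup>2" by (subst (asm) ennreal_less_iff) auto
      \<comment> \<open>Weighted so that a second moment below \<open>e\<^sup>2\<close> gives a
        first moment of at most \<open>e\<close>.\<close>
      have "\<bar>x\<bar> \<le> (e + x\<^sup>2 / e) / 2" for x
      proof -
        have "2 * e * \<bar>x\<bar> \<le> e\<^sup>2 + x\<^sup>2"
          using zero_le_power2[of "e - \<bar>x\<bar>"] by (simp add: power2_diff)
        then have "2 * e * \<bar>x\<bar> / (2 * e) \<le> (e\<^sup>2 + x\<^sup>2) / (2 * e)" using e by (intro divide_right_mono) auto
        then show ?thesis using e by (simp add: add_divide_distrib power2_eq_square)
      qed
      then have "(\<integral>\<omega>. \<bar>?D n \<omega>\<bar> \<partial>P) \<le> (\<integral>\<omega>. (e + (?D n \<omega>)\<^sup>2 / e) / 2 \<partial>P)"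
        using fin_integrable[OF fin_diff P] \<open>\<And>n. fin (Z s t n)\<close> \<open>fin (\<lambda>\<omega>. Q t \<omega> - Q s \<omega>)\<close>
          i2 fin_integrable[OF fin_const P]
        by (intro integral_mono) auto
      also have "\<dots> = (e + (\<integral>\<omega>. (?D n \<omega>)\<^sup>2 \<partial>P) / e) / 2"
        using i2 fin_integrable[OF fin_const P] prob_space.prob_space[OF P_prob[OF P]] by simp
      also have "\<dots> \<le> e" using m e by (simp add: field_simps power2_eq_square)
      finally show "(\<integral>\<omega>. \<bar>?D n \<omega>\<bar> \<partial>P) \<le> e" .
    qed
  qed
qed

lemma Z_L1_lim_Q: assumes t: "0 \<le> t" shows "L1_lim (Z 0 t) (Q t)"
proof -
  note L = Z_L1_lim[OF order_refl t]
  have fQ: "fin (Q t)"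
  proof (rule fin_bounded[OF Q_measurable[OF t], of "\<sigma>u\<^sup>2 * t"])
    fix P assume "P \<in> \<P>"
    from Q_bounds_AE[OF t this] show "AE \<omega> in P. \<bar>Q t \<omega>\<bar> \<le> \<sigma>u\<^sup>2 * t" by eventually_elim auto
  qed
  have eq: "(\<integral>\<omega>. \<bar>Z 0 t n \<omega> - Q t \<omega>\<bar> \<partial>P) = (\<integral>\<omega>. \<bar>Z 0 t n \<omega> - (Q t \<omega> - Q 0 \<omega>)\<bar> \<partial>P)" if P: "P \<in> \<P>" for P n
    using fin_measurable[OF L1_limD(1)[OF L]] Q_measurable[OF t] Q_measurable[of 0] Q_0_AE[OF P]
    by (intro integral_cong_AE) (auto simp: P_measurable[OF P] elim!: eventually_mono)
  show ?thesis
    using L fQ unfolding L1_lim_def by (simp add: eq)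
qed

text \<open>The approximating upper means already equal the limit, because \<open>E_sum_sq\<close>
  is exact for every partition.\<close>

lemma E_increment_linear:
  assumes st: "0 \<le> s" "s \<le> t" shows "E (\<lambda>\<omega>. k * (Q t \<omega> - Q s \<omega>)) = gam k * (t - s)"
proof -
  have "(\<lambda>n. E (\<lambda>\<omega>. k * Z s t n \<omega>)) \<longlonglongrightarrow> E (\<lambda>\<omega>. k * (Q t \<omega> - Q s \<omega>))"
    by (intro L1_lim_E L1_lim_cmult Z_L1_lim st)
  moreover have "E (\<lambda>\<omega>. k * Z s t n \<omega>) = gam k * (t - s)" for n
    using E_sum_sq[of "unif s t (Suc n)" k "Suc n"] st by (simp add: Z_def mono_unif)
  ultimately show ?thesis by (simp add: LIMSEQ_const_iff)
qed

text \<open>The identity holds for sums of squares and passes to the limit on both sides. The right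
  side is delicate, for there the inner function \<open>\<psi>n n\<close> moves along with its
  argument; since \<open>\<phi>'\<close> is Lipschitz, \<open>\<psi>n n\<close> converges uniformly
  in \<open>x\<close>. The original \<open>\<phi>\<close> returns at the end, as it agrees almost
  surely with \<open>\<phi>'\<close>.\<close>

lemma independence:
  assumes ts: "times ts" "\<And>r. r \<in> set ts \<Longrightarrow> r \<le> s" and st: "0 \<le> s" "s \<le> t"
    and phi: "\<phi> \<in> C_lLip (Suc (length ts))"
  shows "E (\<lambda>\<omega>. \<phi> (map (\<lambda>r. Q r \<omega>) ts @ [Q t \<omega> - Q s \<omega>])) =
    E (\<lambda>\<omega>. E (\<lambda>\<omega>'. \<phi> (map (\<lambda>r. Q r \<omega>) ts @ [Q t \<omega>' - Q s \<omega>'])))"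
proof -
  let ?m = "length ts"
  \<comment> \<open>A common bound for \<open>Q r\<close> with \<open>r \<le> s\<close> and for the
    increment over \<open>[s, t]\<close>.\<close>
  define K where "K = \<sigma>u\<^sup>2 * t"
  have K: "0 \<le> K" using st by (simp add: K_def)
  define \<phi>' where "\<phi>' = (\<lambda>x. \<phi> (map (clamp0 K) x))"
  obtain L M where L: "0 \<le> L" "\<And>x y. length x = Suc ?m \<Longrightarrow> length y = Suc ?m \<Longrightarrow> \<bar>\<phi>' x - \<phi>' y\<bar> \<le> L * l1 (vdiff x y)"
    "\<And>x. length x = Suc ?m \<Longrightarrow> \<bar>\<phi>' x\<bar> \<le> M"
    using C_lLip_clamp0[OF phi K] unfolding \<phi>'_def by blast
  have phi': "\<phi>' \<in> C_lLip (Suc ?m)"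
    using L by (intro C_lLipI[of _ _ L 0]) auto
  define X where "X \<omega> = map (\<lambda>r. Q r \<omega>) ts" for \<omega>
  define Y where "Y \<omega> = Q t \<omega> - Q s \<omega>" for \<omega>
  define Xn where "Xn n \<omega> = map (\<lambda>r. Z 0 r n \<omega>) ts" for n \<omega>
  define Yn where "Yn n = Z s t n" for n
  have ts0: "0 \<le> r" "r \<le> s" if "r \<in> set ts" for r using that ts by (auto simp: times_def)
  have Ym [measurable]: "Y \<in> borel_measurable borel" using increment_measurable[OF st] by (simp add: Y_def[abs_def])
  have lX [simp]: "length (X \<omega>) = ?m" "length (Xn n \<omega>) = ?m" for n \<omega> by (auto simp: X_def Xn_def)
  have AE_Y: "AE \<omega> in P. clamp0 K (Y \<omega>) = Y \<omega>" if P: "P \<in> \<P>" for P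
    using increment_nonneg_AE[OF st P]
  proof eventually_elim
    case (elim \<omega>)
    moreover have "\<sigma>u\<^sup>2 * (t - s) \<le> K" unfolding K_def using st by (intro mult_left_mono) auto
    ultimately show ?case by (intro clamp0_id) (auto simp: Y_def)
  qed
  have AE_X: "AE \<omega> in P. map (clamp0 K) (X \<omega>) = X \<omega>" if P: "P \<in> \<P>" for P
  proof -
    have "AE \<omega> in P. \<forall>r\<in>set ts. clamp0 K (Q r \<omega>) = Q r \<omega>"
    proof (rule AE_finite_allI)
      fix r assume r: "r \<in> set ts"
      show "AE \<omega> in P. clamp0 K (Q r \<omega>) = Q r \<omega>"
        using Q_bounds_AE[OF ts0(1)[OF r] P]
      proof eventually_elim
        case (elim \<omega>)
        moreover have "\<sigma>u\<^sup>2 * r \<le> K" unfolding K_def using ts0[OF r] st by (intro mult_left_mono) auto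
        ultimately show ?case by (intro clamp0_id) auto
      qed
    qed simp
    then show ?thesis by eventually_elim (simp add: X_def)
  qed
  have mX: "(\<lambda>\<omega>. f (X \<omega>)) \<in> borel_measurable borel" if "f \<in> C_lLip ?m" for f
    using C_lLip_measurable[of f "map Q ts" borel] that ts0(1)
    by (auto simp: X_def comp_def intro: Q_measurable)
  have mXY: "(\<lambda>\<omega>. f (X \<omega> @ [Y \<omega>])) \<in> borel_measurable borel" if "f \<in> C_lLip (Suc ?m)" for f
  proof -
    have "(\<lambda>\<omega>. f (map (\<lambda>h. h \<omega>) (map Q ts @ [Y]))) \<in> borel_measurable borel"
      using that ts0(1) by (intro C_lLip_measurable) (auto intro: Q_measurable Ym)
    then show ?thesis by (simp add: X_def comp_def)
  qed
  have mxY: "(\<lambda>\<omega>. f (x @ [Y \<omega>])) \<in> borel_measurable borel" if "f \<in> C_lLip (Suc ?m)" "length x = ?m" for f x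
  proof -
    have "(\<lambda>\<omega>. f (map (\<lambda>h. h \<omega>) (map (\<lambda>a _. a) x @ [Y]))) \<in> borel_measurable borel"
      using that by (intro C_lLip_measurable) (auto intro: Ym)
    then show ?thesis by (simp add: comp_def)
  qed
  have pXn: "past s (\<lambda>\<omega>. f (Xn n \<omega>))" if "f \<in> C_lLip ?m" for f n
  proof -
    have "past s (\<lambda>\<omega>. f (map (\<lambda>X. X \<omega>) (map (\<lambda>r. Z 0 r n) ts)))"
      using that ts0 by (intro past_comp) (auto intro!: past_Z)
    then show ?thesis by (simp add: Xn_def comp_def)
  qed
  have pXYn: "past t (\<lambda>\<omega>. \<phi>' (Xn n \<omega> @ [Yn n \<omega>]))" for n
  proof -
    have "past t (\<lambda>\<omega>. \<phi>' (map (\<lambda>X. X \<omega>) (map (\<lambda>r. Z 0 r n) ts @ [Yn n])))"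
      using phi' ts0 st by (intro past_comp) (auto simp: Yn_def intro!: past_Z intro: order_trans)
    then show ?thesis by (simp add: Xn_def comp_def)
  qed
  have pxYn: "past t (\<lambda>\<omega>. \<phi>' (x @ [Yn n \<omega>]))" if "length x = ?m" for x n
  proof -
    have "past t (\<lambda>\<omega>. \<phi>' (map (\<lambda>X. X \<omega>) (map (\<lambda>a _. a) x @ [Yn n])))"
      using phi' that st by (intro past_comp) (auto simp: Yn_def intro!: past_Z)
    then show ?thesis by (simp add: comp_def)
  qed
  define \<psi>n where "\<psi>n n x = E (\<lambda>\<omega>. \<phi>' (x @ [Yn n \<omega>]))" for n x
  define \<psi> where "\<psi> x = E (\<lambda>\<omega>. \<phi>' (x @ [Y \<omega>]))" for x
  have fphi: "fin (\<lambda>\<omega>. \<phi>' (X \<omega> @ [Y \<omega>]))"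
    using L(3) mXY[OF phi'] by (intro fin_bounded[of _ M]) auto
  have fphix: "fin (\<lambda>\<omega>. \<phi>' (x @ [Y \<omega>]))" if "length x = ?m" for x
    using L(3) mxY[OF phi' that] that by (intro fin_bounded[of _ M]) auto
  have psi_lip: "\<bar>\<psi> x - \<psi> y\<bar> \<le> L * l1 (vdiff x y)" if "length x = ?m" "length y = ?m" for x y
    unfolding \<psi>_def
  proof (rule E_diff_bound[OF fphix[OF that(1)] fphix[OF that(2)]])
    fix P assume P: "P \<in> \<P>"
    have "(\<integral>\<omega>. \<bar>\<phi>' (x @ [Y \<omega>]) - \<phi>' (y @ [Y \<omega>])\<bar> \<partial>P) \<le> (\<integral>\<omega>. L * l1 (vdiff x y) \<partial>P)"
    proof (rule integral_mono)
      show "integrable P (\<lambda>\<omega>. \<bar>\<phi>' (x @ [Y \<omega>]) - \<phi>' (y @ [Y \<omega>])\<bar>)"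
        using fin_integrable[OF fphix P] that by auto
      show "integrable P (\<lambda>\<omega>. L * l1 (vdiff x y))" by (rule fin_integrable[OF fin_const P])
      show "\<bar>\<phi>' (x @ [Y \<omega>]) - \<phi>' (y @ [Y \<omega>])\<bar> \<le> L * l1 (vdiff x y)" for \<omega>
        using L(2)[of "x @ [Y \<omega>]" "y @ [Y \<omega>]"] that by (simp add: vdiff_append)
    qed
    then show "(\<integral>\<omega>. \<bar>\<phi>' (x @ [Y \<omega>]) - \<phi>' (y @ [Y \<omega>])\<bar> \<partial>P) \<le> L * l1 (vdiff x y)"
      by (simp add: prob_space.prob_space[OF P_prob[OF P]])
  qed
  have psi: "\<psi> \<in> C_lLip ?m" using psi_lip by (intro C_lLipI[of _ _ L 0]) auto
  have psi_bd: "\<bar>\<psi> x\<bar> \<le> M" if "length x = ?m" for x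
    unfolding \<psi>_def using fphix[OF that] L(3) that by (intro abs_E_le) auto
  have psin: "\<psi>n n \<in> C_lLip ?m" for n
    unfolding \<psi>n_def[abs_def] Yn_def using st by (intro C_lLip_E_past[OF phi', of t] past_Z) auto
  have fpsi: "fin (\<lambda>\<omega>. \<psi> (X \<omega>))"
    using psi_bd mX[OF psi] by (intro fin_bounded[of _ M]) auto
  have XL: "list_all2 L1_lim (map (\<lambda>r n. Z 0 r n) ts) (map Q ts)"
    using ts0 by (auto simp: list_all2_conv_all_nth intro!: Z_L1_lim_Q)
  have YL: "L1_lim Yn Y"
    unfolding Yn_def[abs_def] Y_def[abs_def] using Z_L1_lim[OF st] .
  have XYL: "list_all2 L1_lim (map (\<lambda>r n. Z 0 r n) ts @ [Yn]) (map Q ts @ [Y])"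
    using XL YL by (intro list_all2_appendI) auto
  have lim1: "L1_lim (\<lambda>n \<omega>. \<phi>' (Xn n \<omega> @ [Yn n \<omega>])) (\<lambda>\<omega>. \<phi>' (X \<omega> @ [Y \<omega>]))"
    unfolding L1_lim_def
  proof (intro conjI allI impI)
    show "fin (\<lambda>\<omega>. \<phi>' (Xn n \<omega> @ [Yn n \<omega>]))" for n by (rule fin_past[OF pXYn])
    show "fin (\<lambda>\<omega>. \<phi>' (X \<omega> @ [Y \<omega>]))" by (rule fphi)
    fix e :: real assume "0 < e"
    then have "0 < e / (L + 1)" using L(1) by simp
    from L1_lim_vector[OF XYL this]
    show "\<forall>\<^sub>F n in sequentially. \<forall>P\<in>\<P>. (\<integral>\<omega>. \<bar>\<phi>' (Xn n \<omega> @ [Yn n \<omega>]) - \<phi>' (X \<omega> @ [Y \<omega>])\<bar> \<partial>P) \<le> e"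
    proof eventually_elim
      case (elim n)
      show ?case
      proof
        fix P assume P: "P \<in> \<P>"
        let ?d = "\<lambda>\<omega>. l1 (vdiff (Xn n \<omega> @ [Yn n \<omega>]) (X \<omega> @ [Y \<omega>]))"
        from elim P have d: "integrable P ?d" "(\<integral>\<omega>. ?d \<omega> \<partial>P) \<le> e / (L + 1)"
          by (auto simp: Xn_def X_def comp_def)
        have "(\<integral>\<omega>. \<bar>\<phi>' (Xn n \<omega> @ [Yn n \<omega>]) - \<phi>' (X \<omega> @ [Y \<omega>])\<bar> \<partial>P) \<le> (\<integral>\<omega>. L * ?d \<omega> \<partial>P)"
          using fin_integrable[OF fphi P] fin_integrable[OF fin_past[OF pXYn] P] d(1) L(2)
          by (intro integral_mono) auto
        also have "\<dots> = L * (\<integral>\<omega>. ?d \<omega> \<partial>P)" by simp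
        also have "\<dots> \<le> (L + 1) * (e / (L + 1))"
          using d(2) L(1) by (intro mult_mono) auto
        finally show "(\<integral>\<omega>. \<bar>\<phi>' (Xn n \<omega> @ [Yn n \<omega>]) - \<phi>' (X \<omega> @ [Y \<omega>])\<bar> \<partial>P) \<le> e"
          using L(1) by simp
      qed
    qed
  qed
  \<comment> \<open>Two errors: \<open>\<psi>n n\<close> against \<open>\<psi>\<close> at the same
    point, controlled uniformly by the distance of \<open>Yn n\<close> from \<open>Y\<close>, and
    \<open>\<psi>\<close> at \<open>Xn n\<close> against \<open>\<psi>\<close> at \<open>X\<close>,
    controlled by its Lipschitz constant. Each gets half of \<open>e\<close>.\<close>
  have lim2: "L1_lim (\<lambda>n \<omega>. \<psi>n n (Xn n \<omega>)) (\<lambda>\<omega>. \<psi> (X \<omega>))"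
    unfolding L1_lim_def
  proof (intro conjI allI impI)
    show "fin (\<lambda>\<omega>. \<psi>n n (Xn n \<omega>))" for n by (rule fin_past[OF pXn[OF psin]])
    show "fin (\<lambda>\<omega>. \<psi> (X \<omega>))" by (rule fpsi)
    fix e :: real assume "0 < e"
    then have e: "0 < e / (2 * (L + 1))" using L(1) by simp
    from L1_lim_vector[OF XL e] L1_limD(3)[OF YL e]
    show "\<forall>\<^sub>F n in sequentially. \<forall>P\<in>\<P>. (\<integral>\<omega>. \<bar>\<psi>n n (Xn n \<omega>) - \<psi> (X \<omega>)\<bar> \<partial>P) \<le> e"
    proof eventually_elim
      case (elim n)
      let ?e = "e / (2 * (L + 1))"
      have psi_n: "\<bar>\<psi>n n x - \<psi> x\<bar> \<le> L * ?e" if x: "length x = ?m" for x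
        unfolding \<psi>_def \<psi>n_def
      proof (rule E_diff_bound[OF fin_past[OF pxYn[OF x]] fphix[OF x]])
        fix P assume P: "P \<in> \<P>"
        have "(\<integral>\<omega>. \<bar>\<phi>' (x @ [Yn n \<omega>]) - \<phi>' (x @ [Y \<omega>])\<bar> \<partial>P) \<le> (\<integral>\<omega>. L * \<bar>Yn n \<omega> - Y \<omega>\<bar> \<partial>P)"
        proof (rule integral_mono)
          show "integrable P (\<lambda>\<omega>. \<bar>\<phi>' (x @ [Yn n \<omega>]) - \<phi>' (x @ [Y \<omega>])\<bar>)"
            using fin_integrable[OF fphix[OF x] P] fin_integrable[OF fin_past[OF pxYn[OF x]] P] by auto
          show "integrable P (\<lambda>\<omega>. L * \<bar>Yn n \<omega> - Y \<omega>\<bar>)"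
            using fin_integrable[OF L1_limD(1)[OF YL] P] fin_integrable[OF L1_limD(2)[OF YL] P] by auto
          have "l1 (vdiff x x) = 0" by (induction x) auto
          then show "\<bar>\<phi>' (x @ [Yn n \<omega>]) - \<phi>' (x @ [Y \<omega>])\<bar> \<le> L * \<bar>Yn n \<omega> - Y \<omega>\<bar>" for \<omega>
            using L(2)[of "x @ [Yn n \<omega>]" "x @ [Y \<omega>]"] x by (simp add: vdiff_append)
        qed
        also have "\<dots> = L * (\<integral>\<omega>. \<bar>Yn n \<omega> - Y \<omega>\<bar> \<partial>P)" by simp
        also have "\<dots> \<le> L * ?e" using elim(2) P L(1) by (intro mult_left_mono) auto
        finally show "(\<integral>\<omega>. \<bar>\<phi>' (x @ [Yn n \<omega>]) - \<phi>' (x @ [Y \<omega>])\<bar> \<partial>P) \<le> L * ?e" .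
      qed
      show ?case
      proof
        fix P assume P: "P \<in> \<P>"
        let ?d = "\<lambda>\<omega>. l1 (vdiff (Xn n \<omega>) (X \<omega>))"
        from elim(1) P have d: "integrable P ?d" "(\<integral>\<omega>. ?d \<omega> \<partial>P) \<le> ?e"
          by (auto simp: Xn_def X_def comp_def)
        have "(\<integral>\<omega>. \<bar>\<psi>n n (Xn n \<omega>) - \<psi> (X \<omega>)\<bar> \<partial>P) \<le> (\<integral>\<omega>. L * ?e + L * ?d \<omega> \<partial>P)"
        proof (rule integral_mono)
          show "integrable P (\<lambda>\<omega>. \<bar>\<psi>n n (Xn n \<omega>) - \<psi> (X \<omega>)\<bar>)"
            using fin_integrable[OF fpsi P] fin_integrable[OF fin_past[OF pXn[OF psin]] P] by auto
          show "integrable P (\<lambda>\<omega>. L * ?e + L * ?d \<omega>)"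
            using d(1) fin_integrable[OF fin_const P] by auto
          show "\<bar>\<psi>n n (Xn n \<omega>) - \<psi> (X \<omega>)\<bar> \<le> L * ?e + L * ?d \<omega>" for \<omega>
            using psi_n[of "Xn n \<omega>"] psi_lip[of "Xn n \<omega>" "X \<omega>"] by auto
        qed
        also have "\<dots> = L * ?e + L * (\<integral>\<omega>. ?d \<omega> \<partial>P)"
          using d(1) fin_integrable[OF fin_const P] prob_space.prob_space[OF P_prob[OF P]] by simp
        also have "\<dots> \<le> (L + 1) * ?e + (L + 1) * ?e"
          using d(2) e L(1) by (intro add_mono mult_mono) auto
        also have "(L + 1) * ?e = e / 2"
        proof -
          have "a * (e / (2 * a)) = e / 2" if "0 < a" for a :: real using that by simp
          from this[of "L + 1"] show ?thesis using L(1) by simp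
        qed
        also have "e / 2 + e / 2 = e" by simp
        finally show "(\<integral>\<omega>. \<bar>\<psi>n n (Xn n \<omega>) - \<psi> (X \<omega>)\<bar> \<partial>P) \<le> e" .
      qed
    qed
  qed
  have eqn: "E (\<lambda>\<omega>. \<phi>' (Xn n \<omega> @ [Yn n \<omega>])) = E (\<lambda>\<omega>. \<psi>n n (Xn n \<omega>))" for n
  proof -
    have "E (\<lambda>\<omega>. \<phi>' (map (\<lambda>X. X \<omega>) (map (\<lambda>r. Z 0 r n) ts) @ [sum_sq (unif s t (Suc n)) (Suc n) \<omega>])) =
      E (\<lambda>\<omega>. E (\<lambda>\<omega>'. \<phi>' (map (\<lambda>X. X \<omega>) (map (\<lambda>r. Z 0 r n) ts) @ [sum_sq (unif s t (Suc n)) (Suc n) \<omega>'])))"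
      using ts0 st phi' by (intro past_independence_sum_sq) (auto intro: past_Z mono_unif)
    then show ?thesis by (simp add: \<psi>n_def Xn_def Yn_def Z_def comp_def)
  qed
  have main: "E (\<lambda>\<omega>. \<phi>' (X \<omega> @ [Y \<omega>])) = E (\<lambda>\<omega>. \<psi> (X \<omega>))"
    using L1_lim_E[OF lim1] L1_lim_E[OF lim2] unfolding eqn by (rule LIMSEQ_unique)
  have Ypow: "fin (\<lambda>\<omega>. (1 + 2 * \<bar>Y \<omega>\<bar>) ^ k)" for k
  proof (rule fin_bounded[of _ "(1 + 2 * K) ^ k"])
    fix P assume P: "P \<in> \<P>"
    from AE_Y[OF P] show "AE \<omega> in P. \<bar>(1 + 2 * \<bar>Y \<omega>\<bar>) ^ k\<bar> \<le> (1 + 2 * K) ^ k"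
    proof eventually_elim
      case (elim \<omega>)
      then have "\<bar>Y \<omega>\<bar> \<le> K" using clamp0_bounds(3)[OF K, of "Y \<omega>"] by simp
      then show ?case by (simp add: power_mono)
    qed
  qed measurable
  have fxY: "fin (\<lambda>\<omega>. \<phi> (x @ [Y \<omega>]))" if "length x = ?m" for x
    by (rule fin_C_lLip_append[OF phi Ym Ypow that])
  have inner: "E (\<lambda>\<omega>'. \<phi> (X \<omega> @ [Y \<omega>'])) = \<psi> (X \<omega>)" if "map (clamp0 K) (X \<omega>) = X \<omega>" for \<omega>
    unfolding \<psi>_def
  proof (rule E_cong_AE)
    fix P assume P: "P \<in> \<P>"
    from AE_Y[OF P] show "AE \<omega>' in P. \<phi> (X \<omega> @ [Y \<omega>']) = \<phi>' (X \<omega> @ [Y \<omega>'])"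
      by eventually_elim (simp add: \<phi>'_def that)
  qed (auto intro: fxY fphix)
  let ?g = "\<lambda>\<omega>. E (\<lambda>\<omega>'. \<phi> (X \<omega> @ [Y \<omega>']))"
  have AE_g: "AE \<omega> in P. ?g \<omega> = \<psi> (X \<omega>)" if P: "P \<in> \<P>" for P
    using AE_X[OF P] by eventually_elim (rule inner)
  \<comment> \<open>Measurability comes from \<open>C_lLip_E\<close> for the unclamped
    \<open>\<phi>\<close>, the bound from almost sure equality with \<open>\<psi>\<close>.\<close>
  have fg: "fin ?g"
  proof (rule fin_dominated[OF fpsi mX[OF C_lLip_E[OF phi Ym Ypow]]])
    fix P assume "P \<in> \<P>"
    from AE_g[OF this] show "AE \<omega> in P. \<bar>?g \<omega>\<bar> \<le> \<bar>\<psi> (X \<omega>)\<bar>" by eventually_elim simp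
  qed
  have AE_phi: "AE \<omega> in P. \<phi> (X \<omega> @ [Y \<omega>]) = \<phi>' (X \<omega> @ [Y \<omega>])" if P: "P \<in> \<P>" for P
    using AE_X[OF P] AE_Y[OF P] by eventually_elim (simp add: \<phi>'_def)
  have fphi0: "fin (\<lambda>\<omega>. \<phi> (X \<omega> @ [Y \<omega>]))"
  proof (rule fin_dominated[OF fphi mXY[OF phi]])
    fix P assume "P \<in> \<P>"
    from AE_phi[OF this] show "AE \<omega> in P. \<bar>\<phi> (X \<omega> @ [Y \<omega>])\<bar> \<le> \<bar>\<phi>' (X \<omega> @ [Y \<omega>])\<bar>"
      by eventually_elim simp
  qed
  have "E (\<lambda>\<omega>. \<phi> (X \<omega> @ [Y \<omega>])) = E (\<lambda>\<omega>. \<phi>' (X \<omega> @ [Y \<omega>]))"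
    by (rule E_cong_AE[OF fphi0 fphi AE_phi])
  also have "\<dots> = E ?g" unfolding main by (rule E_cong_AE[OF fg fpsi AE_g, symmetric])
  finally show ?thesis by (simp add: X_def Y_def)
qed

lemma independent_increments_Q: "independent_increments \<P> Q"
  unfolding independent_increments_def independent_of_def
proof (intro allI impI ballI)
  fix s t :: real and ts \<phi> assume "0 \<le> s" "0 \<le> t" "times ts \<and> (\<forall>r\<in>set ts. r \<le> s)" "\<phi> \<in> C_lLip (length ts + 1)"
  then show "E (\<lambda>\<omega>. \<phi> (map (\<lambda>r. Q r \<omega>) ts @ [Q (s + t) \<omega> - Q s \<omega>])) =
    E (\<lambda>\<omega>. E (\<lambda>\<omega>'. \<phi> (map (\<lambda>r. Q r \<omega>) ts @ [Q (s + t) \<omega>' - Q s \<omega>'])))"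
    by (intro independence) auto
qed

text \<open>The deterministic speed \<open>c\<close> is attained in the limit of a large number of independent increments,
  since each contributes only \<open>O(h\<^sup>2)\<close> to the mean square deviation.\<close>

lemma deviation_nonneg:
  assumes c: "\<sigma>l\<^sup>2 \<le> c" "c \<le> \<sigma>u\<^sup>2" and st: "0 \<le> s" "0 \<le> t"
  shows "0 \<le> E (\<lambda>\<omega>. - (Q (s + t) \<omega> - Q s \<omega> - c * t)\<^sup>2)"
proof -
  define D where "D r \<omega> = Q (s + r) \<omega> - Q s \<omega> - c * r" for r \<omega>
  have Dm [measurable]: "D r \<in> borel_measurable borel" if "0 \<le> r" for r
    unfolding D_def[abs_def] using st that by (auto intro!: borel_measurable_diff Q_measurable)
  have c0: "0 \<le> c" using sig2 c by linarith
  have bd: "\<bar>x - c * h\<bar> \<le> \<sigma>u\<^sup>2 * h" if "0 \<le> x" "x \<le> \<sigma>u\<^sup>2 * h" "0 \<le> h" for x h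
  proof -
    have "0 \<le> c * h" "c * h \<le> \<sigma>u\<^sup>2 * h" using c c0 that by (auto intro: mult_right_mono)
    with that show ?thesis by linarith
  qed
  have D_bd: "AE \<omega> in P. \<bar>D r \<omega>\<bar> \<le> \<sigma>u\<^sup>2 * r" if "P \<in> \<P>" "0 \<le> r" for P r
  proof -
    have "s \<le> s + r" using that(2) by simp
    from increment_nonneg_AE[OF st(1) this that(1)] show ?thesis
      by eventually_elim (simp add: D_def bd that(2))
  qed
  \<comment> \<open>\<open>V\<close> is never positive; the aim is \<open>0 \<le> V t\<close>, by
    showing that \<open>V\<close> drops by at most a multiple of \<open>h\<^sup>2\<close> over a
    step of length \<open>h\<close>.\<close>
  define V where "V r = E (\<lambda>\<omega>. - (D r \<omega>)\<^sup>2)" for r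
  have sq: "\<bar>x\<^sup>2\<bar> \<le> b\<^sup>2" if "\<bar>x\<bar> \<le> b" for x b :: real
    using power_mono[OF that, of 2] by simp
  have AE_sq: "AE \<omega> in P. \<bar>(X \<omega>)\<^sup>2\<bar> \<le> b\<^sup>2" "AE \<omega> in P. \<bar>- (X \<omega>)\<^sup>2\<bar> \<le> b\<^sup>2"
    if "AE \<omega> in P. \<bar>X \<omega>\<bar> \<le> b" for P :: "path measure" and X and b :: real
    using that by (auto elim!: eventually_mono dest: sq)
  have fD: "fin (\<lambda>\<omega>. - (D r \<omega>)\<^sup>2)" if "0 \<le> r" for r
    using Dm[OF that] by (intro fin_bounded[OF _ AE_sq(2)[OF D_bd[OF _ that]]]) auto
  have step: "V r - (\<sigma>u\<^sup>2 * h)\<^sup>2 \<le> V (r + h)" if rh: "0 \<le> r" "0 \<le> h" for r h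
  proof -
    define Y where "Y \<omega> = Q (s + (r + h)) \<omega> - Q (s + r) \<omega>" for \<omega>
    have Ym [measurable]: "Y \<in> borel_measurable borel"
      unfolding Y_def[abs_def] using st rh by (intro increment_measurable) auto
    have fY: "fin Y" unfolding Y_def[abs_def] using st rh by (intro fin_increment) auto
    have Y_bd: "AE \<omega> in P. \<bar>Y \<omega> - c * h\<bar> \<le> \<sigma>u\<^sup>2 * h" if P: "P \<in> \<P>" for P
    proof -
      have "0 \<le> s + r" "s + r \<le> s + (r + h)" using st rh by auto
      from increment_nonneg_AE[OF this P] show ?thesis
        by eventually_elim (simp add: Y_def bd rh(2))
    qed
    \<comment> \<open>This is \<open>- (D (r + h))\<^sup>2\<close> with the square of the new
      deviation \<open>Y - c * h\<close> added back. It is affine in \<open>Y\<close>, so its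
      conditional upper mean is explicit.\<close>
    define F where "F \<omega> = - (D r \<omega>)\<^sup>2 - 2 * D r \<omega> * (Y \<omega> - c * h)" for \<omega>
    note [measurable] = Dm[OF rh(1)]
    have fF: "fin F"
    proof (rule fin_bounded[of _ "(\<sigma>u\<^sup>2 * r)\<^sup>2 + 2 * ((\<sigma>u\<^sup>2 * r) * (\<sigma>u\<^sup>2 * h))"])
      show "F \<in> borel_measurable borel" unfolding F_def[abs_def] by measurable
      fix P assume P: "P \<in> \<P>"
      show "AE \<omega> in P. \<bar>F \<omega>\<bar> \<le> (\<sigma>u\<^sup>2 * r)\<^sup>2 + 2 * ((\<sigma>u\<^sup>2 * r) * (\<sigma>u\<^sup>2 * h))"
        using D_bd[OF P rh(1)] Y_bd[OF P]
      proof eventually_elim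
        case (elim \<omega>)
        have "\<bar>D r \<omega>\<bar> * \<bar>Y \<omega> - c * h\<bar> \<le> (\<sigma>u\<^sup>2 * r) * (\<sigma>u\<^sup>2 * h)"
          using elim rh by (intro mult_mono) auto
        then have "\<bar>D r \<omega> * (Y \<omega> - c * h)\<bar> \<le> (\<sigma>u\<^sup>2 * r) * (\<sigma>u\<^sup>2 * h)" by (simp only: abs_mult)
        moreover have "(D r \<omega>)\<^sup>2 \<le> (\<sigma>u\<^sup>2 * r)\<^sup>2" using sq[OF elim(1)] by simp
        moreover have "F \<omega> = - (D r \<omega>)\<^sup>2 - 2 * (D r \<omega> * (Y \<omega> - c * h))" by (simp add: F_def)
        ultimately show ?case using zero_le_power2[of "D r \<omega>"] by linarith
      qed
    qed
    have fD2: "fin (\<lambda>\<omega>. (Y \<omega> - c * h)\<^sup>2)"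
      by (intro fin_bounded[OF _ AE_sq(1)[OF Y_bd]]) auto
    define g where "g z = - z\<^sup>2 + (gam (- 2 * z) + 2 * z * c) * h" for z
    have inner: "E (\<lambda>\<omega>'. - z\<^sup>2 - 2 * z * (Y \<omega>' - c * h)) = g z" for z
    proof -
      have "E (\<lambda>\<omega>'. - z\<^sup>2 - 2 * z * (Y \<omega>' - c * h)) = E (\<lambda>\<omega>'. (- z\<^sup>2 + 2 * z * c * h) + (- 2 * z) * Y \<omega>')"
        by (simp add: algebra_simps)
      also have "\<dots> = (- z\<^sup>2 + 2 * z * c * h) + E (\<lambda>\<omega>'. (- 2 * z) * Y \<omega>')"
        by (rule E_const_add[OF fin_cmult[OF fY]])
      also have "E (\<lambda>\<omega>'. (- 2 * z) * Y \<omega>') = gam (- 2 * z) * h"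
        unfolding Y_def using E_increment_linear[of "s + r" "s + (r + h)" "- 2 * z"] st rh by simp
      finally show ?thesis by (simp add: g_def algebra_simps)
    qed
    \<comment> \<open>The drift \<open>(gam (- 2 * z) + 2 * z * c) * h\<close> is nonnegative
      because \<open>c\<close> is an admissible speed: whatever the sign of \<open>z\<close>, the
      upper expectation does at least as well as the constant speed \<open>c\<close>.\<close>
    have g_ge: "- z\<^sup>2 \<le> g z" for z
      using gam_ge[OF c, of "- 2 * z"] rh(2) unfolding g_def by (auto intro!: mult_nonneg_nonneg)
    \<comment> \<open>\<open>D r\<close> depends on the two values \<open>Q s\<close> and
      \<open>Q (s + r)\<close>; they form the past from which the increment after
      \<open>s + r\<close> is independent.\<close>
    have "(\<lambda>x. - (x ! 1 - x ! 0 - c * r)\<^sup>2 - 2 * (x ! 1 - x ! 0 - c * r) * (x ! 2 - c * h)) \<in> C_lLip (Suc (length [s, s + r]))"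
      by (intro C_lLip_diff C_lLip_mult C_lLip_const C_lLip_nth C_lLip_uminus square_C_lLip) auto
    moreover have "times [s, s + r]" "ra \<in> set [s, s + r] \<Longrightarrow> ra \<le> s + r" for ra
      using st rh by (auto simp: times_def)
    moreover have "0 \<le> s + r" "s + r \<le> s + (r + h)" using st rh by auto
    ultimately have "E F = E (\<lambda>\<omega>. E (\<lambda>\<omega>'. - (D r \<omega>)\<^sup>2 - 2 * D r \<omega> * (Y \<omega>' - c * h)))"
      using independence[of "[s, s + r]" "s + r" "s + (r + h)"
        "\<lambda>x. - (x ! 1 - x ! 0 - c * r)\<^sup>2 - 2 * (x ! 1 - x ! 0 - c * r) * (x ! 2 - c * h)"]
      by (simp add: F_def[abs_def] D_def Y_def)
    also have "\<dots> = E (\<lambda>\<omega>. g (D r \<omega>))" by (simp add: inner)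
    also have "\<dots> \<ge> V r"
      unfolding V_def
    proof (rule E_mono[OF fD[OF rh(1)] _ g_ge])
      have [measurable]: "gam \<in> borel_measurable borel"
        unfolding gam_eq[abs_def] by measurable
      show "fin (\<lambda>\<omega>. g (D r \<omega>))"
      proof (rule fin_bounded[of _ "(\<sigma>u\<^sup>2 * r)\<^sup>2 + 4 * \<sigma>u\<^sup>2 * h * (\<sigma>u\<^sup>2 * r)"])
        show "(\<lambda>\<omega>. g (D r \<omega>)) \<in> borel_measurable borel" unfolding g_def by measurable
        fix P assume P: "P \<in> \<P>"
        show "AE \<omega> in P. \<bar>g (D r \<omega>)\<bar> \<le> (\<sigma>u\<^sup>2 * r)\<^sup>2 + 4 * \<sigma>u\<^sup>2 * h * (\<sigma>u\<^sup>2 * r)"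
          using D_bd[OF P rh(1)]
        proof eventually_elim
          case (elim \<omega>)
          let ?z = "D r \<omega>"
          have "\<bar>gam (- 2 * ?z)\<bar> \<le> 2 * \<bar>?z\<bar> * \<sigma>u\<^sup>2"
            using mult_left_mono[OF sig2(2), of "2 * \<bar>?z\<bar>"] by (auto simp: gam_eq abs_mult mult_ac)
          moreover have "\<bar>2 * ?z * c\<bar> \<le> 2 * \<bar>?z\<bar> * \<sigma>u\<^sup>2"
            using mult_left_mono[OF c(2), of "2 * \<bar>?z\<bar>"] c0 by (auto simp: abs_mult mult_ac)
          ultimately have "\<bar>gam (- 2 * ?z) + 2 * ?z * c\<bar> \<le> 4 * \<sigma>u\<^sup>2 * \<bar>?z\<bar>" by (simp add: mult_ac)
          then have "\<bar>gam (- 2 * ?z) + 2 * ?z * c\<bar> * h \<le> 4 * \<sigma>u\<^sup>2 * \<bar>?z\<bar> * h"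
            using rh(2) by (rule mult_right_mono)
          also have "\<dots> = 4 * \<sigma>u\<^sup>2 * h * \<bar>?z\<bar>" by simp
          also have "\<dots> \<le> 4 * \<sigma>u\<^sup>2 * h * (\<sigma>u\<^sup>2 * r)" using elim rh(2) by (intro mult_left_mono) auto
          finally have "\<bar>(gam (- 2 * ?z) + 2 * ?z * c) * h\<bar> \<le> 4 * \<sigma>u\<^sup>2 * h * (\<sigma>u\<^sup>2 * r)"
            using rh(2) by (simp add: abs_mult)
          moreover have "\<bar>?z\<^sup>2\<bar> \<le> (\<sigma>u\<^sup>2 * r)\<^sup>2" by (rule sq[OF elim])
          ultimately show ?case unfolding g_def by linarith
        qed
      qed
    qed
    finally have "V r \<le> E F" .
    moreover have "E F \<le> V (r + h) + (\<sigma>u\<^sup>2 * h)\<^sup>2"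
    proof -
      have "F = (\<lambda>\<omega>. - (D (r + h) \<omega>)\<^sup>2 + (Y \<omega> - c * h)\<^sup>2)"
        by (auto simp: F_def D_def Y_def power2_eq_square algebra_simps)
      then have "E F \<le> V (r + h) + E (\<lambda>\<omega>. (Y \<omega> - c * h)\<^sup>2)"
        using E_add_le[OF fD[of "r + h"] fD2] rh by (simp add: V_def)
      moreover have "\<bar>E (\<lambda>\<omega>. (Y \<omega> - c * h)\<^sup>2)\<bar> \<le> (\<sigma>u\<^sup>2 * h)\<^sup>2"
        by (intro abs_E_le[OF fD2] AE_sq(1)[OF Y_bd])
      ultimately show ?thesis by linarith
    qed
    ultimately show ?thesis by linarith
  qed
  have iter: "V 0 - real n * (\<sigma>u\<^sup>2 * h)\<^sup>2 \<le> V (real n * h)" if "0 \<le> h" for n h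
  proof (induction n)
    case (Suc n)
    with step[of "real n * h" h] that show ?case by (simp add: algebra_simps)
  qed simp
  have V0: "V 0 = 0" by (simp add: V_def D_def)
  \<comment> \<open>\<open>Suc n\<close> steps of length \<open>t / Suc n\<close> lose
    \<open>(\<sigma>u\<^sup>2 * t / Suc n)\<^sup>2\<close> each, \<open>b / Suc n\<close>
    altogether.\<close>
  define b where "b = (\<sigma>u\<^sup>2 * t)\<^sup>2"
  have "- (b * inverse (real (Suc n))) \<le> V t" for n
  proof -
    have "V 0 - real (Suc n) * (\<sigma>u\<^sup>2 * (t / real (Suc n)))\<^sup>2 \<le> V (real (Suc n) * (t / real (Suc n)))"
      using st by (intro iter) auto
    moreover have "real (Suc n) * (t / real (Suc n)) = t" by simp
    moreover have "real (Suc n) * (\<sigma>u\<^sup>2 * (t / real (Suc n)))\<^sup>2 = b * inverse (real (Suc n))"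
      by (simp add: b_def power2_eq_square field_simps del: of_nat_Suc)
    ultimately show ?thesis using V0 by simp
  qed
  moreover have "(\<lambda>n. - (b * inverse (real (Suc n)))) \<longlonglongrightarrow> - (b * 0)"
    by (intro tendsto_minus tendsto_mult_left LIMSEQ_inverse_real_of_nat)
  ultimately have "- (b * 0) \<le> V t" by (intro LIMSEQ_le_const2) auto
  then show ?thesis by (simp add: V_def D_def)
qed

end

section \<open>The law of the increments\<close>

lemma C_lLip_singleton_continuous:
  assumes "\<phi> \<in> C_lLip 1" shows "continuous_on UNIV (\<lambda>x. \<phi> [x])"
proof -
  from C_lLip_weight_bound[OF assms] obtain C k where C: "0 \<le> C" "\<And>x y. length x = 1 \<Longrightarrow> length y = 1 \<Longrightarrow>
      \<bar>\<phi> x - \<phi> y\<bar> \<le> C * weight x y ^ k * l1 (vdiff x y)" by blast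
  have "((\<lambda>y. \<phi> [y]) \<longlongrightarrow> \<phi> [x]) (at x)" for x
  proof -
    have "((\<lambda>y. C * (1 + \<bar>y\<bar> + \<bar>x\<bar>) ^ k * \<bar>y - x\<bar>) \<longlongrightarrow> C * (1 + \<bar>x\<bar> + \<bar>x\<bar>) ^ k * \<bar>x - x\<bar>) (at x)"
      by (intro tendsto_intros)
    then have "((\<lambda>y. C * (1 + \<bar>y\<bar> + \<bar>x\<bar>) ^ k * \<bar>y - x\<bar>) \<longlongrightarrow> 0) (at x)" by simp
    then have "((\<lambda>y. \<phi> [y] - \<phi> [x]) \<longlongrightarrow> 0) (at x)"
      by (rule Lim_null_comparison[rotated]) (use C(2)[of "[_]" "[x]"] in \<open>auto simp: weight_def\<close>)
    then show ?thesis by (simp add: LIM_zero_iff)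
  qed
  then show ?thesis by (simp add: continuous_on)
qed

text \<open>Makes Weierstrass polynomials usable as Lipschitz approximants, on
  \<open>[0, K]\<close>, of a function that is merely continuous; cylinder functionals cannot take
  the latter directly.\<close>

lemma real_polynomial_function_lipschitz:
  fixes p :: "real \<Rightarrow> real"
  assumes "real_polynomial_function p"
  shows "\<exists>L\<ge>0. \<forall>x\<in>{0..K}. \<forall>y\<in>{0..K}. \<bar>p x - p y\<bar> \<le> L * \<bar>x - y\<bar>"
  using assms
proof induction
  case (linear f)
  from bounded_linear.bounded[OF linear] obtain L where L: "\<And>x. norm (f x) \<le> norm x * L" by blast
  have "\<bar>f x - f y\<bar> \<le> \<bar>L\<bar> * \<bar>x - y\<bar>" for x y
  proof -
    have "\<bar>f x - f y\<bar> = norm (f (x - y))"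
      using bounded_linear.linear[OF linear] by (simp add: linear_diff)
    also have "\<dots> \<le> \<bar>x - y\<bar> * L" using L[of "x - y"] by simp
    also have "\<dots> \<le> \<bar>x - y\<bar> * \<bar>L\<bar>" by (intro mult_left_mono) auto
    finally show ?thesis by (simp add: mult.commute)
  qed
  then show ?case by (intro exI[of _ "\<bar>L\<bar>"]) auto
next
  case (const c)
  show ?case by (intro exI[of _ 0]) auto
next
  case (add f g)
  then obtain L M where "0 \<le> L" "\<forall>x\<in>{0..K}. \<forall>y\<in>{0..K}. \<bar>f x - f y\<bar> \<le> L * \<bar>x - y\<bar>"
    "0 \<le> M" "\<forall>x\<in>{0..K}. \<forall>y\<in>{0..K}. \<bar>g x - g y\<bar> \<le> M * \<bar>x - y\<bar>" by blast
  note LM = this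
  have "\<bar>f x + g x - (f y + g y)\<bar> \<le> (L + M) * \<bar>x - y\<bar>" if "x \<in> {0..K}" "y \<in> {0..K}" for x y
  proof -
    have "\<bar>f x - f y\<bar> \<le> L * \<bar>x - y\<bar>" "\<bar>g x - g y\<bar> \<le> M * \<bar>x - y\<bar>" using LM that by blast+
    then show ?thesis unfolding distrib_right by linarith
  qed
  with LM(1,3) show ?case by (intro exI[of _ "L + M"]) auto
next
  case (mult f g)
  then obtain L M where LM: "0 \<le> L" "\<forall>x\<in>{0..K}. \<forall>y\<in>{0..K}. \<bar>f x - f y\<bar> \<le> L * \<bar>x - y\<bar>"
    "0 \<le> M" "\<forall>x\<in>{0..K}. \<forall>y\<in>{0..K}. \<bar>g x - g y\<bar> \<le> M * \<bar>x - y\<bar>" by blast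
  define a where "a = \<bar>f 0\<bar> + L * \<bar>K\<bar>"
  define b where "b = \<bar>g 0\<bar> + M * \<bar>K\<bar>"
  have bd: "\<bar>f x\<bar> \<le> a" "\<bar>g x\<bar> \<le> b" if "x \<in> {0..K}" for x
  proof -
    have "0 \<in> {0..K}" using that by auto
    with LM that have "\<bar>f x - f 0\<bar> \<le> L * \<bar>x - 0\<bar>" "\<bar>g x - g 0\<bar> \<le> M * \<bar>x - 0\<bar>" by blast+
    moreover have "L * \<bar>x - 0\<bar> \<le> L * \<bar>K\<bar>" "M * \<bar>x - 0\<bar> \<le> M * \<bar>K\<bar>"
      using LM that by (auto intro!: mult_left_mono)
    ultimately show "\<bar>f x\<bar> \<le> a" "\<bar>g x\<bar> \<le> b" unfolding a_def b_def by linarith+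
  qed
  have "\<bar>f x * g x - f y * g y\<bar> \<le> (a * M + b * L) * \<bar>x - y\<bar>" if "x \<in> {0..K}" "y \<in> {0..K}" for x y
  proof -
    have fg: "\<bar>f x - f y\<bar> \<le> L * \<bar>x - y\<bar>" "\<bar>g x - g y\<bar> \<le> M * \<bar>x - y\<bar>" using LM that by blast+
    have "f x * g x - f y * g y = f x * (g x - g y) + g y * (f x - f y)" by (simp add: algebra_simps)
    then have "\<bar>f x * g x - f y * g y\<bar> \<le> \<bar>f x\<bar> * \<bar>g x - g y\<bar> + \<bar>g y\<bar> * \<bar>f x - f y\<bar>"
      by (metis abs_mult abs_triangle_ineq)
    also have "\<dots> \<le> a * (M * \<bar>x - y\<bar>) + b * (L * \<bar>x - y\<bar>)"
      using bd(1)[OF that(1)] bd(2)[OF that(2)] fg by (intro add_mono mult_mono) auto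
    finally show ?thesis by (simp add: algebra_simps)
  qed
  moreover have "0 \<le> a * M + b * L" unfolding a_def b_def using LM by auto
  ultimately show ?case by blast
qed

lemma continuous_bounded:
  assumes "continuous_on UNIV (\<phi> :: real \<Rightarrow> real)"
  shows "\<exists>M\<ge>0. \<forall>x\<in>{0..K}. \<bar>\<phi> x\<bar> \<le> M"
proof -
  have "bounded (\<phi> ` {0..K})"
    using assms by (intro compact_imp_bounded compact_continuous_image) (auto intro: continuous_on_subset)
  then show ?thesis by (auto simp: bounded_pos intro: less_imp_le)
qed

text \<open>A parabola with its top at height \<open>\<phi> z - e\<close> lies below
  \<open>\<phi>\<close>: near \<open>z\<close> by continuity, elsewhere because it has dropped by
  twice the bound of \<open>\<phi>\<close>. This reduces lower bounds on \<open>E\<close> for any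
  \<open>\<phi>\<close> to the one function treated in \<open>deviation_nonneg\<close>.\<close>

lemma quadratic_minorant:
  fixes \<phi> :: "real \<Rightarrow> real"
  assumes phi: "continuous_on UNIV \<phi>" and e: "0 < e" and z: "z \<in> {0..K}"
  shows "\<exists>C\<ge>0. \<forall>x\<in>{0..K}. \<phi> z - e - C * (x - z)\<^sup>2 \<le> \<phi> x"
proof -
  obtain M where M: "0 \<le> M" "\<And>x. x \<in> {0..K} \<Longrightarrow> \<bar>\<phi> x\<bar> \<le> M"
    using continuous_bounded[OF phi] by blast
  have "isCont \<phi> z" using phi by (simp add: continuous_on_eq_continuous_at)
  then obtain d where d: "0 < d" "\<And>x. dist x z < d \<Longrightarrow> dist (\<phi> x) (\<phi> z) < e"
    using e unfolding continuous_at_eps_delta by blast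
  \<comment> \<open>The coefficient makes the parabola drop by \<open>2 * M\<close> at distance
    \<open>d\<close> from \<open>z\<close>.\<close>
  show ?thesis
  proof (intro exI[of _ "2 * M / d\<^sup>2"] conjI ballI)
    show "0 \<le> 2 * M / d\<^sup>2" using M(1) by simp
    fix x assume x: "x \<in> {0..K}"
    show "\<phi> z - e - 2 * M / d\<^sup>2 * (x - z)\<^sup>2 \<le> \<phi> x"
    proof (cases "dist x z < d")
      case True
      have "0 \<le> 2 * M / d\<^sup>2 * (x - z)\<^sup>2" using M(1) by simp
      with d(2)[OF True] show ?thesis by (simp add: dist_real_def)
    next
      case False
      then have "d\<^sup>2 \<le> (x - z)\<^sup>2" using d(1) by (subst abs_le_square_iff[symmetric]) (auto simp: dist_real_def)
      then have "2 * M / d\<^sup>2 * d\<^sup>2 \<le> 2 * M / d\<^sup>2 * (x - z)\<^sup>2" using M(1) by (intro mult_left_mono) auto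
      then have "2 * M \<le> 2 * M / d\<^sup>2 * (x - z)\<^sup>2" using d(1) by simp
      with M(2)[OF x] M(2)[OF z] e show ?thesis by linarith
    qed
  qed
qed

section \<open>Upper and conditional expectations of \<open>\<phi>\<close> of an increment\<close>

context gbm_qv
begin

abbreviation speeds :: "real set" where
  "speeds \<equiv> {\<alpha>. \<sigma>l\<^sup>2 \<le> \<alpha>\<^sup>2 \<and> \<alpha>\<^sup>2 \<le> \<sigma>u\<^sup>2}"

lemma sigma_u_speed: "\<sigma>u \<in> speeds"
  using sig2 by simp

lemma speed_range: "0 \<le> t \<Longrightarrow> \<alpha> \<in> speeds \<Longrightarrow> \<alpha>\<^sup>2 * t \<in> {0..\<sigma>u\<^sup>2 * t}"
  by (auto intro: mult_right_mono)

lemma speed_exists: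
  assumes "0 \<le> t" "\<sigma>l\<^sup>2 * t \<le> x" "x \<le> \<sigma>u\<^sup>2 * t"
  shows "\<exists>\<alpha>\<in>speeds. x = \<alpha>\<^sup>2 * t"
proof (cases "t = 0")
  case True
  with assms sigma_u_speed show ?thesis by (intro bexI[of _ \<sigma>u]) auto
next
  case False
  with assms(1) have t: "0 < t" by simp
  have "0 \<le> \<sigma>l\<^sup>2 * t" using t by simp
  with assms(2) have "0 \<le> x" by linarith
  with t have "0 \<le> x / t" by simp
  then have "(sqrt (x / t))\<^sup>2 = x / t" by simp
  moreover have "\<sigma>l\<^sup>2 \<le> x / t" "x / t \<le> \<sigma>u\<^sup>2" using assms t by (auto simp: field_simps)
  ultimately show ?thesis using t by (intro bexI[of _ "sqrt (x / t)"]) auto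
qed

lemma fin_continuous_increment:
  assumes phi: "continuous_on UNIV \<phi>" and st: "0 \<le> s" "0 \<le> t"
  shows "fin (\<lambda>\<omega>. \<phi> (Q (t + s) \<omega> - Q s \<omega>))"
proof -
  have st': "s \<le> t + s" using st by simp
  obtain M where M: "\<And>x. x \<in> {0..\<sigma>u\<^sup>2 * t} \<Longrightarrow> \<bar>\<phi> x\<bar> \<le> M"
    using continuous_bounded[OF phi] by blast
  show ?thesis
  proof (rule fin_bounded[of _ M])
    show "(\<lambda>\<omega>. \<phi> (Q (t + s) \<omega> - Q s \<omega>)) \<in> borel_measurable borel"
      by (rule measurable_compose[OF increment_measurable[OF st(1) st'] borel_measurable_continuous_onI[OF phi]])
    fix P assume "P \<in> \<P>"
    from increment_nonneg_AE[OF st(1) st' this] show "AE \<omega> in P. \<bar>\<phi> (Q (t + s) \<omega> - Q s \<omega>)\<bar> \<le> M"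
      by eventually_elim (auto intro: M)
  qed
qed

lemma bdd_above_speeds:
  assumes "continuous_on UNIV (\<phi> :: real \<Rightarrow> real)" "0 \<le> t"
  shows "bdd_above ((\<lambda>\<alpha>. \<phi> (\<alpha>\<^sup>2 * t)) ` speeds)"
proof -
  obtain M where M: "\<And>x. x \<in> {0..\<sigma>u\<^sup>2 * t} \<Longrightarrow> \<bar>\<phi> x\<bar> \<le> M"
    using continuous_bounded[OF assms(1)] by blast
  have "\<phi> (\<alpha>\<^sup>2 * t) \<le> M" if "\<alpha> \<in> speeds" for \<alpha>
    using abs_le_D1[OF M[OF speed_range[OF assms(2) that]]] .
  then show ?thesis by (intro bdd_aboveI2[of _ _ M])
qed

text \<open>Upper bound: almost every increment is itself of the form
  \<open>\<alpha>\<^sup>2 * t\<close>. Lower bound: a downward parabola centred at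
  \<open>z = \<alpha>\<^sup>2 * t\<close> costs only \<open>e\<close>, as the upper mean of
  \<open>- (?R \<omega> - z)\<^sup>2\<close> is not negative.\<close>

lemma E_increment:
  assumes phi: "continuous_on UNIV \<phi>" and st: "0 \<le> s" "0 \<le> t"
  shows "E (\<lambda>\<omega>. \<phi> (Q (t + s) \<omega> - Q s \<omega>)) = (SUP \<alpha>\<in>speeds. \<phi> (\<alpha>\<^sup>2 * t))"
proof (rule antisym)
  let ?R = "\<lambda>\<omega>. Q (t + s) \<omega> - Q s \<omega>"
  let ?S = "SUP \<alpha>\<in>speeds. \<phi> (\<alpha>\<^sup>2 * t)"
  have st': "s \<le> t + s" using st by simp
  note fphi = fin_continuous_increment[OF phi st]
  have "E (\<lambda>\<omega>. \<phi> (?R \<omega>)) \<le> E (\<lambda>_. ?S)"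
  proof (rule E_mono_AE[OF fphi fin_const])
    fix P assume "P \<in> \<P>"
    from increment_bounds_AE[OF st(1) st' this] show "AE \<omega> in P. \<phi> (?R \<omega>) \<le> ?S"
    proof eventually_elim
      case (elim \<omega>)
      then obtain \<alpha> where "\<alpha> \<in> speeds" "?R \<omega> = \<alpha>\<^sup>2 * t" using speed_exists[OF st(2), of "?R \<omega>"] by auto
      then show ?case using cSUP_upper[OF _ bdd_above_speeds[OF phi st(2)]] by simp
    qed
  qed
  then show "E (\<lambda>\<omega>. \<phi> (?R \<omega>)) \<le> ?S" by simp
  show "?S \<le> E (\<lambda>\<omega>. \<phi> (?R \<omega>))"
  proof (rule cSUP_least)
    show "speeds \<noteq> {}" using sigma_u_speed by blast
    fix \<alpha> assume a: "\<alpha> \<in> speeds"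
    define z where "z = \<alpha>\<^sup>2 * t"
    have z: "z \<in> {0..\<sigma>u\<^sup>2 * t}" unfolding z_def by (rule speed_range[OF st(2) a])
    show "\<phi> (\<alpha>\<^sup>2 * t) \<le> E (\<lambda>\<omega>. \<phi> (?R \<omega>))"
      unfolding z_def[symmetric]
    proof (rule field_le_epsilon)
      fix e :: real assume "0 < e"
      then obtain C where C: "0 \<le> C" "\<And>x. x \<in> {0..\<sigma>u\<^sup>2 * t} \<Longrightarrow> \<phi> z - e - C * (x - z)\<^sup>2 \<le> \<phi> x"
        using quadratic_minorant[OF phi _ z] by blast
      have fD: "fin (\<lambda>\<omega>. - (?R \<omega> - z)\<^sup>2)"
        by (rule fin_continuous_increment[OF _ st]) (intro continuous_intros)
      have "0 \<le> E (\<lambda>\<omega>. - (?R \<omega> - z)\<^sup>2)"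
        unfolding z_def using deviation_nonneg[of "\<alpha>\<^sup>2" s t] a st by (simp add: add.commute)
      then have "\<phi> z - e \<le> (\<phi> z - e) + C * E (\<lambda>\<omega>. - (?R \<omega> - z)\<^sup>2)" using C(1) by simp
      also have "\<dots> = E (\<lambda>\<omega>. (\<phi> z - e) + C * - (?R \<omega> - z)\<^sup>2)"
        by (subst E_const_add[OF fin_cmult[OF fD]]) (simp only: E_cmult[OF fD C(1)])
      also have "\<dots> \<le> E (\<lambda>\<omega>. \<phi> (?R \<omega>))"
      proof (rule E_mono_AE[OF fin_add[OF fin_const fin_cmult[OF fD]] fphi])
        fix P assume "P \<in> \<P>"
        from increment_nonneg_AE[OF st(1) st' this]
        show "AE \<omega> in P. (\<phi> z - e) + C * - (?R \<omega> - z)\<^sup>2 \<le> \<phi> (?R \<omega>)"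
        proof eventually_elim
          case (elim \<omega>)
          then show ?case using C(2)[of "?R \<omega>"] by simp
        qed
      qed
      finally show "\<phi> z \<le> E (\<lambda>\<omega>. \<phi> (?R \<omega>)) + e" by simp
    qed
  qed
qed

text \<open>Read off the law: the right side of \<open>E_increment\<close> does not contain
  \<open>s\<close>.\<close>

lemma stationary_increments_Q: "stationary_increments \<P> Q"
  unfolding stationary_increments_def identically_distributed_def
proof (intro allI impI ballI)
  fix s t :: real and \<phi> assume st: "0 \<le> s" "0 \<le> t" and phi: "\<phi> \<in> C_lLip 1"
  note c = C_lLip_singleton_continuous[OF phi]
  show "E (\<lambda>\<omega>. \<phi> [Q (s + t) \<omega> - Q s \<omega>]) = E (\<lambda>\<omega>. \<phi> [Q t \<omega> - Q 0 \<omega>])"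
    using E_increment[OF c st] E_increment[OF c order_refl st(2)] by (simp add: add.commute)
qed

lemma E_Q: assumes "0 \<le> t" shows "E (\<lambda>\<omega>. k * Q t \<omega>) = gam k * t"
proof -
  have "E (\<lambda>\<omega>. k * Q t \<omega>) = E (\<lambda>\<omega>. k * (Q t \<omega> - Q 0 \<omega>))"
  proof (rule E_cong_AE)
    show "fin (\<lambda>\<omega>. k * Q t \<omega>)" by (rule fin_cmult[OF L1_limD(2)[OF Z_L1_lim_Q[OF assms]]])
    show "fin (\<lambda>\<omega>. k * (Q t \<omega> - Q 0 \<omega>))" by (rule fin_cmult[OF fin_increment[OF order_refl assms]])
    fix P assume "P \<in> \<P>"
    from Q_0_AE[OF this] show "AE \<omega> in P. k * Q t \<omega> = k * (Q t \<omega> - Q 0 \<omega>)" by eventually_elim simp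
  qed
  then show ?thesis using E_increment_linear[OF order_refl assms] by simp
qed

lemma upper_moment_const: "upper_moment \<P> 1 (\<lambda>_. c) = ennreal \<bar>c\<bar>"
proof -
  have "(SUP P\<in>\<P>. \<integral>\<^sup>+\<omega>. ennreal (\<bar>c\<bar> ^ 1) \<partial>P) = (SUP P\<in>\<P>. ennreal \<bar>c\<bar>)"
    by (rule SUP_cong) (simp_all add: prob_space.emeasure_space_1[OF P_prob])
  then show ?thesis using P_nonempty by (simp add: upper_moment_def)
qed

lemma cylinder_cond_exp_Z:
  assumes h: "L-lipschitz_on UNIV h" and st: "0 \<le> s" "s \<le> t"
  shows "cylinder_cond_exp \<P> s (\<lambda>\<omega>. h (Z s t n \<omega>)) (\<lambda>_. E (\<lambda>\<omega>. h (Z s t n \<omega>)))"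
proof -
  let ?u = "unif s t (Suc n)"
  define vs where "vs = map (\<lambda>i. ?u (Suc i)) [0..<Suc n]"
  \<comment> \<open>With \<open>us = [s]\<close>, entry 0 is the value at time \<open>s\<close> and
    the increments over \<open>[s, t]\<close> start at index 1. Skipping entry 0 is what makes the
    conditional expectation constant.\<close>
  define \<phi> where "\<phi> x = h (\<Sum>i<Suc n. (x ! Suc i)\<^sup>2)" for x
  have u: "s \<le> ?u i" "?u i \<le> ?u (Suc i)" for i
    using monoD[OF mono_unif[OF st(2)], of 0 i] monoD[OF mono_unif[OF st(2)], of i "Suc i"] by auto
  have lv: "length vs = Suc n" by (simp add: vs_def)
  have "sorted vs"
    unfolding vs_def sorted_iff_nth_mono by (auto simp del: upt_Suc intro!: monoD[OF mono_unif[OF st(2)]])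
  then have "times ([s] @ vs)"
    using u st unfolding times_def vs_def by (auto simp del: upt_Suc intro: order_trans)
  moreover have "\<phi> \<in> C_lLip (length ([s] @ vs))"
    unfolding \<phi>_def[abs_def] using h
    by (intro C_lLip_lipschitz[of _ _ L h] C_lLip_sum square_C_lLip C_lLip_nth) (auto simp: lv)
  moreover have eq: "(\<Sum>i<Suc n. ((a # increments s vs \<omega>) ! Suc i)\<^sup>2) = Z s t n \<omega>" for a \<omega>
    unfolding Z_def sum_sq_def
  proof (rule sum.cong)
    fix i assume i: "i \<in> {..<Suc n}"
    have "(s # vs) ! i = ?u i" "vs ! i = ?u (Suc i)"
      using i by (cases i; auto simp: vs_def simp del: upt_Suc)+
    then show "((a # increments s vs \<omega>) ! Suc i)\<^sup>2 = (coord (?u (Suc i)) \<omega> - coord (?u i) \<omega>)\<^sup>2"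
      using i lv by (simp add: nth_increments)
  qed simp
  ultimately show ?thesis
    unfolding cylinder_cond_exp_def
    by (intro exI[of _ "[s]"] exI[of _ vs] exI[of _ \<phi>]) (simp add: \<phi>_def eq del: sum.lessThan_Suc)
qed

text \<open>Three approximations lead to a cylinder functional \<open>X'\<close>: a polynomial for
  \<open>\<phi>\<close>, clamping to make it globally Lipschitz, and \<open>Z\<close> for the
  increment of \<open>Q\<close>. The conditional expectation of the result is the constant
  \<open>E X'\<close>, which is within \<open>e\<close> of \<open>S\<close> by
  \<open>E_diff_bound\<close>.\<close>

lemma cond_exp_increment:
  assumes phi: "continuous_on UNIV \<phi>" and st: "0 \<le> s" "0 \<le> t"
  shows "is_cond_exp \<P> s (\<lambda>\<omega>. \<phi> (Q (t + s) \<omega> - Q s \<omega>)) (\<lambda>_. SUP \<alpha>\<in>speeds. \<phi> (\<alpha>\<^sup>2 * t))"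
proof -
  let ?X = "\<lambda>\<omega>. \<phi> (Q (t + s) \<omega> - Q s \<omega>)"
  define S where "S = (SUP \<alpha>\<in>speeds. \<phi> (\<alpha>\<^sup>2 * t))"
  define K where "K = \<sigma>u\<^sup>2 * t"
  have K: "0 \<le> K" using st by (simp add: K_def)
  have st': "s \<le> t + s" using st by simp
  have fX: "fin ?X" by (rule fin_continuous_increment[OF phi st])
  have ES: "E ?X = S" unfolding S_def by (rule E_increment[OF phi st])
  have ex: "\<exists>X' Y'. cylinder_cond_exp \<P> s X' Y' \<and> cylinder X' \<and>
      upper_moment \<P> 1 (\<lambda>\<omega>. X' \<omega> - ?X \<omega>) \<le> ennreal e \<and> upper_moment \<P> 1 (\<lambda>\<omega>. Y' \<omega> - S) \<le> ennreal e"
    if e: "0 < e" for e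
  proof -
    have "compact {0..K}" "continuous_on {0..K} \<phi>" "0 < e / 2"
      using phi e by (auto intro: continuous_on_subset)
    from Stone_Weierstrass_real_polynomial_function[OF this]
    obtain p where p: "real_polynomial_function p" "\<And>x. x \<in> {0..K} \<Longrightarrow> \<bar>\<phi> x - p x\<bar> < e / 2" by blast
    obtain L where L: "0 \<le> L" "\<And>x y. x \<in> {0..K} \<Longrightarrow> y \<in> {0..K} \<Longrightarrow> \<bar>p x - p y\<bar> \<le> L * \<bar>x - y\<bar>"
      using real_polynomial_function_lipschitz[OF p(1), of K] by blast
    define h where "h x = p (clamp0 K x)" for x
    have hL: "\<bar>h x - h y\<bar> \<le> L * \<bar>x - y\<bar>" for x y
    proof -
      have "\<bar>h x - h y\<bar> \<le> L * \<bar>clamp0 K x - clamp0 K y\<bar>" unfolding h_def using K by (intro L(2)) auto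
      also have "\<dots> \<le> L * \<bar>x - y\<bar>" using L(1) by (intro mult_left_mono) (auto simp: clamp0_def)
      finally show ?thesis .
    qed
    have lip: "L-lipschitz_on UNIV h" using hL L(1) by (intro lipschitz_onI) (auto simp: dist_real_def)
    \<comment> \<open>Half of \<open>e\<close> is left to the polynomial, half to the distance of
      \<open>Z\<close> from the increment, enlarged by \<open>L\<close>; \<open>L + 1\<close> avoids
      a zero denominator.\<close>
    have "0 < e / (2 * (L + 1))" using e L(1) by simp
    from L1_limD(3)[OF Z_L1_lim[OF st(1) st'] this] obtain n where
      n: "\<And>P. P \<in> \<P> \<Longrightarrow> (\<integral>\<omega>. \<bar>Z s (t + s) n \<omega> - (Q (t + s) \<omega> - Q s \<omega>)\<bar> \<partial>P) \<le> e / (2 * (L + 1))"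
      by (auto simp: eventually_sequentially)
    define X' where "X' \<omega> = h (Z s (t + s) n \<omega>)" for \<omega>
    have pX': "past (t + s) X'"
      unfolding X'_def[abs_def] using st by (intro past_lipschitz[OF _ lip] past_Z) auto
    note fX' = fin_past[OF pX']
    let ?d = "\<lambda>\<omega>. Z s (t + s) n \<omega> - (Q (t + s) \<omega> - Q s \<omega>)"
    have fd: "fin ?d" using Z_L1_lim[OF st(1) st'] by (intro fin_diff L1_limD)
    have b: "(\<integral>\<omega>. \<bar>X' \<omega> - ?X \<omega>\<bar> \<partial>P) \<le> e" if P: "P \<in> \<P>" for P
    proof -
      have "(\<integral>\<omega>. \<bar>X' \<omega> - ?X \<omega>\<bar> \<partial>P) \<le> (\<integral>\<omega>. L * \<bar>?d \<omega>\<bar> + e / 2 \<partial>P)"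
      proof (rule integral_mono_AE)
        show "integrable P (\<lambda>\<omega>. \<bar>X' \<omega> - ?X \<omega>\<bar>)" using fin_integrable[OF fin_diff[OF fX' fX] P] by auto
        show "integrable P (\<lambda>\<omega>. L * \<bar>?d \<omega>\<bar> + e / 2)"
          using fin_integrable[OF fd P] fin_integrable[OF fin_const P]
          by (intro Bochner_Integration.integrable_add integrable_mult_right integrable_abs) auto
        show "AE \<omega> in P. \<bar>X' \<omega> - ?X \<omega>\<bar> \<le> L * \<bar>?d \<omega>\<bar> + e / 2"
          using increment_nonneg_AE[OF st(1) st' P]
        proof eventually_elim
          case (elim \<omega>)
          let ?R = "Q (t + s) \<omega> - Q s \<omega>"
          from elim have R: "?R \<in> {0..K}" by (simp add: K_def)
          then have "h ?R = p ?R" by (simp add: h_def clamp0_id)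
          with p(2)[OF R] hL[of "Z s (t + s) n \<omega>" ?R] show ?case unfolding X'_def by linarith
        qed
      qed
      also have "\<dots> = L * (\<integral>\<omega>. \<bar>?d \<omega>\<bar> \<partial>P) + e / 2"
        using fin_integrable[OF fd P] fin_integrable[OF fin_const P] prob_space.prob_space[OF P_prob[OF P]]
        by (subst Bochner_Integration.integral_add) auto
      also have "\<dots> \<le> (L + 1) * (e / (2 * (L + 1))) + e / 2"
        using n[OF P] L(1) by (intro add_right_mono mult_mono) auto
      also have "(L + 1) * (e / (2 * (L + 1))) = e / 2"
      proof -
        have "a * (e / (2 * a)) = e / 2" if "0 < a" for a :: real using that by simp
        from this[of "L + 1"] show ?thesis using L(1) by simp
      qed
      finally show ?thesis by simp
    qed
    have "upper_moment \<P> 1 (\<lambda>\<omega>. X' \<omega> - ?X \<omega>) \<le> ennreal e"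
      unfolding upper_moment_def
    proof (rule SUP_least)
      fix P assume P: "P \<in> \<P>"
      show "(\<integral>\<^sup>+\<omega>. ennreal (\<bar>X' \<omega> - ?X \<omega>\<bar> ^ 1) \<partial>P) \<le> ennreal e"
        using b[OF P] fin_integrable[OF fin_diff[OF fX' fX] P]
        by (simp add: nn_integral_eq_integral ennreal_leI)
    qed
    moreover have "upper_moment \<P> 1 (\<lambda>\<omega>. E X' - S) \<le> ennreal e"
      unfolding upper_moment_const using E_diff_bound[OF fX' fX b] ES by (intro ennreal_leI) simp
    moreover have "cylinder_cond_exp \<P> s X' (\<lambda>_. E X')"
      unfolding X'_def[abs_def] by (rule cylinder_cond_exp_Z[OF lip st(1) st'])
    ultimately show ?thesis using past_cylinder[OF pX'] by blast
  qed
  define e where "e n = inverse (real (Suc n))" for n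
  have "\<forall>n. \<exists>XY. cylinder_cond_exp \<P> s (fst XY) (snd XY) \<and> cylinder (fst XY) \<and>
      upper_moment \<P> 1 (\<lambda>\<omega>. fst XY \<omega> - ?X \<omega>) \<le> ennreal (e n) \<and>
      upper_moment \<P> 1 (\<lambda>\<omega>. snd XY \<omega> - S) \<le> ennreal (e n)"
    using ex[of "e _"] by (auto simp: e_def simp del: of_nat_Suc)
  from choice[OF this] obtain XY where XY: "\<And>n. cylinder_cond_exp \<P> s (fst (XY n)) (snd (XY n))"
      "\<And>n. cylinder (fst (XY n))"
      "\<And>n. upper_moment \<P> 1 (\<lambda>\<omega>. fst (XY n) \<omega> - ?X \<omega>) \<le> ennreal (e n)"
      "\<And>n. upper_moment \<P> 1 (\<lambda>\<omega>. snd (XY n) \<omega> - S) \<le> ennreal (e n)" by blast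
  have "(\<lambda>n. ennreal (e n)) \<longlonglongrightarrow> ennreal 0"
    unfolding e_def by (intro tendsto_ennrealI LIMSEQ_inverse_real_of_nat)
  then have e0: "(\<lambda>n. ennreal (e n)) \<longlonglongrightarrow> 0" by simp
  have lim: "(\<lambda>n. upper_moment \<P> 1 (\<lambda>\<omega>. fst (XY n) \<omega> - ?X \<omega>)) \<longlonglongrightarrow> 0"
    by (rule tendsto_sandwich[OF _ _ tendsto_const e0]) (use XY(3) in auto)
  have lim2: "(\<lambda>n. upper_moment \<P> 1 (\<lambda>\<omega>. snd (XY n) \<omega> - S)) \<longlonglongrightarrow> 0"
    by (rule tendsto_sandwich[OF _ _ tendsto_const e0]) (use XY(4) in auto)
  have "?X \<in> L_G \<P> 1"
    unfolding L_G_def using fin_measurable[OF fX] XY(2) lim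
    by (auto intro!: exI[of _ "\<lambda>n. fst (XY n)"])
  moreover have "(\<lambda>_. S) \<in> L_G \<P> 1"
    unfolding L_G_def using past_cylinder[OF past_const[of 0 S]] upper_moment_const[of 0]
    by (auto intro!: exI[of _ "\<lambda>_ _. S"])
  ultimately show ?thesis
    unfolding is_cond_exp_def S_def[symmetric] using XY(1) lim lim2
    by (intro conjI exI[of _ "\<lambda>n. fst (XY n)"] exI[of _ "\<lambda>n. snd (XY n)"] allI)
qed

text \<open>The upper statement for \<open>- \<phi>\<close>; an infimum is minus the supremum of the
  negatives.\<close>

lemma lower_cond_exp_increment:
  assumes phi: "continuous_on UNIV \<phi>" and st: "0 \<le> s" "0 \<le> t"
  shows "is_lower_cond_exp \<P> s (\<lambda>\<omega>. \<phi> (Q (t + s) \<omega> - Q s \<omega>)) (\<lambda>_. INF \<alpha>\<in>speeds. \<phi> (\<alpha>\<^sup>2 * t))"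
  using cond_exp_increment[OF continuous_on_minus[OF phi] st]
  by (simp add: is_lower_cond_exp_def Inf_real_def image_image)

end

section \<open>A continuous version and Stieltjes integrals\<close>

text \<open>A countable supremum, hence measurable in the path; under \<open>rat_lipschitz\<close>
  it is the continuous extension of \<open>q\<close> to real times.\<close>

definition rat_extension :: "(rat \<Rightarrow> real) \<Rightarrow> real \<Rightarrow> real" where
  "rat_extension q t = (SUP r\<in>{r. 0 \<le> r \<and> of_rat r \<le> t}. q r)"

text \<open>Only countably many conditions, so on paths of \<open>Q\<close> they hold outside one
  polar set and define a measurable event.\<close>

definition rat_lipschitz :: "real \<Rightarrow> (rat \<Rightarrow> real) \<Rightarrow> bool" where
  "rat_lipschitz L q \<longleftrightarrow> (\<forall>a b. 0 \<le> a \<longrightarrow> a \<le> b \<longrightarrow> 0 \<le> q b - q a \<and> q b - q a \<le> L * (of_rat b - of_rat a))"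

lemma rat_between:
  assumes "0 \<le> t" "0 < (e :: real)"
  obtains r :: rat where "0 \<le> r" "of_rat r \<le> t" "t - e < of_rat r"
proof (cases "t = 0")
  case True
  then show ?thesis using assms that[of 0] by simp
next
  case False
  with assms have "max 0 (t - e) < t" by auto
  then obtain r where r: "max 0 (t - e) < of_rat r" "of_rat r < t" using of_rat_dense by blast
  then have "0 \<le> r" by (metis less_imp_le max_less_iff_conj zero_less_of_rat_iff)
  with r that[of r] show ?thesis by simp
qed

lemma bdd_above_rat_lipschitz:
  fixes t :: real
  assumes "rat_lipschitz L q" shows "bdd_above (q ` {r. 0 \<le> r \<and> of_rat r \<le> t})"
proof -
  have "q r \<le> q 0 + \<bar>L\<bar> * \<bar>t\<bar>" if r: "0 \<le> r" "of_rat r \<le> t" for r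
  proof -
    have "q r - q 0 \<le> L * (of_rat r - of_rat 0)" using assms r unfolding rat_lipschitz_def by blast
    also have "\<dots> \<le> \<bar>L\<bar> * \<bar>t\<bar>"
      using r by (intro mult_mono) auto
    finally show ?thesis by simp
  qed
  then show ?thesis by (intro bdd_aboveI2[of _ _ "q 0 + \<bar>L\<bar> * \<bar>t\<bar>"]) auto
qed

text \<open>Rationals approach \<open>t\<close> from below, and there \<open>x\<close> exceeds
  \<open>q\<close> by arbitrarily little. This identifies the extension with a given value at a time
  \<open>t\<close> that may be irrational.\<close>

lemma rat_extension_eq:
  assumes q: "rat_lipschitz L q" and t: "0 \<le> t"
    and x: "\<And>r. 0 \<le> r \<Longrightarrow> of_rat r \<le> t \<Longrightarrow> 0 \<le> x - q r \<and> x - q r \<le> L * (t - of_rat r)"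
  shows "rat_extension q t = x"
  unfolding rat_extension_def
proof (rule antisym)
  let ?I = "{r. 0 \<le> r \<and> of_rat r \<le> t}"
  have "(0::rat) \<in> ?I" using t by simp
  then show "(SUP r\<in>?I. q r) \<le> x" using x by (intro cSUP_least) force+
  show "x \<le> (SUP r\<in>?I. q r)"
  proof (rule field_le_epsilon)
    fix e :: real assume e: "0 < e"
    have "0 < e / (\<bar>L\<bar> + 1)" using e by simp
    from rat_between[OF t this] obtain r where r: "0 \<le> r" "of_rat r \<le> t" "t - e / (\<bar>L\<bar> + 1) < of_rat r" by blast
    have "q r \<le> (SUP r\<in>?I. q r)" using r by (intro cSUP_upper bdd_above_rat_lipschitz[OF q]) auto
    moreover have "L * (t - of_rat r) \<le> (\<bar>L\<bar> + 1) * (e / (\<bar>L\<bar> + 1))"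
      using r by (intro mult_mono) auto
    ultimately show "x \<le> (SUP r\<in>?I. q r) + e" using x[OF r(1,2)] by simp
  qed
qed

lemma rat_extension_lipschitz:
  assumes q: "rat_lipschitz L q" and st: "0 \<le> s" "s \<le> t" and L: "0 \<le> L"
  shows "0 \<le> rat_extension q t - rat_extension q s" "rat_extension q t - rat_extension q s \<le> L * (t - s)"
proof -
  let ?I = "\<lambda>t. {r. 0 \<le> r \<and> of_rat r \<le> t}"
  have z: "(0::rat) \<in> ?I s" "(0::rat) \<in> ?I t" using st by auto
  have up: "q r \<le> rat_extension q u" if "0 \<le> r" "of_rat r \<le> u" for r u
    unfolding rat_extension_def using that by (intro cSUP_upper bdd_above_rat_lipschitz[OF q]) auto
  have "rat_extension q s \<le> rat_extension q t"
    unfolding rat_extension_def[of q s] using z st by (intro cSUP_least) (auto intro!: up)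
  then show "0 \<le> rat_extension q t - rat_extension q s" by simp
  have "rat_extension q t \<le> rat_extension q s + L * (t - s)"
    unfolding rat_extension_def[of q t]
  proof (rule cSUP_least)
    show "?I t \<noteq> {}" using z by blast
    fix r assume "r \<in> ?I t"
    then have r: "0 \<le> r" "of_rat r \<le> t" by auto
    show "q r \<le> rat_extension q s + L * (t - s)"
    proof (cases "of_rat r \<le> s")
      case True
      have "0 \<le> L * (t - s)" using st L by simp
      with up[OF r(1) True] show ?thesis by linarith
    next
      case False
      show ?thesis
      proof (rule field_le_epsilon)
        fix e :: real assume e: "0 < e"
        have "0 < e / (L + 1)" using e L by simp
        \<comment> \<open>For \<open>r\<close> beyond \<open>s\<close>, \<open>q r\<close> is
          compared with \<open>q a\<close> at a rational \<open>a\<close> just below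
          \<open>s\<close>; the gap, multiplied by \<open>L\<close>, costs at most
          \<open>e\<close>.\<close>
        from rat_between[OF st(1) this] obtain a where a: "0 \<le> a" "of_rat a \<le> s" "s - e / (L + 1) < of_rat a" by blast
        have "(of_rat a :: real) \<le> of_rat r" using a False by linarith
        then have "a \<le> r" by (simp add: of_rat_less_eq)
        then have "q r - q a \<le> L * (of_rat r - of_rat a)" using q a(1) unfolding rat_lipschitz_def by blast
        also have "\<dots> \<le> L * ((t - s) + e / (L + 1))" using L r a by (intro mult_left_mono) auto
        also have "\<dots> = L * (t - s) + L * (e / (L + 1))" by (simp add: distrib_left)
        also have "L * (e / (L + 1)) \<le> (L + 1) * (e / (L + 1))" using L e by (intro mult_right_mono) auto
        also have "(L + 1) * (e / (L + 1)) = e" using L by simp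
        finally show "q r \<le> rat_extension q s + L * (t - s) + e" using up[OF a(1,2)] by linarith
      qed
    qed
  qed
  then show "rat_extension q t - rat_extension q s \<le> L * (t - s)" by simp
qed

section \<open>Variation and Stieltjes measures of increasing functions\<close>

lemma mono_on_finite_variation:
  assumes "mono_on {0..} f" shows "finite_variation f"
  unfolding finite_variation_def
proof (intro allI impI exI)
  fix T :: real and ts assume "0 \<le> T" "partition_of T ts"
  then have ts: "ts \<noteq> []" "sorted ts" "hd ts = 0" "last ts = T" by (auto simp: partition_of_def)
  have nn: "0 \<le> ts ! i" if "i < length ts" for i
    using sorted_nth_mono[OF ts(2), of 0 i] that ts(1,3) by (simp add: hd_conv_nth)
  have "\<bar>f (ts ! Suc i) - f (ts ! i)\<bar> = f (ts ! Suc i) - f (ts ! i)" if "i < length ts - 1" for i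
    using that mono_onD[OF assms, of "ts ! i" "ts ! Suc i"] nn[of i] nn[of "Suc i"]
      sorted_nth_mono[OF ts(2), of i "Suc i"] by auto
  then have "(\<Sum>i<length ts - 1. \<bar>f (ts ! Suc i) - f (ts ! i)\<bar>) = (\<Sum>i<length ts - 1. f (ts ! Suc i) - f (ts ! i))"
    by (intro sum.cong) auto
  also have "\<dots> = f (ts ! (length ts - 1)) - f (ts ! 0)" by (rule sum_lessThan_telescope)
  finally show "(\<Sum>i<length ts - 1. \<bar>f (ts ! Suc i) - f (ts ! i)\<bar>) \<le> f T - f 0"
    using ts by (simp add: last_conv_nth hd_conv_nth)
qed

text \<open>An inequality between measures does not in general extend from an intersection-stable
  generator, an equality does. Hence the domination is given by a measure \<open>M'\<close> that
  fills the gap on intervals; then \<open>N\<close> is the sum of \<open>M\<close> and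
  \<open>M'\<close> on all Borel sets.\<close>

lemma emeasure_mono_if_Ioc_add:
  fixes M M' N :: "real measure"
  assumes sets: "sets M = sets borel" "sets M' = sets borel" "sets N = sets borel"
    and eq: "\<And>a b. emeasure M {a<..b} + emeasure M' {a<..b} = emeasure N {a<..b}"
    and fin: "\<And>a b. emeasure N {a<..b} \<noteq> \<infinity>"
    and A: "A \<in> sets borel"
  shows "emeasure M A \<le> emeasure N A"
proof -
  define S where "S = measure_of UNIV (sets borel) (\<lambda>A. emeasure M A + emeasure M' A)"
  have "countably_additive (sets borel) (\<lambda>A. emeasure M A + emeasure M' A)"
    unfolding countably_additive_def
  proof (intro allI impI)
    fix B :: "nat \<Rightarrow> real set" assume "range B \<subseteq> sets borel" "disjoint_family B"
    then have "(\<Sum>i. emeasure M (B i)) = emeasure M (\<Union>i. B i)" "(\<Sum>i. emeasure M' (B i)) = emeasure M' (\<Union>i. B i)"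
      using sets by (auto intro!: suminf_emeasure)
    then show "(\<Sum>i. emeasure M (B i) + emeasure M' (B i)) = emeasure M (\<Union>i. B i) + emeasure M' (\<Union>i. B i)"
      by (simp add: suminf_add[OF summableI summableI, symmetric])
  qed
  then have eS: "emeasure S B = emeasure M B + emeasure M' B" if "B \<in> sets borel" for B
    unfolding S_def using that sets.sigma_algebra_axioms[of borel]
    by (intro emeasure_measure_of_sigma) (auto simp: positive_def)
  have sS: "sets S = sets borel" unfolding S_def by (metis sets.sets_measure_of_eq space_borel)
  have "S = N"
  proof (rule measure_eqI_generator_eq)
    let ?E = "range (\<lambda>(a, b). {a<..b::real})"
    show "Int_stable ?E"
      unfolding Int_stable_def
    proof (intro ballI)
      fix X Y assume "X \<in> ?E" "Y \<in> ?E"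
      then obtain a b c d where "X = {a<..b}" "Y = {c<..d}" by auto
      then have "X \<inter> Y = (\<lambda>(a, b). {a<..b}) (max a c, min b d)" by auto
      then show "X \<inter> Y \<in> ?E" by blast
    qed
    show "?E \<subseteq> Pow UNIV" by simp
    show "emeasure S X = emeasure N X" if "X \<in> ?E" for X using that eq by (auto simp: eS)
    have b: "sets (borel :: real measure) = sigma_sets UNIV ?E"
      by (subst borel_sigma_sets_Ioc) simp
    show "sets S = sigma_sets UNIV ?E" "sets N = sigma_sets UNIV ?E" using sS sets b by auto
    show "range (\<lambda>n::nat. {- real n<..real n}) \<subseteq> ?E" by auto
    show "(\<Union>n::nat. {- real n<..real n}) = UNIV"
    proof (intro set_eqI iffI UNIV_I)
      fix x :: real
      obtain n :: nat where "\<bar>x\<bar> < real n" using reals_Archimedean2 by blast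
      then show "x \<in> (\<Union>n::nat. {- real n<..real n})" by (intro UN_I[of n]) auto
    qed
    show "emeasure S {- real n<..real n} \<noteq> \<infinity>" for n using fin eq by (simp add: eS)
  qed
  then show ?thesis using eS[OF A] by (metis le_iff_add)
qed

text \<open>For nonnegative \<open>c\<close>, the Stieltjes measure of the function
  \<open>c * max 0 r\<close>, written as a density so that integrals against it are multiples of
  Lebesgue integrals.\<close>

definition half_line :: "real \<Rightarrow> real measure" where
  "half_line c = density lborel (\<lambda>x. ennreal c * indicator {0..} x)"

lemma sets_half_line [simp, measurable_cong]: "sets (half_line c) = sets borel"
  by (simp add: half_line_def)

lemma emeasure_half_line:
  assumes "0 \<le> c" "a \<le> b" shows "emeasure (half_line c) {a<..b} = ennreal (c * max 0 b - c * max 0 a)"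
proof -
  have "emeasure (half_line c) {a<..b} = (\<integral>\<^sup>+x. ennreal c * indicator ({a<..b} \<inter> {0..}) x \<partial>lborel)"
    unfolding half_line_def by (subst emeasure_density) (auto intro!: nn_integral_cong simp: indicator_def)
  also have "\<dots> = ennreal c * emeasure lborel ({a<..b} \<inter> {0..})"
    by (rule nn_integral_cmult_indicator) simp
  also have "emeasure lborel ({a<..b} \<inter> {0..}) = ennreal (max 0 b - max 0 a)"
  proof (cases "0 \<le> a")
    case True
    then have "{a<..b} \<inter> {0..} = {a<..b}" by auto
    with True assms show ?thesis by simp
  next
    case False
    then have "{a<..b} \<inter> {0..} = {0..b}" by auto
    with False show ?thesis by (cases "0 \<le> b") auto
  qed
  finally show ?thesis using assms by (simp add: ennreal_mult'[symmetric] right_diff_distrib)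
qed

lemma nn_integral_half_line:
  assumes "f \<in> borel_measurable borel" "\<And>x. x < 0 \<Longrightarrow> f x = 0"
  shows "(\<integral>\<^sup>+x. f x \<partial>half_line c) = ennreal c * (\<integral>\<^sup>+x. f x \<partial>lborel)"
proof -
  have "(\<integral>\<^sup>+x. f x \<partial>half_line c) = (\<integral>\<^sup>+x. ennreal c * f x \<partial>lborel)"
    unfolding half_line_def using assms
    by (subst nn_integral_density) (auto intro!: nn_integral_cong simp: indicator_def not_le)
  then show ?thesis using assms by (simp add: nn_integral_cmult)
qed

lemma nn_integral_mono_emeasure:
  assumes "sets M = sets borel" "sets N = sets borel" "\<And>A. A \<in> sets borel \<Longrightarrow> emeasure M A \<le> emeasure N A"
  shows "(\<integral>\<^sup>+x. f x \<partial>M) \<le> (\<integral>\<^sup>+x. f x \<partial>N)"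
proof (rule nn_integral_mono_measure)
  show "sets M = sets N" using assms by simp
  with assms show "M \<le> N"
    by (simp add: le_measure)
qed

text \<open>Subtracting \<open>l\<close> times the identity from \<open>F\<close>, or
  \<open>F\<close> from \<open>u\<close> times the identity, leaves an increasing function, whose
  Stieltjes measure is the gap measure \<open>M'\<close>. After composition with
  \<open>max 0\<close> these measures do not charge negative times, so \<open>f\<close> has to
  vanish there to match the Lebesgue integral.\<close>

lemma stieltjes_bounds:
  fixes F :: "real \<Rightarrow> real"
  assumes F: "\<And>a b. 0 \<le> a \<Longrightarrow> a \<le> b \<Longrightarrow> l * (b - a) \<le> F b - F a \<and> F b - F a \<le> u * (b - a)"
    and c: "continuous_on {0..} F" and l: "0 \<le> l" and f: "f \<in> borel_measurable borel" "\<And>x. x < 0 \<Longrightarrow> f x = 0"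
  shows "ennreal l * (\<integral>\<^sup>+x. f x \<partial>lborel) \<le> (\<integral>\<^sup>+x. f x \<partial>interval_measure (\<lambda>r. F (max 0 r)))"
    and "(\<integral>\<^sup>+x. f x \<partial>interval_measure (\<lambda>r. F (max 0 r))) \<le> ennreal u * (\<integral>\<^sup>+x. f x \<partial>lborel)"
proof -
  have u: "0 \<le> u" using F[of 0 1] l by simp
  let ?G = "\<lambda>r. F (max 0 r)"
  have cG: "continuous_on UNIV ?G"
    by (rule continuous_on_compose2[OF c]) (auto intro!: continuous_intros)
  have G: "l * (max 0 y - max 0 x) \<le> ?G y - ?G x" "?G y - ?G x \<le> u * (max 0 y - max 0 x)" if "x \<le> y" for x y
    using F[of "max 0 x" "max 0 y"] that by auto
  have rc: "continuous (at_right a) H" if "continuous_on UNIV H" for H :: "real \<Rightarrow> real" and a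
    using that by (simp add: continuous_at_imp_continuous_at_within continuous_on_eq_continuous_at)
  have Ioc: "emeasure (interval_measure H) {a<..b} = (if a \<le> b then ennreal (H b - H a) else 0)"
    if "\<And>x y. x \<le> y \<Longrightarrow> H x \<le> H y" "continuous_on UNIV H" for H a b
    by (subst emeasure_interval_measure_Ioc_eq) (auto intro: that rc)
  have mono: "?G x \<le> ?G y" if "x \<le> y" for x y
  proof -
    have "0 \<le> l * (max 0 y - max 0 x)" using that l by (intro mult_nonneg_nonneg) auto
    with G(1)[OF that] show ?thesis by linarith
  qed
  have "emeasure (half_line l) A \<le> emeasure (interval_measure ?G) A" if "A \<in> sets borel" for A
  proof (rule emeasure_mono_if_Ioc_add[where M' = "interval_measure (\<lambda>r. ?G r - l * max 0 r)"])
    have m: "?G x - l * max 0 x \<le> ?G y - l * max 0 y" if "x \<le> y" for x y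
      using G(1)[OF that] by (simp add: right_diff_distrib)
    show "emeasure (half_line l) {a<..b} + emeasure (interval_measure (\<lambda>r. ?G r - l * max 0 r)) {a<..b}
        = emeasure (interval_measure ?G) {a<..b}" for a b
    proof (cases "a \<le> b")
      case True
      have "0 \<le> l * max 0 b - l * max 0 a" using True l by (simp add: mult_left_mono)
      with True m[OF True] show ?thesis
        by (subst Ioc[OF m], simp, intro continuous_intros cG, subst Ioc[OF mono cG], simp)
          (simp add: emeasure_half_line[OF l] ennreal_plus[symmetric] del: ennreal_plus)
    qed simp
    show "emeasure (interval_measure ?G) {a<..b} \<noteq> \<infinity>" for a b by (simp add: Ioc[OF mono cG])
  qed (use that in auto)
  from nn_integral_mono_emeasure[OF _ _ this, of f]
  show "ennreal l * (\<integral>\<^sup>+x. f x \<partial>lborel) \<le> (\<integral>\<^sup>+x. f x \<partial>interval_measure ?G)"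
    by (simp add: nn_integral_half_line[OF f])
  have "emeasure (interval_measure ?G) A \<le> emeasure (half_line u) A" if "A \<in> sets borel" for A
  proof (rule emeasure_mono_if_Ioc_add[where M' = "interval_measure (\<lambda>r. u * max 0 r - ?G r)"])
    have m: "u * max 0 x - ?G x \<le> u * max 0 y - ?G y" if "x \<le> y" for x y
      using G(2)[OF that] by (simp add: right_diff_distrib)
    show "emeasure (interval_measure ?G) {a<..b} + emeasure (interval_measure (\<lambda>r. u * max 0 r - ?G r)) {a<..b}
        = emeasure (half_line u) {a<..b}" for a b
    proof (cases "a \<le> b")
      case True
      with m[OF True] mono[OF True] show ?thesis
        by (subst Ioc[OF m], simp, intro continuous_intros cG, subst Ioc[OF mono cG], simp)
          (simp add: emeasure_half_line[OF u] ennreal_plus[symmetric] del: ennreal_plus)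
    qed simp
    show "emeasure (half_line u) {a<..b} \<noteq> \<infinity>" for a b
      by (cases "a \<le> b") (simp_all add: emeasure_half_line[OF u])
  qed (use that in auto)
  from nn_integral_mono_emeasure[OF _ _ this, of f]
  show "(\<integral>\<^sup>+x. f x \<partial>interval_measure ?G) \<le> ennreal u * (\<integral>\<^sup>+x. f x \<partial>lborel)"
    by (simp add: nn_integral_half_line[OF f])
qed

lemma rational_bounds_extend:
  fixes F :: "real \<Rightarrow> real"
  assumes c: "continuous_on {0..} F"
    and F: "\<And>p q :: rat. 0 \<le> p \<Longrightarrow> p \<le> q \<Longrightarrow> F (of_rat q) - F (of_rat p) \<in> {l * (of_rat q - of_rat p)..u * (of_rat q - of_rat p)}"
    and ab: "0 \<le> a" "a \<le> b"
  shows "F b - F a \<in> {l * (b - a)..u * (b - a)}"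
proof -
  \<comment> \<open>Approximation from above keeps the rationals nonnegative.\<close>
  have app: "\<exists>r :: nat \<Rightarrow> rat. (\<forall>n. x \<le> of_rat (r n)) \<and> (\<lambda>n. of_rat (r n)) \<longlonglongrightarrow> x" for x :: real
  proof -
    have "\<exists>r :: rat. x \<le> of_rat r \<and> of_rat r < x + inverse (real (Suc n))" for n
    proof -
      have "x < x + inverse (real (Suc n))" by simp
      from of_rat_dense[OF this] show ?thesis by (auto intro: less_imp_le)
    qed
    then obtain r :: "nat \<Rightarrow> rat" where r: "\<And>n. x \<le> of_rat (r n)" "\<And>n. of_rat (r n) < x + inverse (real (Suc n))"
      by metis
    have "(\<lambda>n. of_rat (r n)) \<longlonglongrightarrow> x"
    proof (rule tendsto_sandwich[OF _ _ tendsto_const])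
      show "(\<lambda>n. x + inverse (real (Suc n))) \<longlonglongrightarrow> x"
        using tendsto_add[OF tendsto_const LIMSEQ_inverse_real_of_nat, of x] by simp
    qed (use r less_imp_le in \<open>auto intro!: always_eventually\<close>)
    with r show ?thesis by blast
  qed
  show ?thesis
  proof (cases "a = b")
    case False
    with ab have "a < b" by simp
    obtain p :: "nat \<Rightarrow> rat" where p: "\<And>n. a \<le> of_rat (p n)" "(\<lambda>n. real_of_rat (p n)) \<longlonglongrightarrow> a" using app by blast
    obtain q :: "nat \<Rightarrow> rat" where q: "\<And>n. b \<le> of_rat (q n)" "(\<lambda>n. real_of_rat (q n)) \<longlonglongrightarrow> b" using app by blast
    have Fp: "(\<lambda>n. F (of_rat (p n))) \<longlonglongrightarrow> F a"
      by (rule continuous_on_tendsto_compose[OF c p(2)]) (use order_trans[OF ab(1) p(1)] ab in auto)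
    have Fq: "(\<lambda>n. F (of_rat (q n))) \<longlonglongrightarrow> F b"
      by (rule continuous_on_tendsto_compose[OF c q(2)]) (use order_trans[OF order_trans[OF ab] q(1)] ab in auto)
    \<comment> \<open>\<open>p n\<close> is eventually below \<open>b\<close>, hence below
      \<open>q n\<close>; this is why the case \<open>a = b\<close> is treated apart.\<close>
    have ev: "\<forall>\<^sub>F n in sequentially. l * (of_rat (q n) - of_rat (p n)) \<le> F (of_rat (q n)) - F (of_rat (p n)) \<and>
        F (of_rat (q n)) - F (of_rat (p n)) \<le> u * (of_rat (q n) - of_rat (p n))"
      using order_tendstoD(2)[OF p(2) \<open>a < b\<close>]
    proof eventually_elim
      case (elim n)
      have "real_of_rat (p n) \<le> of_rat (q n)" "0 \<le> real_of_rat (p n)" using elim q(1)[of n] p(1)[of n] ab by linarith+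
      then have "0 \<le> p n" "p n \<le> q n" by (auto simp: of_rat_less_eq)
      from F[OF this] show ?case by simp
    qed
    have "l * (b - a) \<le> F b - F a"
      by (rule tendsto_le[OF sequentially_bot tendsto_diff[OF Fq Fp] tendsto_mult_left[OF tendsto_diff[OF q(2) p(2)]]])
        (use ev in \<open>auto elim: eventually_mono\<close>)
    moreover have "F b - F a \<le> u * (b - a)"
      by (rule tendsto_le[OF sequentially_bot tendsto_mult_left[OF tendsto_diff[OF q(2) p(2)]] tendsto_diff[OF Fq Fp]])
        (use ev in \<open>auto elim: eventually_mono\<close>)
    ultimately show ?thesis by simp
  qed simp
qed

section \<open>Quasi-sure events\<close>

context gbm
begin

lemma quasi_surely_iff:
  "quasi_surely \<P> R \<longleftrightarrow> (\<exists>A\<in>sets borel. (\<forall>P\<in>\<P>. emeasure P A = 0) \<and> (\<forall>\<omega>. \<omega> \<notin> A \<longrightarrow> R \<omega>))"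
proof -
  have "(SUP P\<in>\<P>. emeasure P A) = 0 \<longleftrightarrow> (\<forall>P\<in>\<P>. emeasure P A = 0)" for A
    by (simp add: SUP_bot_conv(1)[of "\<lambda>P. emeasure P A" \<P>, unfolded bot_ennreal])
  then show ?thesis unfolding quasi_surely_def by simp
qed

lemma quasi_surely_mono: "quasi_surely \<P> R \<Longrightarrow> (\<And>\<omega>. R \<omega> \<Longrightarrow> R' \<omega>) \<Longrightarrow> quasi_surely \<P> R'"
  unfolding quasi_surely_def by (erule bexE, rule bexI) auto

lemma quasi_surely_countable:
  assumes "\<And>i :: 'i :: countable. quasi_surely \<P> (R i)"
  shows "quasi_surely \<P> (\<lambda>\<omega>. \<forall>i. R i \<omega>)"
proof -
  have "\<forall>i. \<exists>A. A \<in> sets borel \<and> (\<forall>P\<in>\<P>. emeasure P A = 0) \<and> (\<forall>\<omega>. \<omega> \<notin> A \<longrightarrow> R i \<omega>)"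
    using assms unfolding quasi_surely_iff by blast
  from choice[OF this] obtain A where A: "\<And>i. A i \<in> sets borel" "\<And>i P. P \<in> \<P> \<Longrightarrow> emeasure P (A i) = 0"
    "\<And>i \<omega>. \<omega> \<notin> A i \<Longrightarrow> R i \<omega>" by blast
  have "emeasure P (\<Union>i. A i) = 0" if P: "P \<in> \<P>" for P
  proof -
    have "A i \<in> null_sets P" for i using A(1,2) P by (simp add: null_sets_def P_sets[OF P])
    then have "(\<Union>i. A i) \<in> null_sets P" by (rule null_sets_UN)
    then show ?thesis by (rule null_setsD1)
  qed
  moreover have "(\<Union>i. A i) \<in> sets borel" using A(1) by (intro sets.countable_UN'') auto
  ultimately show ?thesis unfolding quasi_surely_iff using A(3) by (intro bexI[of _ "\<Union>i. A i"]) auto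
qed

lemma quasi_surely_conj:
  assumes "quasi_surely \<P> R" "quasi_surely \<P> R'" shows "quasi_surely \<P> (\<lambda>\<omega>. R \<omega> \<and> R' \<omega>)"
proof -
  have "quasi_surely \<P> (\<lambda>\<omega>. \<forall>b. if b then R \<omega> else R' \<omega>)"
  proof (rule quasi_surely_countable)
    show "quasi_surely \<P> (\<lambda>\<omega>. if b then R \<omega> else R' \<omega>)" for b using assms by (cases b) auto
  qed
  then show ?thesis by (rule quasi_surely_mono) (metis (full_types))
qed

text \<open>The null sets of the measures in \<open>\<P>\<close> may all differ, while
  \<open>quasi_surely\<close> wants one Borel set for all of them; the failure set itself serves
  once it is measurable.\<close>

lemma quasi_surelyI_AE:
  assumes "{\<omega>. R \<omega>} \<in> sets borel" "\<And>P. P \<in> \<P> \<Longrightarrow> AE \<omega> in P. R \<omega>"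
  shows "quasi_surely \<P> R"
proof -
  have A: "- {\<omega>. R \<omega>} \<in> sets borel" using assms(1) by (metis sets.compl_sets space_borel Compl_eq_Diff_UNIV)
  have "emeasure P (- {\<omega>. R \<omega>}) = 0" if P: "P \<in> \<P>" for P
  proof -
    have "space P = UNIV" using sets_eq_imp_space_eq[OF P_sets[OF P]] by simp
    then have "- {\<omega>. R \<omega>} = {\<omega> \<in> space P. \<not> R \<omega>}" by auto
    then show ?thesis using assms(2)[OF P] A P_sets[OF P] by (subst (asm) AE_iff_measurable[OF _ refl]) auto
  qed
  with A show ?thesis unfolding quasi_surely_iff by (intro bexI[of _ "- {\<omega>. R \<omega>}"]) auto
qed

lemma quasi_surely_AE: "quasi_surely \<P> R \<Longrightarrow> P \<in> \<P> \<Longrightarrow> AE \<omega> in P. R \<omega>"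
proof -
  assume "quasi_surely \<P> R" and P: "P \<in> \<P>"
  then obtain A where A: "A \<in> sets borel" "emeasure P A = 0" "\<And>\<omega>. \<omega> \<notin> A \<Longrightarrow> R \<omega>"
    unfolding quasi_surely_iff by blast
  then have "A \<in> null_sets P" by (simp add: null_sets_def P_sets[OF P])
  then show ?thesis using A(3) by (intro AE_I') blast+
qed

lemma quasi_surely_True: "(\<And>\<omega>. R \<omega>) \<Longrightarrow> quasi_surely \<P> R"
  unfolding quasi_surely_iff by (intro bexI[of _ "{}"]) auto

lemma upper_moment_cong_AE:
  assumes "\<And>P. P \<in> \<P> \<Longrightarrow> AE \<omega> in P. X \<omega> = Y \<omega>" shows "upper_moment \<P> p X = upper_moment \<P> p Y"
  unfolding upper_moment_def
proof (rule SUP_cong[OF refl])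
  fix P assume "P \<in> \<P>"
  from assms[OF this] show "(\<integral>\<^sup>+\<omega>. ennreal (\<bar>X \<omega>\<bar> ^ p) \<partial>P) = (\<integral>\<^sup>+\<omega>. ennreal (\<bar>Y \<omega>\<bar> ^ p) \<partial>P)"
    by (intro nn_integral_cong_AE) (auto elim!: eventually_mono)
qed

end

section \<open>A version with continuous increasing paths\<close>

context gbm_qv
begin

lemma increment_bounds_qs:
  assumes "0 \<le> s" "s \<le> t"
  shows "quasi_surely \<P> (\<lambda>\<omega>. \<sigma>l\<^sup>2 * (t - s) \<le> Q t \<omega> - Q s \<omega> \<and> Q t \<omega> - Q s \<omega> \<le> \<sigma>u\<^sup>2 * (t - s))"
proof (rule quasi_surelyI_AE)
  have [measurable]: "Q t \<in> borel_measurable borel" "Q s \<in> borel_measurable borel"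
    using assms by (auto intro: Q_measurable)
  have "{\<omega> \<in> space borel. \<sigma>l\<^sup>2 * (t - s) \<le> Q t \<omega> - Q s \<omega> \<and> Q t \<omega> - Q s \<omega> \<le> \<sigma>u\<^sup>2 * (t - s)} \<in> sets borel"
    by measurable
  then show "{\<omega>. \<sigma>l\<^sup>2 * (t - s) \<le> Q t \<omega> - Q s \<omega> \<and> Q t \<omega> - Q s \<omega> \<le> \<sigma>u\<^sup>2 * (t - s)} \<in> sets borel" by simp
qed (rule increment_bounds_AE[OF assms])

definition Qr :: "path \<Rightarrow> rat \<Rightarrow> real" where "Qr \<omega> r = Q (of_rat r) \<omega>"

text \<open>The value 0 on the exceptional event makes every path increasing and Lipschitz on
  \<open>[0, \<infinity>)\<close>, not only quasi-every one.\<close>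

definition version :: "real \<Rightarrow> path \<Rightarrow> real" where
  "version t \<omega> = (if rat_lipschitz (\<sigma>u\<^sup>2) (Qr \<omega>) then rat_extension (Qr \<omega>) t else 0)"

lemma Qr_measurable: "0 \<le> r \<Longrightarrow> (\<lambda>\<omega>. Qr \<omega> r) \<in> borel_measurable borel"
  unfolding Qr_def by (rule Q_measurable) simp

lemma rat_lipschitz_measurable: "{\<omega>. rat_lipschitz (\<sigma>u\<^sup>2) (Qr \<omega>)} \<in> sets borel"
proof -
  have "{\<omega> \<in> space borel. 0 \<le> Qr \<omega> b - Qr \<omega> a \<and> Qr \<omega> b - Qr \<omega> a \<le> \<sigma>u\<^sup>2 * (of_rat b - of_rat a)} \<in> sets borel"
    if "0 \<le> a" "a \<le> b" for a b
  proof -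
    have [measurable]: "(\<lambda>\<omega>. Qr \<omega> b) \<in> borel_measurable borel" "(\<lambda>\<omega>. Qr \<omega> a) \<in> borel_measurable borel"
      using that by (auto intro: Qr_measurable)
    show ?thesis by measurable
  qed
  then have "{\<omega> \<in> space borel. 0 \<le> a \<longrightarrow> a \<le> b \<longrightarrow> 0 \<le> Qr \<omega> b - Qr \<omega> a \<and> Qr \<omega> b - Qr \<omega> a \<le> \<sigma>u\<^sup>2 * (of_rat b - of_rat a)} \<in> sets borel" for a b
    by (cases "0 \<le> a \<and> a \<le> b") auto
  then have "{\<omega> \<in> space borel. \<forall>a b. 0 \<le> a \<longrightarrow> a \<le> b \<longrightarrow> 0 \<le> Qr \<omega> b - Qr \<omega> a \<and> Qr \<omega> b - Qr \<omega> a \<le> \<sigma>u\<^sup>2 * (of_rat b - of_rat a)} \<in> sets borel"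
    by (intro sets.sets_Collect_countable_All)
  then show ?thesis by (simp add: rat_lipschitz_def)
qed

lemma version_measurable: "0 \<le> t \<Longrightarrow> version t \<in> borel_measurable borel"
proof -
  \<comment> \<open>The case distinction is moved inside the supremum, so that the family is bounded
    above for every \<open>\<omega>\<close>.\<close>
  let ?g = "\<lambda>r \<omega>. if rat_lipschitz (\<sigma>u\<^sup>2) (Qr \<omega>) then Qr \<omega> r else 0"
  let ?I = "{r. 0 \<le> r \<and> of_rat r \<le> t}"
  assume t: "0 \<le> t"
  then have z: "(0::rat) \<in> ?I" by simp
  have "version t \<omega> = (SUP r\<in>?I. ?g r \<omega>)" for \<omega>
  proof (cases "rat_lipschitz (\<sigma>u\<^sup>2) (Qr \<omega>)")
    case False
    have "(SUP r\<in>?I. 0 :: real) = 0" using z by (intro cSUP_const) blast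
    with False show ?thesis by (simp add: version_def)
  qed (simp add: version_def rat_extension_def)
  moreover have "(\<lambda>\<omega>. SUP r\<in>?I. ?g r \<omega>) \<in> borel_measurable borel"
  proof (rule borel_measurable_cSUP)
    show "?g r \<in> borel_measurable borel" if "r \<in> ?I" for r
      using that rat_lipschitz_measurable Qr_measurable[of r] by (intro measurable_If) auto
    show "bdd_above ((\<lambda>r. ?g r \<omega>) ` ?I)" for \<omega>
    proof (cases "rat_lipschitz (\<sigma>u\<^sup>2) (Qr \<omega>)")
      case True
      then show ?thesis using bdd_above_rat_lipschitz[OF True, of t] by simp
    qed (auto intro: bdd_aboveI2[of _ _ 0])
  qed auto
  ultimately show ?thesis by (simp cong: measurable_cong)
qed

lemma rational_bounds_qs:
  "quasi_surely \<P> (\<lambda>\<omega>. \<forall>a b :: rat. 0 \<le> a \<longrightarrow> a \<le> b \<longrightarrow>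
     Q (of_rat b) \<omega> - Q (of_rat a) \<omega> \<in> {\<sigma>l\<^sup>2 * (of_rat b - of_rat a)..\<sigma>u\<^sup>2 * (of_rat b - of_rat a)})"
proof (intro quasi_surely_countable)
  fix a b :: rat
  show "quasi_surely \<P> (\<lambda>\<omega>. 0 \<le> a \<longrightarrow> a \<le> b \<longrightarrow>
     Q (of_rat b) \<omega> - Q (of_rat a) \<omega> \<in> {\<sigma>l\<^sup>2 * (of_rat b - of_rat a)..\<sigma>u\<^sup>2 * (of_rat b - of_rat a)})"
  proof (cases "0 \<le> a \<and> a \<le> b")
    case True
    then have "0 \<le> real_of_rat a" "real_of_rat a \<le> of_rat b" by (auto simp: of_rat_less_eq)
    from increment_bounds_qs[OF this] show ?thesis by (rule quasi_surely_mono) auto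
  qed (auto intro: quasi_surely_True)
qed

text \<open>For the fixed \<open>t\<close>, the bounds between \<open>t\<close> and all rationals
  below it hold outside one polar set, and there \<open>rat_extension_eq\<close> applies. That set
  depends on \<open>t\<close>: the two processes agree at each time, but need not agree at all times
  at once.\<close>

lemma version_eq_qs:
  assumes t: "0 \<le> t" shows "quasi_surely \<P> (\<lambda>\<omega>. version t \<omega> = Q t \<omega>)"
proof -
  have "quasi_surely \<P> (\<lambda>\<omega>. \<forall>r :: rat. 0 \<le> r \<longrightarrow> of_rat r \<le> t \<longrightarrow>
      0 \<le> Q t \<omega> - Q (of_rat r) \<omega> \<and> Q t \<omega> - Q (of_rat r) \<omega> \<le> \<sigma>u\<^sup>2 * (t - of_rat r))"
  proof (rule quasi_surely_countable)
    fix r :: rat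
    show "quasi_surely \<P> (\<lambda>\<omega>. 0 \<le> r \<longrightarrow> of_rat r \<le> t \<longrightarrow>
      0 \<le> Q t \<omega> - Q (of_rat r) \<omega> \<and> Q t \<omega> - Q (of_rat r) \<omega> \<le> \<sigma>u\<^sup>2 * (t - of_rat r))"
    proof (cases "0 \<le> r \<and> of_rat r \<le> t")
      case True
      then have r: "0 \<le> real_of_rat r" "of_rat r \<le> t" by auto
      have "0 \<le> \<sigma>l\<^sup>2 * (t - of_rat r)" using r by simp
      with increment_bounds_qs[OF r] show ?thesis by (elim quasi_surely_mono) linarith
    qed (auto intro: quasi_surely_True)
  qed
  from quasi_surely_conj[OF this rational_bounds_qs] show ?thesis
  proof (rule quasi_surely_mono)
    fix \<omega> assume \<omega>: "(\<forall>r :: rat. 0 \<le> r \<longrightarrow> of_rat r \<le> t \<longrightarrow>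
      0 \<le> Q t \<omega> - Q (of_rat r) \<omega> \<and> Q t \<omega> - Q (of_rat r) \<omega> \<le> \<sigma>u\<^sup>2 * (t - of_rat r)) \<and>
      (\<forall>a b :: rat. 0 \<le> a \<longrightarrow> a \<le> b \<longrightarrow>
        Q (of_rat b) \<omega> - Q (of_rat a) \<omega> \<in> {\<sigma>l\<^sup>2 * (of_rat b - of_rat a)..\<sigma>u\<^sup>2 * (of_rat b - of_rat a)})"
    have q: "rat_lipschitz (\<sigma>u\<^sup>2) (Qr \<omega>)"
      unfolding rat_lipschitz_def
    proof (intro allI impI)
      fix a b :: rat assume ab: "0 \<le> a" "a \<le> b"
      then have "0 \<le> \<sigma>l\<^sup>2 * (of_rat b - of_rat a)" by (simp add: of_rat_less_eq)
      moreover have "Q (of_rat b) \<omega> - Q (of_rat a) \<omega> \<in> {\<sigma>l\<^sup>2 * (of_rat b - of_rat a)..\<sigma>u\<^sup>2 * (of_rat b - of_rat a)}"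
        using \<omega> ab by blast
      ultimately show "0 \<le> Qr \<omega> b - Qr \<omega> a \<and> Qr \<omega> b - Qr \<omega> a \<le> \<sigma>u\<^sup>2 * (of_rat b - of_rat a)"
        unfolding Qr_def atLeastAtMost_iff by linarith
    qed
    have "rat_extension (Qr \<omega>) t = Q t \<omega>"
      by (rule rat_extension_eq[OF q t]) (use \<omega> in \<open>simp add: Qr_def\<close>)
    with q show "version t \<omega> = Q t \<omega>" by (simp add: version_def)
  qed
qed

lemma version_quadratic_variation: "is_quadratic_variation \<P> version"
  unfolding is_quadratic_variation_def
proof (intro allI impI)
  fix t :: real assume t: "0 \<le> t"
  have AE: "AE \<omega> in P. version t \<omega> = Q t \<omega>" if "P \<in> \<P>" for P
    by (rule quasi_surely_AE[OF version_eq_qs[OF t] that])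
  have eq: "upper_moment \<P> 2 (\<lambda>\<omega>. X \<omega> - version t \<omega>) = upper_moment \<P> 2 (\<lambda>\<omega>. X \<omega> - Q t \<omega>)" for X
    using AE by (intro upper_moment_cong_AE) (auto elim!: eventually_mono)
  have "Q t \<in> L_G \<P> 2 \<and> (\<forall>e>0. \<exists>d>0. \<forall>ts. partition_of t ts \<and> mesh_le ts d \<longrightarrow>
        upper_moment \<P> 2 (\<lambda>\<omega>. sum_squares ts \<omega> - Q t \<omega>) < e)"
    using QV t unfolding is_quadratic_variation_def by blast
  then show "version t \<in> L_G \<P> 2 \<and> (\<forall>e>0. \<exists>d>0. \<forall>ts. partition_of t ts \<and> mesh_le ts d \<longrightarrow>
        upper_moment \<P> 2 (\<lambda>\<omega>. sum_squares ts \<omega> - version t \<omega>) < e)"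
    using version_measurable[OF t] by (simp add: L_G_def eq)
qed

lemma version_increments: "0 \<le> s \<Longrightarrow> s \<le> t \<Longrightarrow>
    0 \<le> version t \<omega> - version s \<omega> \<and> version t \<omega> - version s \<omega> \<le> \<sigma>u\<^sup>2 * (t - s)"
  using rat_extension_lipschitz[of "\<sigma>u\<^sup>2" "Qr \<omega>" s t] by (simp add: version_def)

lemma version_mono: "mono_on {0..} (\<lambda>t. version t \<omega>)"
  using version_increments by (auto simp: mono_on_def)

lemma version_continuous: "continuous_on {0..} (\<lambda>t. version t \<omega>)"
proof (rule lipschitz_on_continuous_on)
  show "(\<sigma>u\<^sup>2)-lipschitz_on {0..} (\<lambda>t. version t \<omega>)"
  proof (rule lipschitz_onI)
    fix x y :: real assume "x \<in> {0..}" "y \<in> {0..}"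
    then show "dist (version x \<omega>) (version y \<omega>) \<le> \<sigma>u\<^sup>2 * dist x y"
      using version_increments[of x y \<omega>] version_increments[of y x \<omega>]
      by (cases "x \<le> y") (auto simp: dist_real_def)
  qed simp
qed

text \<open>Off one polar set the bounds hold between all rational times; continuity of the path
  carries them to real times, after which the estimate is pathwise.\<close>

lemma stieltjes_bounds_qs:
  assumes ci: "continuous_increasing \<P> Q"
    and \<eta>: "quasi_surely \<P> (\<lambda>\<omega>. set_borel_measurable borel {0..t} (\<lambda>s. \<eta> s \<omega>))"
  shows "quasi_surely \<P> (\<lambda>\<omega>.
     ennreal (\<sigma>l\<^sup>2) * (\<integral>\<^sup>+s\<in>{0..t}. ennreal (\<bar>\<eta> s \<omega>\<bar>\<^sup>2) \<partial>lborel)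
       \<le> (\<integral>\<^sup>+s\<in>{0..t}. ennreal (\<bar>\<eta> s \<omega>\<bar>\<^sup>2) \<partial>stieltjes Q \<omega>) \<and>
     (\<integral>\<^sup>+s\<in>{0..t}. ennreal (\<bar>\<eta> s \<omega>\<bar>\<^sup>2) \<partial>stieltjes Q \<omega>)
       \<le> ennreal (\<sigma>u\<^sup>2) * (\<integral>\<^sup>+s\<in>{0..t}. ennreal (\<bar>\<eta> s \<omega>\<bar>\<^sup>2) \<partial>lborel))"
  using quasi_surely_conj[OF \<eta> quasi_surely_conj[OF ci[unfolded continuous_increasing_def] rational_bounds_qs]]
proof (rule quasi_surely_mono)
  fix \<omega>
  assume \<omega>: "set_borel_measurable borel {0..t} (\<lambda>s. \<eta> s \<omega>) \<and>
    (continuous_on {0..} (\<lambda>t. Q t \<omega>) \<and> mono_on {0..} (\<lambda>t. Q t \<omega>)) \<and>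
    (\<forall>a b :: rat. 0 \<le> a \<longrightarrow> a \<le> b \<longrightarrow>
      Q (of_rat b) \<omega> - Q (of_rat a) \<omega> \<in> {\<sigma>l\<^sup>2 * (of_rat b - of_rat a)..\<sigma>u\<^sup>2 * (of_rat b - of_rat a)})"
  let ?f = "\<lambda>s. ennreal (\<bar>\<eta> s \<omega>\<bar>\<^sup>2) * indicator {0..t} s"
  have "(\<lambda>s. indicator {0..t} s *\<^sub>R \<eta> s \<omega>) \<in> borel_measurable borel"
    using \<omega> unfolding set_borel_measurable_def by blast
  then have "(\<lambda>s. ennreal ((indicator {0..t} s *\<^sub>R \<eta> s \<omega>)\<^sup>2)) \<in> borel_measurable borel" by measurable
  also have "(\<lambda>s. ennreal ((indicator {0..t} s *\<^sub>R \<eta> s \<omega>)\<^sup>2)) = ?f" by (auto simp: indicator_def)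
  finally have f: "?f \<in> borel_measurable borel" .
  have "l * (b - a) \<le> Q b \<omega> - Q a \<omega> \<and> Q b \<omega> - Q a \<omega> \<le> u * (b - a)"
    if "0 \<le> a" "a \<le> b" "l = \<sigma>l\<^sup>2" "u = \<sigma>u\<^sup>2" for a b l u
    using rational_bounds_extend[of "\<lambda>t. Q t \<omega>" "\<sigma>l\<^sup>2" "\<sigma>u\<^sup>2" a b] \<omega> that by auto
  from stieltjes_bounds[OF this _ _ f] \<omega>
  show "ennreal (\<sigma>l\<^sup>2) * (\<integral>\<^sup>+s. ?f s \<partial>lborel) \<le> (\<integral>\<^sup>+s. ?f s \<partial>stieltjes Q \<omega>) \<and>
     (\<integral>\<^sup>+s. ?f s \<partial>stieltjes Q \<omega>) \<le> ennreal (\<sigma>u\<^sup>2) * (\<integral>\<^sup>+s. ?f s \<partial>lborel)"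
    unfolding stieltjes_def by auto
qed

end

text \<open>Path regularity is claimed for a version \<open>A\<close>, since \<open>Q\<close> is
  determined at each time only up to a polar set; the statements about laws and about fixed times
  hold for \<open>Q\<close> as given. The Stieltjes inequality needs regular paths to make sense and
  is claimed for every continuous increasing version.\<close>

theorem proposition2p3:
  fixes \<sigma>l \<sigma>u :: real and \<P> :: "path measure set" and Q :: "real \<Rightarrow> path \<Rightarrow> real"
  assumes GBM: "G_Brownian_motion \<sigma>l \<sigma>u \<P>"
    and QV: "is_quadratic_variation \<P> Q"
  shows
   "(upper_exp \<P> (Q 1) = \<sigma>u\<^sup>2 \<and> lower_exp \<P> (Q 1) = \<sigma>l\<^sup>2) \<and>
    ((\<exists>A. is_quadratic_variation \<P> A \<and> (\<forall>t\<ge>0. quasi_surely \<P> (\<lambda>\<omega>. A t \<omega> = Q t \<omega>)) \<and>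
        continuous_increasing \<P> A \<and> quasi_surely \<P> (\<lambda>\<omega>. finite_variation (\<lambda>t. A t \<omega>))) \<and>
     independent_increments \<P> Q \<and> stationary_increments \<P> Q) \<and>
    (\<forall>s\<ge>0. \<forall>t\<ge>0. \<forall>\<phi> :: real \<Rightarrow> real. continuous_on UNIV \<phi> \<longrightarrow>
       is_cond_exp \<P> s (\<lambda>\<omega>. \<phi> (Q (t + s) \<omega> - Q s \<omega>))
         (\<lambda>_. SUP \<alpha>\<in>{\<alpha>. \<sigma>l\<^sup>2 \<le> \<alpha>\<^sup>2 \<and> \<alpha>\<^sup>2 \<le> \<sigma>u\<^sup>2}. \<phi> (\<alpha>\<^sup>2 * t)) \<and>
       is_lower_cond_exp \<P> s (\<lambda>\<omega>. \<phi> (Q (t + s) \<omega> - Q s \<omega>))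
         (\<lambda>_. INF \<alpha>\<in>{\<alpha>. \<sigma>l\<^sup>2 \<le> \<alpha>\<^sup>2 \<and> \<alpha>\<^sup>2 \<le> \<sigma>u\<^sup>2}. \<phi> (\<alpha>\<^sup>2 * t))) \<and>
    (\<forall>t T. 0 \<le> t \<and> t \<le> T \<longrightarrow>
       quasi_surely \<P> (\<lambda>\<omega>. \<sigma>l\<^sup>2 * (T - t) \<le> Q T \<omega> - Q t \<omega> \<and> Q T \<omega> - Q t \<omega> \<le> \<sigma>u\<^sup>2 * (T - t))) \<and>
    (\<forall>A. is_quadratic_variation \<P> A \<and> continuous_increasing \<P> A \<longrightarrow>
       (\<forall>t\<ge>0. \<forall>\<eta> :: real \<Rightarrow> path \<Rightarrow> real.
          quasi_surely \<P> (\<lambda>\<omega>. set_borel_measurable borel {0..t} (\<lambda>s. \<eta> s \<omega>) \<and>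
             (\<integral>\<^sup>+s\<in>{0..t}. ennreal (\<bar>\<eta> s \<omega>\<bar>\<^sup>2) \<partial>lborel) < \<infinity>) \<longrightarrow>
          quasi_surely \<P> (\<lambda>\<omega>.
             ennreal (\<sigma>l\<^sup>2) * (\<integral>\<^sup>+s\<in>{0..t}. ennreal (\<bar>\<eta> s \<omega>\<bar>\<^sup>2) \<partial>lborel)
               \<le> (\<integral>\<^sup>+s\<in>{0..t}. ennreal (\<bar>\<eta> s \<omega>\<bar>\<^sup>2) \<partial>stieltjes A \<omega>) \<and>
             (\<integral>\<^sup>+s\<in>{0..t}. ennreal (\<bar>\<eta> s \<omega>\<bar>\<^sup>2) \<partial>stieltjes A \<omega>)
               \<le> ennreal (\<sigma>u\<^sup>2) * (\<integral>\<^sup>+s\<in>{0..t}. ennreal (\<bar>\<eta> s \<omega>\<bar>\<^sup>2) \<partial>lborel))))"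
proof -
  interpret gbm_qv \<sigma>l \<sigma>u \<P> Q by unfold_locales (rule GBM, rule QV)
  \<comment> \<open>The lower mean is minus the upper mean of \<open>- Q 1\<close>, that is
    \<open>- gam (- 1)\<close>.\<close>
  have mean: "upper_exp \<P> (Q 1) = \<sigma>u\<^sup>2 \<and> lower_exp \<P> (Q 1) = \<sigma>l\<^sup>2"
    using E_Q[of 1 1] E_Q[of 1 "-1"] by (simp add: lower_exp_def)
  have "continuous_increasing \<P> version" "quasi_surely \<P> (\<lambda>\<omega>. finite_variation (\<lambda>t. version t \<omega>))"
    unfolding continuous_increasing_def
    by (auto intro!: quasi_surely_True version_continuous version_mono mono_on_finite_variation)
  then have exA: "\<exists>A. is_quadratic_variation \<P> A \<and> (\<forall>t\<ge>0. quasi_surely \<P> (\<lambda>\<omega>. A t \<omega> = Q t \<omega>)) \<and>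
        continuous_increasing \<P> A \<and> quasi_surely \<P> (\<lambda>\<omega>. finite_variation (\<lambda>t. A t \<omega>))"
    using version_quadratic_variation version_eq_qs by (intro exI[of _ version]) auto
  have st: "quasi_surely \<P> (\<lambda>\<omega>.
      ennreal (\<sigma>l\<^sup>2) * (\<integral>\<^sup>+s\<in>{0..t}. ennreal (\<bar>\<eta> s \<omega>\<bar>\<^sup>2) \<partial>lborel)
        \<le> (\<integral>\<^sup>+s\<in>{0..t}. ennreal (\<bar>\<eta> s \<omega>\<bar>\<^sup>2) \<partial>stieltjes A \<omega>) \<and>
      (\<integral>\<^sup>+s\<in>{0..t}. ennreal (\<bar>\<eta> s \<omega>\<bar>\<^sup>2) \<partial>stieltjes A \<omega>)
        \<le> ennreal (\<sigma>u\<^sup>2) * (\<integral>\<^sup>+s\<in>{0..t}. ennreal (\<bar>\<eta> s \<omega>\<bar>\<^sup>2) \<partial>lborel))"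
    if A: "is_quadratic_variation \<P> A" "continuous_increasing \<P> A"
      and \<eta>: "quasi_surely \<P> (\<lambda>\<omega>. set_borel_measurable borel {0..t} (\<lambda>s. \<eta> s \<omega>) \<and>
             (\<integral>\<^sup>+s\<in>{0..t}. ennreal (\<bar>\<eta> s \<omega>\<bar>\<^sup>2) \<partial>lborel) < \<infinity>)" for A t \<eta>
  proof -
    \<comment> \<open>\<open>A\<close> is itself a quadratic variation under the same
      \<open>\<P>\<close>, so everything proved for \<open>Q\<close> holds for it.\<close>
    interpret A: gbm_qv \<sigma>l \<sigma>u \<P> A by unfold_locales (rule A(1))
    show ?thesis by (rule A.stieltjes_bounds_qs[OF A(2) quasi_surely_mono[OF \<eta>]]) blast
  qed
  show ?thesis
    by (intro conjI allI impI mean[THEN conjunct1] mean[THEN conjunct2] exA independent_increments_Q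
        stationary_increments_Q cond_exp_increment lower_cond_exp_increment increment_bounds_qs st)
      (assumption | erule conjunct1 | erule conjunct2)+
qed

end
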